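(* Let $\{\mathbf Z_n\}_{n\ge 0}=\{(X_n,Y_n)\}_{n\ge 0}$, $X_0=Y_0=0$, be the anisotropic random walk on $\mathbb Z^2$ with column probabilities $\{p_j\}_{j\in\mathbb Z}$ (see context). Assume that for some constants $1<\gamma<\infty$ and $1/2<\eta<\infty$, as $k\to\infty$, $$k^{-1}\sum_{j=1}^k p_j^{-1}=2\gamma+o(k^{-\eta}),\qquad k^{-1}\sum_{j=1}^k p_{-j}^{-1}=2\gamma+o(k^{-\eta}).$$ Then, on an appropriate probability space for this random walk $\{\mathbf Z_n\}$, one can construct two independent standard Wiener processes $\{W_1(t),t\ge 0\}$ and $\{W_2(t),t\ge 0\}$ so that, with $$\mathbf W_n(t):=\left(\frac{W_1(nt\gamma^{-1})}{n^{1/2}},\ \frac{W_2(nt(1-\gamma^{-1}))}{n^{1/2}}\right),\quad t\ge 0,\ n\ge 1,$$ we have, as $n\to\infty$, $$\sup_{0\le t\le 1}\left\Vert (2n\log\log n)^{-1/2}\mathbf Z_{[nt]}-(2\log\log n)^{-1/2}\mathbf W_n(t)\right\Vert$$ $$=\sup_{0\le t\le 1}\left\Vert\left(\frac{X_{[nt]}-W_1(nt\gamma^{-1})}{(2n\log\log n)^{1/2}},\ \frac{Y_{[nt]}-W_2(nt(1-\gamma^{-1}))}{(2n\log\log n)^{1/2}}\right)\right\Vert=o(1)\quad\text{almost surely.}$$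
   Context: Anisotropic random walk: $\{p_j\}_{j\in\mathbb Z}$ are real numbers with $0<p_j\le 1/2$ for all $j$ and $\min_{j\in\mathbb Z}p_j<1/2$ (i.e. some $p_j<1/2$). $\{(X_n,Y_n)\}_{n\ge 0}$ is the Markov chain on $\mathbb Z^2$ started at $X_0=Y_0=0$ with transition probabilities, for $(j,k)\in\mathbb Z^2$, $n=0,1,2,\dots$, $$P\{(X_{n+1},Y_{n+1})=(j\pm1,k)\mid (X_n,Y_n)=(j,k)\}=p_j,$$ $$P\{(X_{n+1},Y_{n+1})=(j,k\pm1)\mid (X_n,Y_n)=(j,k)\}=\tfrac12-p_j$$ (each of the two horizontal neighbours has probability $p_j$ and each of the two vertical neighbours has probability $\frac12-p_j$). "On an appropriate probability space for the random walk one can construct" means: there is a probability space carrying a process with the same law as the walk (denoted by the same symbols) together with the Wiener processes. $[x]$ is the integer part of $x$; $\Vert\cdot\Vert$ is a norm on $\mathbb R^2$. *)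

theory Defs
  imports "HOL-Probability.Probability" "HOL-Library.Landau_Symbols"
begin

definition step_prob :: "(int \<Rightarrow> real) \<Rightarrow> int \<times> int \<Rightarrow> int \<times> int \<Rightarrow> real" where
  "step_prob p = (\<lambda>(j, k) z.
     if z = (j + 1, k) \<or> z = (j - 1, k) then p j
     else if z = (j, k + 1) \<or> z = (j, k - 1) then 1 / 2 - p j
     else 0)"

text \<open>Conditioning on the whole trajectory up to time \<open>n\<close> expresses the Markov property and the
  transition probabilities at once; trajectories of probability zero are excluded because
  division by zero is total.\<close>

definition (in prob_space) anisotropic_walk ::
    "(int \<Rightarrow> real) \<Rightarrow> (nat \<Rightarrow> 'a \<Rightarrow> int \<times> int) \<Rightarrow> bool" where
  "anisotropic_walk p Z \<longleftrightarrow>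
     (\<forall>n. random_variable (count_space UNIV) (Z n)) \<and>
     (AE \<omega> in M. Z 0 \<omega> = (0, 0)) \<and>
     (\<forall>n h z. \<P>(\<omega> in M. \<forall>i\<le>n. Z i \<omega> = h i) > 0 \<longrightarrow>
        \<P>(\<omega> in M. Z (Suc n) \<omega> = z \<bar> \<forall>i\<le>n. Z i \<omega> = h i) = step_prob p (h n) z)"

text \<open>The time set is \<open>[0, \<infinity>)\<close>: values of the process at negative times are irrelevant.\<close>

definition (in prob_space) wiener_process :: "(real \<Rightarrow> 'a \<Rightarrow> real) \<Rightarrow> bool" where
  "wiener_process W \<longleftrightarrow>
     (\<forall>t\<ge>0. random_variable borel (W t)) \<and>
     (AE \<omega> in M. W 0 \<omega> = 0) \<and>
     (\<forall>s t. 0 \<le> s \<longrightarrow> s < t \<longrightarrow>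
        distributed M lborel (\<lambda>\<omega>. W t \<omega> - W s \<omega>) (normal_density 0 (sqrt (t - s)))) \<and>
     (\<forall>n (t :: nat \<Rightarrow> real). 0 \<le> t 0 \<longrightarrow> (\<forall>i<n. t i \<le> t (Suc i)) \<longrightarrow>
        indep_vars (\<lambda>_. borel) (\<lambda>i \<omega>. W (t (Suc i)) \<omega> - W (t i) \<omega>) {..<n}) \<and>
     (AE \<omega> in M. continuous_on {0..} (\<lambda>t. W t \<omega>))"

text \<open>Independence of the processes as random elements of the product space
  \<open>\<real>\<close> to the power \<open>[0, \<infinity>)\<close>, that is, of the sigma-algebras generated by all their values.\<close>

definition (in prob_space) indep_processes ::
    "(real \<Rightarrow> 'a \<Rightarrow> real) \<Rightarrow> (real \<Rightarrow> 'a \<Rightarrow> real) \<Rightarrow> bool" where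
  "indep_processes V W \<longleftrightarrow>
     indep_var (Pi\<^sub>M {0..} (\<lambda>_. borel)) (\<lambda>\<omega>. \<lambda>t\<in>{0..}. V t \<omega>)
               (Pi\<^sub>M {0..} (\<lambda>_. borel)) (\<lambda>\<omega>. \<lambda>t\<in>{0..}. W t \<omega>)"

definition scaled_wiener ::
    "real \<Rightarrow> (real \<Rightarrow> 'a \<Rightarrow> real) \<Rightarrow> (real \<Rightarrow> 'a \<Rightarrow> real) \<Rightarrow> nat \<Rightarrow> real \<Rightarrow> 'a \<Rightarrow> real \<times> real" where
  "scaled_wiener \<gamma> W1 W2 n t \<omega> =
     (W1 (real n * t * (1 / \<gamma>)) \<omega> / sqrt (real n),
      W2 (real n * t * (1 - 1 / \<gamma>)) \<omega> / sqrt (real n))"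

definition int_pair_to_plane :: "int \<times> int \<Rightarrow> real \<times> real" where
  "int_pair_to_plane = map_prod real_of_int real_of_int"

text \<open>An arbitrary norm on the plane; nonnegativity follows from the other axioms.\<close>

definition norm_on_plane :: "(real \<times> real \<Rightarrow> real) \<Rightarrow> bool" where
  "norm_on_plane N \<longleftrightarrow>
     (\<forall>v. N v = 0 \<longleftrightarrow> v = 0) \<and>
     (\<forall>c v. N (c *\<^sub>R v) = \<bar>c\<bar> * N v) \<and>
     (\<forall>u v. N (u + v) \<le> N u + N v)"

end

theory Submission
  imports Defs "HOL-Real_Asymp.Real_Asymp"
begin

text \<open>Two independent Wiener processes are built by Levy's construction. The normalized increment of
  each of them over a block of times is mapped by the quantile transform to the sign vectors of the
  block, ordered by their sum; this yields independent fair signs whose block sum is close in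
  \<open>L\<^sup>2\<close> to the increment, at a polynomial rate that comes from comparing the Rademacher sum with
  the heat flow of the normal distribution function. Hence there are simple random walks \<open>S1\<close>, \<open>S2\<close>
  on the space of the Wiener processes with \<open>S\<^sub>i n - W\<^sub>i n = o(sqrt n)\<close> almost surely.

  An independent clock decides, with probability \<open>2 * p X\<close>, that the next step is horizontal; a
  horizontal step consumes the next sign of \<open>S1\<close>, a vertical one the next sign of \<open>S2\<close>. So the walk
  is \<open>(S1 H, S2 (n - H))\<close> for the number \<open>H\<close> of horizontal steps among the first \<open>n\<close>. If \<open>f\<close> solves
  \<open>p j * (f (j + 1) + f (j - 1) - 2 * f j) = 2 * p j - 1 / \<gamma>\<close>, then \<open>H - n / \<gamma> - f X\<close> is a martingale.
  The hypothesis on the averages of \<open>1 / p\<close> bounds the gradient of \<open>f\<close> by the square root of the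
  distance, so \<open>H - n / \<gamma>\<close> has second moment \<open>O(n powr (3 / 2))\<close> and is almost surely
  \<open>O(n powr (7 / 8))\<close>. Over such a time window \<open>S1\<close> and \<open>S2\<close> move by \<open>o(sqrt n)\<close> only, and no law of
  the iterated logarithm is needed.\<close>

section \<open>Independence, subgaussian sums, and limits\<close>

text \<open>An error of o(sqrt n) suffices, so the sharp Komlos-Major-Tusnady coupling is avoided
  and signs are matched with Gaussian increments block by block. Blocks of geometric length would be
  too long: a walk moves by order sqrt n inside a block comparable with its starting time. Blocks of
  polynomial growth are short in this sense, but there are so many of them that a central limit
  theorem without a rate would not make their errors summable. This is why a polynomial rate,
  however poor, has to be proved. The second difficulty is that the number of horizontal steps
  depends on the signs of the walk itself, through the columns visited, so it is not an independent
  time change. It is only estimated in mean square, and the estimate is then combined with a modulus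
  of continuity that holds along almost every path.\<close>

lemma (in prob_space) indep_vars_blocks:
  assumes blocks: "indep_vars (\<lambda>c. PiM (F c) N) (\<lambda>c \<omega>. \<lambda>k\<in>F c. Y k \<omega>) C"
    and inner: "\<And>c. c \<in> C \<Longrightarrow> indep_vars N Y (F c)"
    and disj: "disjoint_family_on F C"
  shows "indep_vars N Y (\<Union>c\<in>C. F c)"
  unfolding indep_vars_def2
proof (intro conjI ballI indep_setsI)
  have rvY: "random_variable (N i) (Y i)" if "i \<in> (\<Union>c\<in>C. F c)" for i
    using inner that by (auto simp: indep_vars_def2)
  show "random_variable (N i) (Y i)" if "i \<in> (\<Union>c\<in>C. F c)" for i
    using rvY that .
  show "{Y i -` A \<inter> space M |A. A \<in> sets (N i)} \<subseteq> events" if "i \<in> (\<Union>c\<in>C. F c)" for i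
    using rvY[OF that] by (auto simp: measurable_sets)
  fix A J
  assume J: "J \<noteq> {}" "J \<subseteq> (\<Union>c\<in>C. F c)" "finite J"
    and A: "\<forall>j\<in>J. A j \<in> {Y j -` A \<inter> space M |A. A \<in> sets (N j)}"
  from A have "\<forall>j\<in>J. \<exists>B. A j = Y j -` B \<inter> space M \<and> B \<in> sets (N j)" by auto
  then obtain B where B: "\<And>j. j \<in> J \<Longrightarrow> A j = Y j -` B j \<inter> space M" "\<And>j. j \<in> J \<Longrightarrow> B j \<in> sets (N j)"
    by metis
  from J(2) have "\<forall>j\<in>J. \<exists>c\<in>C. j \<in> F c" by auto
  then obtain cc where cc: "\<And>j. j \<in> J \<Longrightarrow> cc j \<in> C" "\<And>j. j \<in> J \<Longrightarrow> j \<in> F (cc j)"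
    by metis
  have uniq: "cc j = c" if "j \<in> J" "c \<in> C" "j \<in> F c" for j c
    using disj cc[OF that(1)] that unfolding disjoint_family_on_def by blast
  \<comment> \<open>The finite intersection is regrouped by blocks. \<open>E c\<close> collects the
    conditions on coordinates of block \<open>c\<close>: independence of the blocks factors over
    \<open>c\<close>, and independence inside each block factors the rest.\<close>
  define E where "E c = (\<Inter>j\<in>{j\<in>J. cc j = c}. (\<lambda>f. f j) -` B j \<inter> space (PiM (F c) N))" for c
  have E: "E c \<in> sets (PiM (F c) N)" if "c \<in> cc ` J" for c
    unfolding E_def
  proof (rule sets.finite_INT)
    show "finite {j\<in>J. cc j = c}" using J by auto
    show "{j\<in>J. cc j = c} \<noteq> {}" using that by auto
    fix j assume "j \<in> {j\<in>J. cc j = c}"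
    then have "j \<in> F c" "j \<in> J" using cc by auto
    then show "(\<lambda>f. f j) -` B j \<inter> space (PiM (F c) N) \<in> sets (PiM (F c) N)"
      by (intro measurable_sets[OF measurable_component_singleton] B)
  qed
  have preim: "(\<lambda>\<omega>. \<lambda>k\<in>F c. Y k \<omega>) -` E c \<inter> space M = (\<Inter>j\<in>{j\<in>J. cc j = c}. A j)"
    if c: "c \<in> cc ` J" for c
  proof -
    have cC: "c \<in> C" using c cc by auto
    have sp: "(\<lambda>k\<in>F c. Y k \<omega>) \<in> space (PiM (F c) N)" if "\<omega> \<in> space M" for \<omega>
    proof -
      have "Y k \<omega> \<in> space (N k)" if "k \<in> F c" for k
        by (rule measurable_space[OF rvY \<open>\<omega> \<in> space M\<close>]) (use cC that in blast)
      then show ?thesis by (simp add: space_PiM PiE_iff)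
    qed
    obtain j0 where j0: "j0 \<in> J" "cc j0 = c" using c by auto
    show ?thesis
    proof (rule set_eqI)
      fix \<omega>
      have "\<omega> \<in> (\<lambda>\<omega>. \<lambda>k\<in>F c. Y k \<omega>) -` E c \<inter> space M \<longleftrightarrow>
          \<omega> \<in> space M \<and> (\<forall>j\<in>{j\<in>J. cc j = c}. (\<lambda>k\<in>F c. Y k \<omega>) j \<in> B j)"
        using sp[of \<omega>] unfolding E_def by blast
      also have "\<dots> \<longleftrightarrow> \<omega> \<in> space M \<and> (\<forall>j\<in>{j\<in>J. cc j = c}. Y j \<omega> \<in> B j)"
        using cc(2) by (metis (mono_tags, lifting) mem_Collect_eq restrict_apply')
      also have "\<dots> \<longleftrightarrow> \<omega> \<in> (\<Inter>j\<in>{j\<in>J. cc j = c}. A j)"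
        using B(1) j0 by auto
      finally show "\<omega> \<in> (\<lambda>\<omega>. \<lambda>k\<in>F c. Y k \<omega>) -` E c \<inter> space M \<longleftrightarrow> \<omega> \<in> (\<Inter>j\<in>{j\<in>J. cc j = c}. A j)" .
    qed
  qed
  have "(\<Inter>j\<in>J. A j) = (\<Inter>c\<in>cc ` J. (\<lambda>\<omega>. \<lambda>k\<in>F c. Y k \<omega>) -` E c \<inter> space M)"
    using preim by auto
  also have "prob \<dots> = (\<Prod>c\<in>cc ` J. prob ((\<lambda>\<omega>. \<lambda>k\<in>F c. Y k \<omega>) -` E c \<inter> space M))"
    using J cc E by (intro indep_varsD[OF blocks]) auto
  also have "\<dots> = (\<Prod>c\<in>cc ` J. \<Prod>j\<in>{j\<in>J. cc j = c}. prob (A j))"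
  proof (rule prod.cong[OF refl])
    fix c assume c: "c \<in> cc ` J"
    have cC: "c \<in> C" using c cc by auto
    have "prob (\<Inter>j\<in>{j\<in>J. cc j = c}. A j) = prob (\<Inter>j\<in>{j\<in>J. cc j = c}. Y j -` B j \<inter> space M)"
      using B by (intro arg_cong[where f=prob]) auto
    also have "\<dots> = (\<Prod>j\<in>{j\<in>J. cc j = c}. prob (Y j -` B j \<inter> space M))"
    proof (rule indep_varsD[OF inner[OF cC]])
      show "{j\<in>J. cc j = c} \<subseteq> F c" using cc(2) by blast
    qed (use c J B in auto)
    also have "\<dots> = (\<Prod>j\<in>{j\<in>J. cc j = c}. prob (A j))"
      using B by (intro prod.cong) auto
    finally show "prob ((\<lambda>\<omega>. \<lambda>k\<in>F c. Y k \<omega>) -` E c \<inter> space M) = (\<Prod>j\<in>{j\<in>J. cc j = c}. prob (A j))"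
      using preim[OF c] by simp
  qed
  also have "\<dots> = (\<Prod>j\<in>J. prob (A j))"
    using J by (intro prod.group) auto
  finally show "prob (\<Inter>j\<in>J. A j) = (\<Prod>j\<in>J. prob (A j))" .
qed

text \<open>By Tonelli the sum has finite expectation. This is the form of Borel-Cantelli used with
  second moments: almost surely the terms of the series tend to 0.\<close>

lemma AE_summable_of_summable_integral:
  fixes Y :: "nat \<Rightarrow> 'a \<Rightarrow> real"
  assumes "\<And>i. integrable M (Y i)" "\<And>i x. x \<in> space M \<Longrightarrow> 0 \<le> Y i x"
    and "\<And>i. (\<integral>x. Y i x \<partial>M) \<le> c i" "summable c"
  shows "AE x in M. summable (\<lambda>i. Y i x)"
proof -
  have [measurable]: "Y i \<in> borel_measurable M" for i using assms(1) by auto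
  have c0: "0 \<le> c i" for i
    using assms(2) by (intro order_trans[OF integral_nonneg_AE[OF AE_I2] assms(3)[of i]]) auto
  have "(\<integral>\<^sup>+x. (\<Sum>i. ennreal (Y i x)) \<partial>M) = (\<Sum>i. \<integral>\<^sup>+x. ennreal (Y i x) \<partial>M)"
    by (rule nn_integral_suminf) simp
  also have "\<dots> \<le> (\<Sum>i. ennreal (c i))"
    by (intro suminf_le) (auto simp: nn_integral_eq_integral assms ennreal_leI)
  also have "\<dots> = ennreal (\<Sum>i. c i)" using c0 assms(4) by (intro suminf_ennreal2) auto
  also have "\<dots> < \<infinity>" by simp
  finally have "AE x in M. (\<Sum>i. ennreal (Y i x)) \<noteq> \<infinity>"
    by (intro nn_integral_noteq_infinite) auto
  then show ?thesis
  proof (rule AE_mp, intro AE_I2 impI)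
    fix x assume "x \<in> space M" "(\<Sum>i. ennreal (Y i x)) \<noteq> \<infinity>"
    then show "summable (\<lambda>i. Y i x)" using assms(2) by (intro summable_suminf_not_top) auto
  qed
qed

text \<open>The variance proxy is fixed to 1, which fits a fair sign as well as a standard normal
  variable. Sign sums and Gaussian sums thereby share one fluctuation estimate.\<close>

definition (in prob_space) subgaussian :: "('a \<Rightarrow> real) \<Rightarrow> bool" where
  "subgaussian X \<longleftrightarrow> random_variable borel X \<and>
     (\<forall>l. integrable M (\<lambda>\<omega>. exp (l * X \<omega>)) \<and> expectation (\<lambda>\<omega>. exp (l * X \<omega>)) \<le> exp (l\<^sup>2 / 2))"

lemma (in prob_space) subgaussian_sum:
  assumes "finite I" "indep_vars (\<lambda>_. borel) X I" "\<And>i. i \<in> I \<Longrightarrow> subgaussian (X i)"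
  shows "integrable M (\<lambda>\<omega>. exp (l * (\<Sum>i\<in>I. X i \<omega>)))"
    and "expectation (\<lambda>\<omega>. exp (l * (\<Sum>i\<in>I. X i \<omega>))) \<le> exp (real (card I) * l\<^sup>2 / 2)"
proof -
  have ind: "indep_vars (\<lambda>_. borel) (\<lambda>i \<omega>. exp (l * X i \<omega>)) I"
    by (rule indep_vars_compose2[OF assms(2)]) auto
  have int: "integrable M (\<lambda>\<omega>. exp (l * X i \<omega>))" if "i \<in> I" for i
    using assms(3)[OF that] by (auto simp: subgaussian_def)
  have eq: "exp (l * (\<Sum>i\<in>I. X i \<omega>)) = (\<Prod>i\<in>I. exp (l * X i \<omega>))" for \<omega>
    using assms(1) by (simp add: exp_sum sum_distrib_left)
  show "integrable M (\<lambda>\<omega>. exp (l * (\<Sum>i\<in>I. X i \<omega>)))"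
    unfolding eq by (rule indep_vars_integrable[OF assms(1) ind int])
  have "expectation (\<lambda>\<omega>. exp (l * (\<Sum>i\<in>I. X i \<omega>))) = (\<Prod>i\<in>I. expectation (\<lambda>\<omega>. exp (l * X i \<omega>)))"
    unfolding eq by (rule indep_vars_lebesgue_integral[OF assms(1) ind int])
  also have "\<dots> \<le> (\<Prod>i\<in>I. exp (l\<^sup>2 / 2))"
    using assms(3) by (intro prod_mono) (auto simp: subgaussian_def intro!: integral_nonneg_AE)
  also have "\<dots> = exp (real (card I) * l\<^sup>2 / 2)"
    by (simp add: exp_of_nat_mult[symmetric])
  finally show "expectation (\<lambda>\<omega>. exp (l * (\<Sum>i\<in>I. X i \<omega>))) \<le> exp (real (card I) * l\<^sup>2 / 2)" .
qed

lemma (in prob_space) chernoff_two_sided: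
  assumes [measurable]: "random_variable borel X" and v: "0 < v" and x: "0 \<le> x"
    and "\<And>l. integrable M (\<lambda>\<omega>. exp (l * X \<omega>))"
    and "\<And>l. expectation (\<lambda>\<omega>. exp (l * X \<omega>)) \<le> exp (v * l\<^sup>2 / 2)"
  shows "prob {\<omega>\<in>space M. x \<le> \<bar>X \<omega>\<bar>} \<le> 2 * exp (- x\<^sup>2 / (2 * v))"
proof -
  \<comment> \<open>The minimiser of the exponent
    \<open>- l * x + v * l\<^sup>2 / 2\<close>.\<close>
  define l where "l = x / v"
  have l: "0 \<le> l" using v x by (simp add: l_def)
  have "prob {\<omega>\<in>space M. x \<le> \<bar>X \<omega>\<bar>} = expectation (indicator {\<omega>\<in>space M. x \<le> \<bar>X \<omega>\<bar>})"
    by simp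
  also have "\<dots> \<le> expectation (\<lambda>\<omega>. exp (- l * x) * exp (l * X \<omega>) + exp (- l * x) * exp ((- l) * X \<omega>))"
  proof (rule integral_mono)
    show "integrable M (\<lambda>\<omega>. exp (- l * x) * exp (l * X \<omega>) + exp (- l * x) * exp ((- l) * X \<omega>))"
      using assms(4) by (intro Bochner_Integration.integrable_add integrable_mult_right) 
    show "integrable M (indicator {\<omega>\<in>space M. x \<le> \<bar>X \<omega>\<bar>} :: 'a \<Rightarrow> real)"
      by (simp add: emeasure_eq_measure)
    fix \<omega> assume "\<omega> \<in> space M"
    show "indicator {\<omega>\<in>space M. x \<le> \<bar>X \<omega>\<bar>} \<omega> \<le> exp (- l * x) * exp (l * X \<omega>) + exp (- l * x) * exp ((- l) * X \<omega>)"
    proof (cases "x \<le> \<bar>X \<omega>\<bar>")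
      case True
      then have "x \<le> X \<omega> \<or> x \<le> - X \<omega>" by linarith
      then have "0 \<le> - l * x + l * X \<omega> \<or> 0 \<le> - l * x + (- l) * X \<omega>"
      proof
        assume "x \<le> X \<omega>" from mult_left_mono[OF this l] show ?thesis by simp
      next
        assume "x \<le> - X \<omega>" from mult_left_mono[OF this l] show ?thesis by simp
      qed
      then have "1 \<le> exp (- l * x + l * X \<omega>) \<or> 1 \<le> exp (- l * x + (- l) * X \<omega>)" by simp
      moreover have "0 < exp (- l * x + l * X \<omega>)" "0 < exp (- l * x + (- l) * X \<omega>)" by simp_all
      ultimately have "1 \<le> exp (- l * x + l * X \<omega>) + exp (- l * x + (- l) * X \<omega>)" by linarith
      then show ?thesis using True by (simp add: exp_add[symmetric] indicator_def del: mult_minus_left)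
    qed (simp add: indicator_def)
  qed
  also have "\<dots> = exp (- l * x) * expectation (\<lambda>\<omega>. exp (l * X \<omega>)) + exp (- l * x) * expectation (\<lambda>\<omega>. exp ((- l) * X \<omega>))"
    using assms(4)[of l] assms(4)[of "- l"]
    by (subst Bochner_Integration.integral_add) (simp_all del: mult_minus_left)
  also have "\<dots> \<le> exp (- l * x) * exp (v * l\<^sup>2 / 2) + exp (- l * x) * exp (v * l\<^sup>2 / 2)"
    using assms(5)[of l] assms(5)[of "-l"] by (intro add_mono mult_left_mono) auto
  also have "\<dots> = 2 * exp (- l * x + v * l\<^sup>2 / 2)" by (simp only: exp_add mult_2)
  also have "- l * x + v * l\<^sup>2 / 2 = - x\<^sup>2 / (2 * v)"
    using v by (simp add: l_def power2_eq_square field_simps)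
  finally show ?thesis .
qed

lemma summable_exp_neg_powr:
  fixes \<kappa> a :: real
  assumes "0 < \<kappa>"
  shows "summable (\<lambda>i::nat. (real i + 1) powr a * (2 * exp (- ((real i + 1) powr \<kappa>) / 2)))"
proof (rule summable_comparison_test_bigo)
  show "summable (\<lambda>i::nat. norm (real i powr (- 2)))"
    by (simp add: summable_real_powr_iff)
  show "(\<lambda>i::nat. (real i + 1) powr a * (2 * exp (- ((real i + 1) powr \<kappa>) / 2))) \<in> O(\<lambda>i. real i powr (- 2))"
    using assms by real_asymp
qed

text \<open>Chernoff and a union bound over the end points \<open>j\<close>. The variance proxy is
  at most \<open>(i + 1) powr a\<close> and the squared level is
  \<open>(i + 1) powr (2 * b)\<close>, so \<open>a < 2 * b\<close> makes the failure probability
  decay like a stretched exponential, which beats the number of end points and is summable in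
  \<open>i\<close>.\<close>

lemma (in prob_space) partial_sum_fluctuation:
  fixes Y :: "nat \<Rightarrow> 'a \<Rightarrow> real"
  assumes ind: "indep_vars (\<lambda>_. borel) Y UNIV" and sg: "\<And>i. subgaussian (Y i)"
    and ab: "0 < a" "a < 2 * b"
  shows "AE \<omega> in M. \<forall>\<^sub>F i in sequentially. \<forall>j\<ge>i. real (j - i) \<le> (real i + 1) powr a \<longrightarrow>
    \<bar>(\<Sum>k<j. Y k \<omega>) - (\<Sum>k<i. Y k \<omega>)\<bar> \<le> (real i + 1) powr b"
proof -
  have [measurable]: "random_variable borel (Y i)" for i using sg by (auto simp: subgaussian_def)
  \<comment> \<open>The end points of nonempty windows only: the empty window is trivial and would
    put variance 0 into the Chernoff bound.\<close>
  define J where "J i = {i<..i + nat \<lfloor>(real i + 1) powr a\<rfloor>}" for i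
  define A where "A i = (\<Union>j\<in>J i. {\<omega>\<in>space M. (real i + 1) powr b \<le> \<bar>\<Sum>k\<in>{i..<j}. Y k \<omega>\<bar>})" for i
  have [measurable]: "A i \<in> events" for i unfolding A_def J_def by (intro sets.finite_UN) auto
  have tail: "prob {\<omega>\<in>space M. (real i + 1) powr b \<le> \<bar>\<Sum>k\<in>{i..<j}. Y k \<omega>\<bar>} \<le> 2 * exp (- ((real i + 1) powr (2 * b - a)) / 2)"
    if "j \<in> J i" for i j
  proof -
    have ij: "i < j" "j - i \<le> nat \<lfloor>(real i + 1) powr a\<rfloor>"
      using that unfolding J_def by auto
    have ij': "real (j - i) \<le> (real i + 1) powr a"
      using ij(2) of_nat_floor[of "(real i + 1) powr a"] powr_ge_zero[of "real i + 1" a] by linarith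
    have ind': "indep_vars (\<lambda>_. borel) Y {i..<j}" by (rule indep_vars_subset[OF ind]) auto
    have "prob {\<omega>\<in>space M. (real i + 1) powr b \<le> \<bar>\<Sum>k\<in>{i..<j}. Y k \<omega>\<bar>} \<le> 2 * exp (- ((real i + 1) powr b)\<^sup>2 / (2 * real (j - i)))"
    proof (rule chernoff_two_sided)
      show "integrable M (\<lambda>\<omega>. exp (l * (\<Sum>k\<in>{i..<j}. Y k \<omega>)))" for l
        by (rule subgaussian_sum[OF _ ind']) (auto intro: sg)
      show "expectation (\<lambda>\<omega>. exp (l * (\<Sum>k\<in>{i..<j}. Y k \<omega>))) \<le> exp (real (j - i) * l\<^sup>2 / 2)" for l
        using subgaussian_sum(2)[OF _ ind', of l] sg by simp
    qed (use ij in auto)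
    also have "\<dots> \<le> 2 * exp (- ((real i + 1) powr b)\<^sup>2 / (2 * (real i + 1) powr a))"
      using ij ij' by (auto intro!: divide_left_mono)
    also have "- ((real i + 1) powr b)\<^sup>2 / (2 * (real i + 1) powr a) = - ((real i + 1) powr (2 * b - a)) / 2"
    proof -
      have "((real i + 1) powr b)\<^sup>2 = (real i + 1) powr (2 * b)"
        by (simp add: power2_eq_square powr_add[symmetric])
      then show ?thesis by (simp add: powr_diff)
    qed
    finally show ?thesis .
  qed
  have "prob (A i) \<le> (real i + 1) powr a * (2 * exp (- ((real i + 1) powr (2 * b - a)) / 2))" for i
  proof -
    have "prob (A i) \<le> (\<Sum>j\<in>J i. prob {\<omega>\<in>space M. (real i + 1) powr b \<le> \<bar>\<Sum>k\<in>{i..<j}. Y k \<omega>\<bar>})"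
      unfolding A_def by (rule finite_measure_subadditive_finite) (auto simp: J_def)
    also have "\<dots> \<le> (\<Sum>j\<in>J i. 2 * exp (- ((real i + 1) powr (2 * b - a)) / 2))"
      by (intro sum_mono tail)
    also have "\<dots> = real (nat \<lfloor>(real i + 1) powr a\<rfloor>) * (2 * exp (- ((real i + 1) powr (2 * b - a)) / 2))"
      by (simp add: J_def)
    also have "\<dots> \<le> (real i + 1) powr a * (2 * exp (- ((real i + 1) powr (2 * b - a)) / 2))"
      by (intro mult_right_mono of_nat_floor) auto
    finally show ?thesis .
  qed
  then have "summable (\<lambda>i. prob (A i))"
    using ab by (intro summable_comparison_test'[OF summable_exp_neg_powr[of "2 * b - a" a]]) auto
  then have "AE \<omega> in M. \<forall>\<^sub>F i in sequentially. \<omega> \<in> space M - A i"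
    by (intro borel_cantelli_AE1) (auto simp: emeasure_eq_measure)
  then show ?thesis
  proof (rule AE_mp, intro AE_I2 impI)
    fix \<omega> assume "\<omega> \<in> space M" "\<forall>\<^sub>F i in sequentially. \<omega> \<in> space M - A i"
    then show "\<forall>\<^sub>F i in sequentially. \<forall>j\<ge>i. real (j - i) \<le> (real i + 1) powr a \<longrightarrow>
      \<bar>(\<Sum>k<j. Y k \<omega>) - (\<Sum>k<i. Y k \<omega>)\<bar> \<le> (real i + 1) powr b"
    proof (elim eventually_mono, intro allI impI)
      fix i j :: nat assume *: "\<omega> \<in> space M - A i" "i \<le> j" "real (j - i) \<le> (real i + 1) powr a"
      have eq: "(\<Sum>k<j. Y k \<omega>) - (\<Sum>k<i. Y k \<omega>) = (\<Sum>k\<in>{i..<j}. Y k \<omega>)"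
        using *(2) by (simp add: sum_diff_nat_ivl[of 0 i j, simplified atLeast0LessThan, symmetric] lessThan_atLeast0)
      show "\<bar>(\<Sum>k<j. Y k \<omega>) - (\<Sum>k<i. Y k \<omega>)\<bar> \<le> (real i + 1) powr b"
      proof (cases "i = j")
        case False
        have "j - i \<le> nat \<lfloor>(real i + 1) powr a\<rfloor>" using * by (intro le_nat_floor) simp
        then have "j \<in> J i" using * False by (auto simp: J_def)
        then show ?thesis using * eq by (auto simp: A_def)
      qed simp
    qed
  qed
qed

text \<open>Probabilities of products of half-lines pass to the limit by dominated convergence,
  provided that no limit variable charges the end point of a half-line. The second alternative of
  the last assumption guarantees this; the first one admits variables with atoms if they do not
  change along the sequence.\<close>

lemma (in prob_space) indep_vars_limit:
  fixes X :: "nat \<Rightarrow> 'i \<Rightarrow> 'a \<Rightarrow> real"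
  assumes I: "finite I" and ind: "\<And>n. indep_vars (\<lambda>_. borel) (X n) I"
    and Y: "\<And>i. i \<in> I \<Longrightarrow> random_variable borel (Y i)"
    and lim: "\<And>i. i \<in> I \<Longrightarrow> AE \<omega> in M. (\<lambda>n. X n i \<omega>) \<longlonglongrightarrow> Y i \<omega>"
    and atoms: "\<And>i. i \<in> I \<Longrightarrow> (\<forall>n. \<forall>\<omega>\<in>space M. X n i \<omega> = Y i \<omega>) \<or> (\<forall>a. prob {\<omega>\<in>space M. Y i \<omega> = a} = 0)"
  shows "indep_vars (\<lambda>_. borel) Y I"
proof (cases "I = {}")
  case True then show ?thesis by (simp add: indep_vars_def2 indep_sets_def)
next
  case False
  have X: "random_variable borel (X n i)" if "i \<in> I" for n i
    using ind that by (auto simp: indep_vars_def2)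
  \<comment> \<open>The half-lines generate the Borel sets; \<open>UNIV\<close> is added because the
    criterion for finite families asks for a generator that contains the whole space.\<close>
  let ?E = "\<lambda>i::'i. insert UNIV (range (atMost :: real \<Rightarrow> real set))"
  have conv: "AE \<omega> in M. (\<lambda>n. indicator B (X n i \<omega>) :: real) \<longlonglongrightarrow> indicator B (Y i \<omega>)"
    if i: "i \<in> I" and B: "B \<in> ?E i" for i B
  proof (cases "\<forall>n. \<forall>\<omega>\<in>space M. X n i \<omega> = Y i \<omega>")
    case True then show ?thesis by (intro AE_I2) auto
  next
    case False
    then have at: "prob {\<omega>\<in>space M. Y i \<omega> = a} = 0" for a using atoms[OF i] by auto
    show ?thesis
    proof (cases "B = UNIV")
      case True then show ?thesis by simp
    next
      case False
      then obtain a where B: "B = {..a}" using B by auto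
      have "AE \<omega> in M. Y i \<omega> \<noteq> a"
        using at[of a] Y[OF i] by (intro AE_I'[of "{\<omega>\<in>space M. Y i \<omega> = a}"]) (auto simp: null_sets_def emeasure_eq_measure)
      with lim[OF i] show ?thesis
      proof eventually_elim
        case (elim \<omega>)
        then consider "Y i \<omega> < a" | "a < Y i \<omega>" by linarith
        then show ?case
        proof cases
          case 1
          with elim have "\<forall>\<^sub>F n in sequentially. X n i \<omega> < a" by (auto dest: order_tendstoD)
          then have "\<forall>\<^sub>F n in sequentially. indicator B (X n i \<omega>) = (indicator B (Y i \<omega>) :: real)"
            by eventually_elim (use 1 B in auto)
          then show ?thesis by (rule tendsto_eventually)
        next
          case 2
          with elim have "\<forall>\<^sub>F n in sequentially. a < X n i \<omega>" by (auto dest: order_tendstoD)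
          then have "\<forall>\<^sub>F n in sequentially. indicator B (X n i \<omega>) = (indicator B (Y i \<omega>) :: real)"
            by eventually_elim (use 2 B in auto)
          then show ?thesis by (rule tendsto_eventually)
        qed
      qed
    qed
  qed
  have bmeas: "B \<in> sets borel" if "B \<in> ?E i" for B i using that by auto
  have pr: "prob (\<Inter>j\<in>J. Z j -` A j \<inter> space M) = expectation (\<lambda>\<omega>. \<Prod>j\<in>J. indicator (A j) (Z j \<omega>) :: real)"
    if "J \<subseteq> I" "J \<noteq> {}" "\<And>j. j \<in> J \<Longrightarrow> random_variable borel (Z j)" "\<And>j. j \<in> J \<Longrightarrow> A j \<in> ?E j"
    for J A and Z :: "'i \<Rightarrow> 'a \<Rightarrow> real"
  proof -
    have fJ: "finite J" using I that(1) by (rule finite_subset[rotated])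
    have ev: "(\<Inter>j\<in>J. Z j -` A j \<inter> space M) \<in> events"
      using that fJ bmeas by (intro sets.finite_INT) (auto intro!: measurable_sets)
    have "(\<Prod>j\<in>J. indicator (A j) (Z j \<omega>)) = (indicator (\<Inter>j\<in>J. Z j -` A j \<inter> space M) \<omega> :: real)"
      if "\<omega> \<in> space M" for \<omega>
    proof (cases "\<forall>j\<in>J. Z j \<omega> \<in> A j")
      case True then show ?thesis using that by auto
    next
      case False
      then show ?thesis using fJ by (auto simp: indicator_def intro!: prod_zero)
    qed
    then have "expectation (\<lambda>\<omega>. \<Prod>j\<in>J. indicator (A j) (Z j \<omega>) :: real) = expectation (indicator (\<Inter>j\<in>J. Z j -` A j \<inter> space M))"
      by (intro Bochner_Integration.integral_cong refl)
    then show ?thesis using ev by simp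
  qed
  have lims: "(\<lambda>n. prob (\<Inter>j\<in>J. X n j -` A j \<inter> space M)) \<longlonglongrightarrow> prob (\<Inter>j\<in>J. Y j -` A j \<inter> space M)"
    if J: "J \<subseteq> I" "J \<noteq> {}" and A: "\<And>j. j \<in> J \<Longrightarrow> A j \<in> ?E j" for J A
  proof -
    have fJ: "finite J" using I J finite_subset by auto
    have "AE \<omega> in M. \<forall>j\<in>J. (\<lambda>n. indicator (A j) (X n j \<omega>) :: real) \<longlonglongrightarrow> indicator (A j) (Y j \<omega>)"
      using fJ J A conv by (subst AE_finite_all) auto
    then have ae: "AE \<omega> in M. (\<lambda>n. \<Prod>j\<in>J. indicator (A j) (X n j \<omega>) :: real) \<longlonglongrightarrow> (\<Prod>j\<in>J. indicator (A j) (Y j \<omega>))"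
      by eventually_elim (auto intro!: tendsto_prod)
    have XJ: "random_variable borel (\<lambda>\<omega>. indicator (A j) (X n j \<omega>) :: real)"
      "random_variable borel (\<lambda>\<omega>. indicator (A j) (Y j \<omega>) :: real)" if "j \<in> J" for n j
      using X[of j n] Y[of j] J(1) bmeas[OF A[OF that]] that
      by (auto intro!: measurable_compose[of _ M borel "indicator (A j)"])
    have "(\<lambda>n. expectation (\<lambda>\<omega>. \<Prod>j\<in>J. indicator (A j) (X n j \<omega>) :: real)) \<longlonglongrightarrow> expectation (\<lambda>\<omega>. \<Prod>j\<in>J. indicator (A j) (Y j \<omega>) :: real)"
    proof (rule integral_dominated_convergence[where w="\<lambda>_. 1"])
      show "AE \<omega> in M. norm (\<Prod>j\<in>J. indicator (A j) (X n j \<omega>) :: real) \<le> 1" for n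
        by (intro AE_I2) (auto simp: abs_prod intro!: prod_le_1)
    qed (use ae XJ in \<open>auto intro!: borel_measurable_prod\<close>)
    then show ?thesis
      using X Y J A by (subst (1 2) pr) auto
  qed
  show ?thesis
  proof (subst indep_vars_finite[where E = ?E])
    show "I \<noteq> {}" "finite I" by fact+
    show "sets borel = sigma_sets (space borel) (?E i)" for i
    proof -
      have "sets (borel :: real measure) = sigma_sets UNIV (range atMost)"
        by (subst borel_eq_atMost) simp
      moreover have "sigma_sets UNIV (range atMost) = sigma_sets UNIV (insert UNIV (range (atMost :: real \<Rightarrow> _)))"
        by (intro sigma_sets_eqI) (auto intro: sigma_sets_top sigma_sets.Basic)
      ultimately show ?thesis by simp
    qed
    show "Int_stable (?E i)" for i
      by (auto simp: Int_stable_def)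
    show "\<forall>A\<in>Pi I ?E. prob (\<Inter>j\<in>I. Y j -` A j \<inter> space M) = (\<Prod>j\<in>I. prob (Y j -` A j \<inter> space M))"
    proof
      fix A assume A: "A \<in> Pi I ?E"
      have 1: "(\<lambda>n. prob (\<Inter>j\<in>I. X n j -` A j \<inter> space M)) \<longlonglongrightarrow> prob (\<Inter>j\<in>I. Y j -` A j \<inter> space M)"
        using A False by (intro lims) auto
      have "(\<lambda>n. prob (X n j -` A j \<inter> space M)) \<longlonglongrightarrow> prob (Y j -` A j \<inter> space M)" if "j \<in> I" for j
        using lims[of "{j}" A] A that by auto
      then have 2: "(\<lambda>n. \<Prod>j\<in>I. prob (X n j -` A j \<inter> space M)) \<longlonglongrightarrow> (\<Prod>j\<in>I. prob (Y j -` A j \<inter> space M))"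
        by (intro tendsto_prod) auto
      have "prob (\<Inter>j\<in>I. X n j -` A j \<inter> space M) = (\<Prod>j\<in>I. prob (X n j -` A j \<inter> space M))" for n
        using False I bmeas[of "A _"] PiE[OF A] by (intro indep_varsD[OF ind]) blast+
      with 1 have "(\<lambda>n. \<Prod>j\<in>I. prob (X n j -` A j \<inter> space M)) \<longlonglongrightarrow> prob (\<Inter>j\<in>I. Y j -` A j \<inter> space M)"
        by (simp only:)
      then show "prob (\<Inter>j\<in>I. Y j -` A j \<inter> space M) = (\<Prod>j\<in>I. prob (Y j -` A j \<inter> space M))"
        using 2 by (rule LIMSEQ_unique)
    qed
  qed (use Y in auto)
qed

section \<open>Gaussian variables\<close>

abbreviation (in prob_space) std_normal :: "('a \<Rightarrow> real) \<Rightarrow> bool" where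
  "std_normal X \<equiv> distributed M lborel X std_normal_density"

lemma (in prob_space) std_normal_random_variable:
  "std_normal X \<Longrightarrow> random_variable borel X"
  by (drule distributed_measurable) simp

lemma (in prob_space) std_normal_iff_distr:
  "std_normal X \<longleftrightarrow> random_variable borel X \<and> distr M borel X = std_normal_distribution"
  unfolding distributed_def by (auto cong: distr_cong)

lemma (in prob_space) std_normal_even_moment:
  assumes X: "std_normal X"
  shows "integrable M (\<lambda>\<omega>. X \<omega> ^ (2 * k))"
    and "expectation (\<lambda>\<omega>. X \<omega> ^ (2 * k)) = fact (2 * k) / (2 ^ k * fact k)"
proof -
  show "integrable M (\<lambda>\<omega>. X \<omega> ^ (2 * k))"
    using distributed_integrable[OF X, of "\<lambda>x. x ^ (2 * k)"] integrable_std_normal_moment[of "2 * k"] by simp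
  show "expectation (\<lambda>\<omega>. X \<omega> ^ (2 * k)) = fact (2 * k) / (2 ^ k * fact k)"
    using distributed_integral[OF X, of "\<lambda>x. x ^ (2 * k)"] integral_std_normal_moment_even[of k] by simp
qed

text \<open>Completing the square: an exponential tilt by \<open>l\<close> moves the mean to
  \<open>l\<close>.\<close>

lemma std_normal_exp_shift:
  "std_normal_density x * exp (l * x) = exp (l\<^sup>2 / 2) * normal_density l 1 x"
  by (simp add: normal_density_def mult_exp_exp power2_eq_square field_simps)

lemma (in prob_space) subgaussian_std_normal:
  assumes X: "std_normal X"
  shows "subgaussian X"
  unfolding subgaussian_def
proof (intro conjI allI)
  show "random_variable borel X" using std_normal_random_variable[OF X] .
  fix l :: real
  show "integrable M (\<lambda>\<omega>. exp (l * X \<omega>))"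
    using distributed_integrable[OF X, of "\<lambda>x. exp (l * x)"] by (simp add: std_normal_exp_shift)
  have "expectation (\<lambda>\<omega>. exp (l * X \<omega>)) = exp (l\<^sup>2 / 2)"
    using distributed_integral[OF X, of "\<lambda>x. exp (l * x)"] by (simp add: std_normal_exp_shift)
  then show "expectation (\<lambda>\<omega>. exp (l * X \<omega>)) \<le> exp (l\<^sup>2 / 2)" by simp
qed

lemma (in prob_space) std_normal_sum:
  assumes "finite I" "I \<noteq> {}" "indep_vars (\<lambda>_. borel) X I" "\<And>i. i \<in> I \<Longrightarrow> std_normal (X i)"
  shows "std_normal (\<lambda>\<omega>. (\<Sum>i\<in>I. X i \<omega>) / sqrt (real (card I)))"
proof -
  have "distributed M lborel (\<lambda>\<omega>. \<Sum>i\<in>I. X i \<omega>) (normal_density (\<Sum>i\<in>I. 0) (sqrt (\<Sum>i\<in>I. 1\<^sup>2)))"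
    using assms by (intro sum_indep_normal) auto
  then show ?thesis
    using assms normal_standard_normal_convert[of "sqrt (real (card I))" "\<lambda>\<omega>. \<Sum>i\<in>I. X i \<omega>" 0]
    by (simp add: card_gt_0_iff)
qed

lemma std_normal_density_rotation:
  "std_normal_density ((u + v) / sqrt 2) * std_normal_density ((u - v) / sqrt 2)
    = std_normal_density u * std_normal_density v"
proof -
  have "((u + v) / sqrt 2)\<^sup>2 + ((u - v) / sqrt 2)\<^sup>2 = u\<^sup>2 + v\<^sup>2"
    by (simp add: power_divide power2_eq_square field_simps)
  then have "- (((u + v) / sqrt 2)\<^sup>2) / 2 + - (((u - v) / sqrt 2)\<^sup>2) / 2 = - (u\<^sup>2) / 2 + - (v\<^sup>2) / 2"
    by linarith
  then have "exp (- (((u + v) / sqrt 2)\<^sup>2) / 2) * exp (- (((u - v) / sqrt 2)\<^sup>2) / 2)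
      = exp (- (u\<^sup>2) / 2) * exp (- (v\<^sup>2) / 2)"
    by (simp only: exp_add[symmetric])
  then show ?thesis by (simp add: std_normal_density_def)
qed

text \<open>The linear change of variables is done by two affine ones:
  \<open>y = - x + sqrt 2 * u\<close> at fixed \<open>x\<close>, and after Fubini
  \<open>x = (u + v) / sqrt 2\<close> at fixed \<open>u\<close>. The factors \<open>sqrt 2\<close>
  and \<open>1 / sqrt 2\<close> cancel, and the product density is invariant.\<close>

lemma nn_integral_std_normal_rotation:
  fixes f :: "real \<times> real \<Rightarrow> ennreal"
  assumes [measurable]: "f \<in> borel_measurable (borel \<Otimes>\<^sub>M borel)"
  shows "(\<integral>\<^sup>+x. \<integral>\<^sup>+y. ennreal (std_normal_density x * std_normal_density y) *
        f ((x + y) / sqrt 2, (x - y) / sqrt 2) \<partial>lborel \<partial>lborel)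
    = (\<integral>\<^sup>+x. \<integral>\<^sup>+y. ennreal (std_normal_density x * std_normal_density y) * f (x, y) \<partial>lborel \<partial>lborel)"
proof -
  define \<phi> where "\<phi> = (std_normal_density :: real \<Rightarrow> real)"
  have [measurable]: "\<phi> \<in> borel_measurable borel" by (simp add: \<phi>_def)
  have s: "sqrt 2 \<noteq> 0" "sqrt 2 * sqrt 2 = (2::real)" by simp_all
  have "(\<integral>\<^sup>+x. \<integral>\<^sup>+y. ennreal (\<phi> x * \<phi> y) * f ((x + y) / sqrt 2, (x - y) / sqrt 2) \<partial>lborel \<partial>lborel)
    = (\<integral>\<^sup>+x. ennreal \<bar>sqrt 2\<bar> * (\<integral>\<^sup>+u. ennreal (\<phi> x * \<phi> (- x + sqrt 2 * u)) *
         f ((x + (- x + sqrt 2 * u)) / sqrt 2, (x - (- x + sqrt 2 * u)) / sqrt 2) \<partial>lborel) \<partial>lborel)"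
    by (intro nn_integral_cong nn_integral_real_affine) auto
  also have "\<dots> = (\<integral>\<^sup>+x. \<integral>\<^sup>+u. ennreal (sqrt 2 * (\<phi> x * \<phi> (- x + sqrt 2 * u))) *
         f (u, (2 * x - sqrt 2 * u) / sqrt 2) \<partial>lborel \<partial>lborel)"
    by (subst nn_integral_cmult[symmetric]) (auto simp: ennreal_mult' mult.assoc)
  also have "\<dots> = (\<integral>\<^sup>+u. \<integral>\<^sup>+x. ennreal (sqrt 2 * (\<phi> x * \<phi> (- x + sqrt 2 * u))) *
         f (u, (2 * x - sqrt 2 * u) / sqrt 2) \<partial>lborel \<partial>lborel)"
    by (rule lborel_pair.Fubini') (simp add: measurable_split_conv)
  also have "\<dots> = (\<integral>\<^sup>+u. ennreal \<bar>1 / sqrt 2\<bar> * (\<integral>\<^sup>+v. ennreal (sqrt 2 * (\<phi> (u / sqrt 2 + (1 / sqrt 2) * v) * \<phi> (- (u / sqrt 2 + (1 / sqrt 2) * v) + sqrt 2 * u))) *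
         f (u, (2 * (u / sqrt 2 + (1 / sqrt 2) * v) - sqrt 2 * u) / sqrt 2) \<partial>lborel) \<partial>lborel)"
    by (intro nn_integral_cong nn_integral_real_affine) auto
  also have "\<dots> = (\<integral>\<^sup>+u. ennreal (1 / sqrt 2) * (\<integral>\<^sup>+v. ennreal (sqrt 2 * (\<phi> u * \<phi> v)) * f (u, v) \<partial>lborel) \<partial>lborel)"
  proof -
    have 1: "u / sqrt 2 + (1 / sqrt 2) * v = (u + v) / sqrt 2" for u v :: real by (simp add: field_simps)
    have 2: "- ((u + v) / sqrt 2) + sqrt 2 * u = (u - v) / sqrt 2" for u v :: real
      by (simp add: field_simps)
    have 3: "(2 * ((u + v) / sqrt 2) - sqrt 2 * u) / sqrt 2 = v" for u v :: real
      by (simp add: field_simps)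
    show ?thesis unfolding 1 2 3 by (simp add: \<phi>_def std_normal_density_rotation)
  qed
  also have "\<dots> = (\<integral>\<^sup>+u. \<integral>\<^sup>+v. ennreal (\<phi> u * \<phi> v) * f (u, v) \<partial>lborel \<partial>lborel)"
  proof (intro nn_integral_cong)
    fix u :: real
    have "ennreal (1 / sqrt 2) * (ennreal (sqrt 2 * (\<phi> u * \<phi> v)) * f (u, v)) = ennreal (\<phi> u * \<phi> v) * f (u, v)" for v
      by (simp add: mult.assoc[symmetric] ennreal_mult'[symmetric])
    then show "ennreal (1 / sqrt 2) * (\<integral>\<^sup>+v. ennreal (sqrt 2 * (\<phi> u * \<phi> v)) * f (u, v) \<partial>lborel)
        = (\<integral>\<^sup>+v. ennreal (\<phi> u * \<phi> v) * f (u, v) \<partial>lborel)"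
      by (subst nn_integral_cmult[symmetric]) auto
  qed
  finally show ?thesis by (simp add: \<phi>_def)
qed

lemma distr_std_normal_rotation:
  "distr (std_normal_distribution \<Otimes>\<^sub>M std_normal_distribution) (borel \<Otimes>\<^sub>M borel)
      (\<lambda>(x, y). ((x + y) / sqrt 2, (x - y) / sqrt 2))
    = std_normal_distribution \<Otimes>\<^sub>M std_normal_distribution" (is "distr ?G ?B ?R = _")
proof (rule measure_eqI)
  show "sets (distr ?G ?B ?R) = sets ?G"
    by (simp cong: sets_pair_measure_cong)
  fix A assume "A \<in> sets (distr ?G ?B ?R)"
  then have [measurable]: "A \<in> sets ?B" by simp
  interpret prob_space std_normal_distribution
    by (rule prob_space_normal_density) simp
  have G: "?G = density (lborel \<Otimes>\<^sub>M lborel) (\<lambda>(x, y). ennreal (std_normal_density x) * ennreal (std_normal_density y))"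
    by (rule pair_measure_density) (auto intro: sigma_finite_lborel sigma_finite_measure_axioms)
  have em: "emeasure ?G B = (\<integral>\<^sup>+x. \<integral>\<^sup>+y. ennreal (std_normal_density x * std_normal_density y) * indicator B (x, y) \<partial>lborel \<partial>lborel)"
    if [measurable]: "B \<in> sets ?B" for B
    unfolding G by (subst emeasure_density; simp add: split_beta' lborel.nn_integral_fst[symmetric] ennreal_mult')
  have Rm: "?R \<in> measurable ?G ?B"
    by (simp cong: measurable_cong_sets sets_pair_measure_cong)
  have RB: "?R -` A \<inter> space ?G \<in> sets ?B"
    using measurable_sets[OF Rm, of A] by (simp cong: sets_pair_measure_cong)
  have "emeasure (distr ?G ?B ?R) A = emeasure ?G (?R -` A \<inter> space ?G)"
    by (rule emeasure_distr[OF Rm]) simp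
  also have "\<dots> = (\<integral>\<^sup>+x. \<integral>\<^sup>+y. ennreal (std_normal_density x * std_normal_density y) *
        indicator A ((x + y) / sqrt 2, (x - y) / sqrt 2) \<partial>lborel \<partial>lborel)"
    unfolding em[OF RB] by (intro nn_integral_cong) (auto simp: indicator_def space_pair_measure)
  also have "\<dots> = emeasure ?G A"
    by (subst nn_integral_std_normal_rotation) (simp_all add: em)
  finally show "emeasure (distr ?G ?B ?R) A = emeasure ?G A" .
qed

text \<open>The halving step of Levy's construction: a normalised increment and a fresh coefficient
  yield independent normalised increments over the two halves of the interval.\<close>

lemma (in prob_space) std_normal_rotation:
  assumes X: "std_normal X" and Y: "std_normal Y" and ind: "indep_var borel X borel Y"
  shows "std_normal (\<lambda>\<omega>. (X \<omega> + Y \<omega>) / sqrt 2)" (is "std_normal ?U")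
    and "std_normal (\<lambda>\<omega>. (X \<omega> - Y \<omega>) / sqrt 2)" (is "std_normal ?V")
    and "indep_var borel (\<lambda>\<omega>. (X \<omega> + Y \<omega>) / sqrt 2) borel (\<lambda>\<omega>. (X \<omega> - Y \<omega>) / sqrt 2)"
proof -
  have [measurable]: "random_variable borel X" "random_variable borel Y"
    using X Y by (auto intro: std_normal_random_variable)
  show U: "std_normal ?U" and V: "std_normal ?V"
    using add_indep_normal[OF ind _ _ X Y] diff_indep_normal[OF ind _ _ X Y]
      normal_standard_normal_convert[of "sqrt 2" "\<lambda>\<omega>. X \<omega> + Y \<omega>" 0]
      normal_standard_normal_convert[of "sqrt 2" "\<lambda>\<omega>. X \<omega> - Y \<omega>" 0] by simp_all
  let ?R = "\<lambda>(x, y). ((x + y) / sqrt 2, (x - y) / sqrt 2 :: real)"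
  have "distr M (borel \<Otimes>\<^sub>M borel) (\<lambda>\<omega>. (?U \<omega>, ?V \<omega>))
      = distr (distr M (borel \<Otimes>\<^sub>M borel) (\<lambda>\<omega>. (X \<omega>, Y \<omega>))) (borel \<Otimes>\<^sub>M borel) ?R"
    by (subst distr_distr) (auto simp: comp_def)
  also have "distr M (borel \<Otimes>\<^sub>M borel) (\<lambda>\<omega>. (X \<omega>, Y \<omega>)) = std_normal_distribution \<Otimes>\<^sub>M std_normal_distribution"
    using ind X Y unfolding indep_var_distribution_eq std_normal_iff_distr by simp
  also have "distr \<dots> (borel \<Otimes>\<^sub>M borel) ?R = distr M borel ?U \<Otimes>\<^sub>M distr M borel ?V"
    using U V by (simp add: distr_std_normal_rotation std_normal_iff_distr)
  finally show "indep_var borel ?U borel ?V"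
    unfolding indep_var_distribution_eq by simp
qed

section \<open>Rademacher sums and the normal distribution function\<close>

definition Phi :: "real \<Rightarrow> real" where
  "Phi x = measure std_normal_distribution {..x}"

lemma prob_space_std_normal_distribution: "prob_space std_normal_distribution"
  by (rule prob_space_normal_density) simp

lemma std_normal_identity: "prob_space.std_normal std_normal_distribution (\<lambda>x. x)"
proof -
  interpret prob_space std_normal_distribution by (rule prob_space_std_normal_distribution)
  show ?thesis by (auto simp: distributed_def distr_id2)
qed

lemma Phi_has_real_derivative: "(Phi has_real_derivative std_normal_density x) (at x)"
proof -
  interpret real_distribution std_normal_distribution by (rule real_dist_normal_dist)
  have cont: "isCont (std_normal_density :: real \<Rightarrow> real) x" for x
    unfolding std_normal_density_def by (intro continuous_intros) auto
  \<comment> \<open>An antiderivative of the density. \<open>Phi\<close> has the same increments, so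
    it differs from \<open>F\<close> by a constant.\<close>
  obtain F :: "real \<Rightarrow> real" where F: "\<And>x. (F has_vector_derivative std_normal_density x) (at x)"
    using einterval_antiderivative[of "-\<infinity>" "\<infinity>" "std_normal_density :: real \<Rightarrow> real"] cont by auto
  have diff: "Phi b - Phi a = F b - F a" if "a \<le> b" for a b
  proof (cases "a = b")
    case False
    then have ab: "a < b" using that by simp
    have "Phi b - Phi a = measure std_normal_distribution {a<..b}"
      using cdf_diff_eq[OF ab] by (simp add: Phi_def cdf_def)
    also have "\<dots> = (\<integral>x. indicator {a<..b} x * std_normal_density x \<partial>lborel)"
    proof -
      have "measure std_normal_distribution {a<..b} = (\<integral>x. indicator {a<..b} x \<partial>std_normal_distribution)" by simp
      also have "\<dots> = (\<integral>x. std_normal_density x *\<^sub>R indicator {a<..b} x \<partial>lborel)"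
        by (rule integral_density) auto
      finally show ?thesis by (simp add: mult.commute)
    qed
    also have "\<dots> = (LBINT x=a..b. std_normal_density x)"
      using ab by (simp add: interval_integral_Ioc set_lebesgue_integral_def)
    also have "\<dots> = F b - F a"
    proof (rule interval_integral_FTC_finite)
      show "continuous_on {min a b..max a b} std_normal_density"
        using cont by (intro continuous_at_imp_continuous_on) auto
      show "(F has_vector_derivative std_normal_density x) (at x within {min a b..max a b})" for x
        by (rule has_vector_derivative_at_within[OF F])
    qed
    finally show ?thesis .
  qed simp
  define c where "c = Phi 0 - F 0"
  have "Phi y = F y + c" for y
    using diff[of 0 y] diff[of y 0] by (cases "0 \<le> y") (auto simp: c_def)
  then have eq: "Phi = (\<lambda>y. F y + c)" by (rule ext)
  have "(F has_real_derivative std_normal_density x) (at x)"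
    using F[of x] by (simp add: has_real_derivative_iff_has_vector_derivative)
  then show ?thesis unfolding eq by (auto intro!: derivative_eq_intros)
qed

lemmas Phi_derivative [derivative_intros] = DERIV_chain2[OF Phi_has_real_derivative]

lemma isCont_Phi: "isCont Phi x"
  using Phi_has_real_derivative by (rule DERIV_isCont)

lemma Phi_strict_mono: "strict_mono Phi"
proof (rule strict_monoI)
  fix x y :: real assume "x < y"
  then show "Phi x < Phi y"
  proof (rule DERIV_pos_imp_increasing)
    fix z :: real
    have "0 < std_normal_density z" by (rule normal_density_pos) simp
    then show "\<exists>d. (Phi has_real_derivative d) (at z) \<and> 0 < d"
      using Phi_has_real_derivative[of z] by blast
  qed
qed

lemma Phi_less_iff: "Phi x < Phi y \<longleftrightarrow> x < y" and Phi_le_iff: "Phi x \<le> Phi y \<longleftrightarrow> x \<le> y"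
  using Phi_strict_mono by (simp_all add: strict_mono_less strict_mono_less_eq)

lemma Phi_borel_measurable [measurable]: "Phi \<in> borel_measurable borel"
  by (intro borel_measurable_continuous_onI continuous_at_imp_continuous_on) (auto intro: isCont_Phi)

lemma Phi_bounds: "0 < Phi x" "Phi x < 1"
proof -
  interpret real_distribution std_normal_distribution by (rule real_dist_normal_dist)
  have "0 \<le> Phi (x - 1)" "Phi (x + 1) \<le> 1" by (auto simp: Phi_def)
  then show "0 < Phi x" "Phi x < 1"
    using Phi_less_iff[of "x - 1" x] Phi_less_iff[of x "x + 1"] by auto
qed

lemma (in prob_space) prob_std_normal_le:
  assumes "std_normal X" shows "prob {\<omega>\<in>space M. X \<omega> \<le> x} = Phi x"
proof -
  have X: "random_variable borel X" "distr M borel X = std_normal_distribution"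
    using assms by (auto simp: std_normal_iff_distr)
  have "Phi x = measure (distr M borel X) {..x}" using X by (simp add: Phi_def)
  also have "\<dots> = prob (X -` {..x} \<inter> space M)" using X by (subst measure_distr) auto
  also have "X -` {..x} \<inter> space M = {\<omega>\<in>space M. X \<omega> \<le> x}" by auto
  finally show ?thesis ..
qed

text \<open>The probability integral transform. The strict inequality fits its two uses: the
  half-open cells of \<open>quantile_index\<close> and the clock condition
  \<open>u n \<omega> < 2 * p x\<close>.\<close>

lemma (in prob_space) prob_std_normal_Phi_less:
  assumes X: "std_normal X" and u: "0 \<le> u" "u \<le> 1"
  shows "prob {\<omega>\<in>space M. Phi (X \<omega>) < u} = u"
proof -
  interpret N: real_distribution std_normal_distribution by (rule real_dist_normal_dist)
  have [measurable]: "random_variable borel X" using std_normal_random_variable[OF X] .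
  consider "u = 0" | "u = 1" | "0 < u" "u < 1" using u by linarith
  then show ?thesis
  proof cases
    case 1 then have "{\<omega>\<in>space M. Phi (X \<omega>) < u} = {}" using Phi_bounds by (auto simp: not_less less_imp_le)
    then show ?thesis using 1 by (simp only: measure_empty)
  next
    case 2 then show ?thesis using Phi_bounds by (simp add: prob_space)
  next
    case 3
    have "eventually (\<lambda>x. Phi x < u) at_bot" "eventually (\<lambda>x. u < Phi x) at_top"
      using N.cdf_lim_at_bot N.cdf_lim_at_top_prob 3 unfolding cdf_def Phi_def[abs_def]
      by (auto dest: order_tendstoD)
    then obtain a b where ab: "Phi a < u" "u < Phi b"
      by (auto simp: eventually_at_bot_linorder eventually_at_top_linorder)
    then have "a \<le> b" using Phi_less_iff[of a b] by linarith
    then obtain x where x: "Phi x = u"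
      using IVT[of Phi a u b] ab isCont_Phi by auto
    \<comment> \<open>Continuity of \<open>Phi\<close> excludes an atom at \<open>x\<close>, so the
      strict and the weak inequality have the same probability.\<close>
    have at: "prob {\<omega>\<in>space M. X \<omega> = x} = 0"
    proof -
      have "prob {\<omega>\<in>space M. X \<omega> = x} \<le> Phi x - Phi (x - e)" if "0 < e" for e
      proof -
        have "prob {\<omega>\<in>space M. X \<omega> = x} \<le> prob ({\<omega>\<in>space M. X \<omega> \<le> x} - {\<omega>\<in>space M. X \<omega> \<le> x - e})"
          using that by (intro finite_measure_mono) auto
        also have "\<dots> = Phi x - Phi (x - e)"
          using that by (subst finite_measure_Diff) (auto simp: prob_std_normal_le[OF X])
        finally show ?thesis .
      qed
      moreover have "((\<lambda>e. Phi x - Phi (x - e)) \<longlongrightarrow> Phi x - Phi (x - 0)) (at_right 0)"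
        by (intro tendsto_intros isCont_tendsto_compose[OF isCont_Phi])
      ultimately have "prob {\<omega>\<in>space M. X \<omega> = x} \<le> 0"
        by (intro tendsto_lowerbound[where F="at_right 0"]) (auto simp: eventually_at_right_less eventually_at_filter)
      then show ?thesis using measure_nonneg[of M] by (intro antisym) auto
    qed
    have "{\<omega>\<in>space M. Phi (X \<omega>) < u} = {\<omega>\<in>space M. X \<omega> \<le> x} - {\<omega>\<in>space M. X \<omega> = x}"
      using x by (auto simp: Phi_less_iff[of _ x, unfolded x])
    moreover have "prob ({\<omega>\<in>space M. X \<omega> \<le> x} - {\<omega>\<in>space M. X \<omega> = x})
        = prob {\<omega>\<in>space M. X \<omega> \<le> x} - prob {\<omega>\<in>space M. X \<omega> = x}"
      by (rule finite_measure_Diff) auto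
    ultimately show ?thesis using x at prob_std_normal_le[OF X, of x] by simp
  qed
qed

section \<open>Bounds for the normal density and one step of the heat flow\<close>

lemma std_normal_density_le_exp: "std_normal_density z \<le> exp (- z\<^sup>2 / 2)"
proof -
  have "1 \<le> sqrt (2 * pi)" using pi_ge_two by (simp add: real_le_rsqrt)
  then show ?thesis by (simp add: std_normal_density_def divide_le_eq mult_le_cancel_left1 le_divide_eq)
qed

lemma exp_half_square_lower: "1 + z\<^sup>2 / 2 + z ^ 4 / 8 \<le> exp (z\<^sup>2 / 2)" for z :: real
  using exp_lower_Taylor_quadratic[of "z\<^sup>2 / 2"] by (simp add: power_divide power_mult[symmetric])

text \<open>The polynomial on the right is the start of the series of
  \<open>exp (z\<^sup>2 / 2)\<close>, which cancels the Gaussian factor. Uniform bounds for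
  polynomials times the density thus become comparisons of polynomials.\<close>

lemma std_normal_density_poly_bound:
  assumes "0 \<le> p" "p \<le> c * (1 + z\<^sup>2 / 2 + z ^ 4 / 8)" "0 \<le> c"
  shows "p * std_normal_density z \<le> c"
proof -
  have "p * std_normal_density z \<le> (c * exp (z\<^sup>2 / 2)) * exp (- z\<^sup>2 / 2)"
  proof (rule mult_mono)
    show "p \<le> c * exp (z\<^sup>2 / 2)"
      using mult_left_mono[OF exp_half_square_lower assms(3)] assms(2) by (rule order_trans[rotated])
  qed (use assms(3) std_normal_density_le_exp in auto)
  also have "\<dots> = c" by (simp add: mult.assoc mult_exp_exp)
  finally show ?thesis .
qed

lemma abs_mult_density_bounds:
  fixes z :: real
  shows "\<bar>z\<bar> * std_normal_density z \<le> 1"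
    and "\<bar>1 - z\<^sup>2\<bar> * std_normal_density z \<le> 2"
    and "\<bar>z\<bar> * \<bar>1 - z\<^sup>2\<bar> * std_normal_density z \<le> 4"
    and "std_normal_density z \<le> 1"
proof -
  have a: "\<bar>z\<bar> \<le> (1 + z\<^sup>2) / 2" using zero_le_power2[of "\<bar>z\<bar> - 1"] by (simp add: power2_eq_square algebra_simps)
  have b: "\<bar>1 - z\<^sup>2\<bar> \<le> 1 + z\<^sup>2" by (simp add: abs_le_iff)
  have z4: "0 \<le> z ^ 4" by simp
  have z4': "z ^ 4 = z\<^sup>2 * z\<^sup>2" by (simp flip: power_add)
  have "\<bar>z\<bar> \<le> 1 + z\<^sup>2 / 2 + z ^ 4 / 8" using a z4 zero_le_power2[of z] by argo
  then show "\<bar>z\<bar> * std_normal_density z \<le> 1"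
    by (intro std_normal_density_poly_bound) auto
  have "\<bar>1 - z\<^sup>2\<bar> \<le> 2 * (1 + z\<^sup>2 / 2 + z ^ 4 / 8)" using b z4 by argo
  then show "\<bar>1 - z\<^sup>2\<bar> * std_normal_density z \<le> 2"
    by (intro std_normal_density_poly_bound) auto
  show "\<bar>z\<bar> * \<bar>1 - z\<^sup>2\<bar> * std_normal_density z \<le> 4"
  proof (rule std_normal_density_poly_bound)
    have "\<bar>z\<bar> * \<bar>1 - z\<^sup>2\<bar> \<le> (1 + z\<^sup>2) / 2 * (1 + z\<^sup>2)" by (rule mult_mono[OF a b]) auto
    also have "\<dots> = (1 + 2 * z\<^sup>2 + z ^ 4) / 2" unfolding z4' by (simp add: algebra_simps)
    also have "\<dots> \<le> 4 * (1 + z\<^sup>2 / 2 + z ^ 4 / 8)" by simp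
    finally show "\<bar>z\<bar> * \<bar>1 - z\<^sup>2\<bar> \<le> 4 * (1 + z\<^sup>2 / 2 + z ^ 4 / 8)" .
  qed auto
  show "std_normal_density z \<le> 1"
    using std_normal_density_le_exp[of z] by (rule order_trans) simp
qed

lemma std_normal_density_deriv:
  "(std_normal_density has_real_derivative - z * std_normal_density z) (at z)" for z :: real
proof -
  have "((\<lambda>z. exp (- z\<^sup>2 / 2)) has_real_derivative - z * exp (- z\<^sup>2 / 2)) (at z)"
    by (auto intro!: derivative_eq_intros simp: power2_eq_square)
  from DERIV_cmult[OF this, of "1 / sqrt (2 * pi)"] show ?thesis
    unfolding std_normal_density_def[abs_def] by (simp add: mult.commute mult.left_commute)
qed

lemma mult_density_deriv:
  "((\<lambda>z. z * std_normal_density z) has_real_derivative (1 - z\<^sup>2) * std_normal_density z) (at z)" for z :: real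
  by (auto intro!: derivative_eq_intros DERIV_chain2[OF std_normal_density_deriv] simp: power2_eq_square algebra_simps)

lemma abs_diff_le_of_deriv_bound:
  fixes f f' :: "real \<Rightarrow> real"
  assumes "\<And>z. z \<in> {min x y..max x y} \<Longrightarrow> (f has_real_derivative f' z) (at z)"
    and "\<And>z. z \<in> {min x y..max x y} \<Longrightarrow> \<bar>f' z\<bar> \<le> B"
  shows "\<bar>f x - f y\<bar> \<le> B * \<bar>x - y\<bar>"
proof -
  have "norm (f x - f y) \<le> B * norm (x - y)"
    by (rule field_differentiable_bound[of "{min x y..max x y}" f f'])
       (use assms in \<open>auto intro: has_field_derivative_at_within\<close>)
  then show ?thesis by simp
qed

lemma Phi_lipschitz: "\<bar>Phi x - Phi y\<bar> \<le> \<bar>x - y\<bar>"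
  using abs_diff_le_of_deriv_bound[of x y Phi std_normal_density 1] Phi_has_real_derivative abs_mult_density_bounds(4)
  by simp

text \<open>Between \<open>w\<close> and \<open>c * w\<close> the modulus is at least that of
  \<open>w\<close>, and \<open>\<bar>z\<bar> * std_normal_density z\<close> is at most 1. The
  derivative is therefore at most \<open>1 / \<bar>w\<bar>\<close>, which cancels the length
  \<open>(c - 1) * \<bar>w\<bar>\<close>: the bound is uniform in \<open>w\<close>.\<close>

lemma Phi_dilation:
  assumes c: "1 \<le> c" shows "\<bar>Phi (c * w) - Phi w\<bar> \<le> c - 1"
proof (cases "w = 0")
  case False
  have between: "\<bar>w\<bar> \<le> \<bar>z\<bar>" if "z \<in> {min (c * w) w..max (c * w) w}" for z
  proof (cases "0 < w")
    case True then have "w \<le> c * w" using c by simp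
    then show ?thesis using that True by auto
  next
    case w: False then have "c * w \<le> w" using c False mult_right_mono_neg[of 1 c w] by simp
    then show ?thesis using that w by auto
  qed
  have "\<bar>Phi (c * w) - Phi w\<bar> \<le> (1 / \<bar>w\<bar>) * \<bar>c * w - w\<bar>"
  proof (rule abs_diff_le_of_deriv_bound[OF Phi_has_real_derivative])
    fix z assume "z \<in> {min (c * w) w..max (c * w) w}"
    then have "\<bar>w\<bar> * std_normal_density z \<le> \<bar>z\<bar> * std_normal_density z"
      by (intro mult_right_mono between) auto
    also have "\<dots> \<le> 1" by (rule abs_mult_density_bounds)
    finally show "\<bar>std_normal_density z\<bar> \<le> 1 / \<bar>w\<bar>" using False by (simp add: field_simps)
  qed
  also have "c * w - w = (c - 1) * w" by (simp add: algebra_simps)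
  also have "1 / \<bar>w\<bar> * \<bar>(c - 1) * w\<bar> = c - 1" using False c by (simp add: abs_mult)
  finally show ?thesis .
qed (use c in simp)

lemma sqrt_one_plus_square_le: "0 \<le> s \<Longrightarrow> sqrt (1 + s\<^sup>2) \<le> 1 + s"
  by (rule real_le_lsqrt) (auto simp: power2_eq_square algebra_simps)

text \<open>\<open>\<lambda>t x. Phi (x / sqrt t)\<close> solves the heat equation, so averaging over one step of
  length \<open>s\<close> in space almost equals advancing the time by \<open>s\<^sup>2\<close>.\<close>

lemma Phi_heat_step_unit:
  assumes s: "0 \<le> s"
  shows "\<bar>(Phi (x + s) + Phi (x - s)) / 2 - Phi (x / sqrt (1 + s\<^sup>2))\<bar> \<le> 7 * s ^ 3"
proof -
  let ?q = "\<lambda>z. z * std_normal_density z :: real"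
  define F where "F s = (Phi (x + s) + Phi (x - s)) / 2 - Phi (x / sqrt (1 + s\<^sup>2))" for s
  \<comment> \<open>\<open>F\<close> is the error of the step as a function of the step size and
    vanishes at 0, so a quadratic bound on its derivative gives the cubic error.\<close>
  define F' where "F' s = (std_normal_density (x + s) - std_normal_density (x - s)) / 2
    + s * (?q (x / sqrt (1 + s\<^sup>2)) / (1 + s\<^sup>2))" for s
  have pos: "0 < 1 + s\<^sup>2" for s :: real by (rule add_pos_nonneg) auto
  have dF: "(F has_real_derivative F' s) (at s)" for s
  proof -
    have "((\<lambda>s. x / sqrt (1 + s\<^sup>2)) has_real_derivative - (s * (x / sqrt (1 + s\<^sup>2)) / (1 + s\<^sup>2))) (at s)"
      using pos[of s] by (auto intro!: derivative_eq_intros simp: field_simps)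
    note d2 = DERIV_chain2[OF Phi_has_real_derivative this]
    have d1: "((\<lambda>s. (Phi (x + s) + Phi (x - s)) / 2) has_real_derivative
        (std_normal_density (x + s) - std_normal_density (x - s)) / 2) (at s)"
      by (auto intro!: derivative_eq_intros)
    show ?thesis unfolding F_def F'_def
      using DERIV_diff[OF d1 d2] by (simp add: ac_simps)
  qed
  have F'b: "\<bar>F' r\<bar> \<le> 7 * s\<^sup>2" if r: "0 \<le> r" "r \<le> s" for r
  proof -
    define y where "y = x / sqrt (1 + r\<^sup>2)"
    define c where "c = sqrt (1 + r\<^sup>2)"
    have c: "1 \<le> c" "c \<le> 1 + r" using r sqrt_one_plus_square_le by (auto simp: c_def)
    have x: "x = c * y" using c by (simp add: y_def c_def[symmetric])
    \<comment> \<open>Mean value theorem for the density, whose derivative is minus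
      \<open>?q\<close>. Both terms of \<open>F' r\<close> then have the form \<open>r\<close> times
      a value of \<open>?q\<close>, with opposite signs and nearby arguments.\<close>
    have "\<exists>z. \<bar>z - x\<bar> \<le> r \<and> std_normal_density (x + r) - std_normal_density (x - r) = 2 * r * (- ?q z)"
    proof (cases "r = 0")
      case False
      then have "x - r < x + r" using r by auto
      then obtain z where "x - r < z" "z < x + r"
        "std_normal_density (x + r) - std_normal_density (x - r) = (x + r - (x - r)) * (- z * std_normal_density z)"
        using MVT2[of "x - r" "x + r" std_normal_density "\<lambda>z. - z * std_normal_density z"] std_normal_density_deriv by blast
      then show ?thesis by (intro exI[of _ z]) auto
    qed (auto intro: exI[of _ x])
    then obtain z where z: "\<bar>z - x\<bar> \<le> r"
      "std_normal_density (x + r) - std_normal_density (x - r) = 2 * r * (- ?q z)" by blast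
    have q1: "\<bar>?q z - ?q x\<bar> \<le> 2 * r"
    proof -
      have "\<bar>?q z - ?q x\<bar> \<le> 2 * \<bar>z - x\<bar>"
        by (rule abs_diff_le_of_deriv_bound[OF mult_density_deriv])
           (use abs_mult_density_bounds(2) in \<open>simp add: abs_mult\<close>)
      also have "\<dots> \<le> 2 * r" using z(1) by simp
      finally show ?thesis .
    qed
    \<comment> \<open>Uniform in \<open>y\<close> for the reason met in \<open>Phi_dilation\<close>:
      the derivative bound \<open>4 / \<bar>y\<bar>\<close> is multiplied by a length
      \<open>(c - 1) * \<bar>y\<bar>\<close>.\<close>
    have q2: "\<bar>?q x - ?q y\<bar> \<le> 4 * r"
    proof (cases "y = 0")
      case False
      have between: "\<bar>y\<bar> \<le> \<bar>w\<bar>" if "w \<in> {min (c * y) y..max (c * y) y}" for w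
      proof (cases "0 < y")
        case True then have "y \<le> c * y" using c by simp
        then show ?thesis using that True by auto
      next
        case w: False then have "c * y \<le> y" using c False mult_right_mono_neg[of 1 c y] by simp
        then show ?thesis using that w by auto
      qed
      have "\<bar>?q (c * y) - ?q y\<bar> \<le> (4 / \<bar>y\<bar>) * \<bar>c * y - y\<bar>"
      proof (rule abs_diff_le_of_deriv_bound[OF mult_density_deriv])
        fix w assume "w \<in> {min (c * y) y..max (c * y) y}"
        then have "\<bar>y\<bar> * (\<bar>1 - w\<^sup>2\<bar> * std_normal_density w) \<le> \<bar>w\<bar> * (\<bar>1 - w\<^sup>2\<bar> * std_normal_density w)"
          by (intro mult_right_mono between) auto
        also have "\<dots> \<le> 4" using abs_mult_density_bounds(3)[of w] by (simp add: mult.assoc)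
        finally show "\<bar>(1 - w\<^sup>2) * std_normal_density w\<bar> \<le> 4 / \<bar>y\<bar>"
          using False by (simp add: abs_mult pos_le_divide_eq mult.commute)
      qed
      also have "c * y - y = (c - 1) * y" by (simp add: algebra_simps)
      also have "4 / \<bar>y\<bar> * \<bar>(c - 1) * y\<bar> = 4 * (c - 1)" using False c by (simp add: abs_mult)
      also have "\<dots> \<le> 4 * r" using c by simp
      finally show ?thesis using x by simp
    qed (use x r in simp)
    have q3: "\<bar>?q y - ?q y / (1 + r\<^sup>2)\<bar> \<le> r"
    proof -
      have "?q y - ?q y / (1 + r\<^sup>2) = ?q y * (r\<^sup>2 / (1 + r\<^sup>2))" using pos[of r] by (simp add: field_simps)
      then have "\<bar>?q y - ?q y / (1 + r\<^sup>2)\<bar> = \<bar>?q y\<bar> * (r\<^sup>2 / (1 + r\<^sup>2))" using pos[of r] by (simp add: abs_mult)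
      also have "\<dots> \<le> 1 * r"
      proof (rule mult_mono)
        show "\<bar>?q y\<bar> \<le> 1" using abs_mult_density_bounds(1)[of y] by (simp add: abs_mult)
        have "r \<le> 1 + r\<^sup>2" using zero_le_power2[of "r - 1"] r by (simp add: power2_eq_square algebra_simps)
        then have "r * r \<le> r * (1 + r\<^sup>2)" using r by (intro mult_left_mono)
        then show "r\<^sup>2 / (1 + r\<^sup>2) \<le> r" using pos[of r] by (simp add: pos_divide_le_eq power2_eq_square)
      qed (use r pos[of r] in auto)
      finally show ?thesis by simp
    qed
    \<comment> \<open>The three differences contribute 2, 4 and 1 times \<open>r\<close>, which is
      the origin of the constant 7.\<close>
    have "F' r = - r * ((?q z - ?q x) + (?q x - ?q y) + (?q y - ?q y / (1 + r\<^sup>2)))"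
      unfolding F'_def y_def[symmetric] z(2) by (simp add: algebra_simps)
    then have "\<bar>F' r\<bar> = r * \<bar>(?q z - ?q x) + (?q x - ?q y) + (?q y - ?q y / (1 + r\<^sup>2))\<bar>"
      using r by (simp add: abs_mult)
    also have "\<dots> \<le> r * (7 * r)"
      using q1 q2 q3 r by (intro mult_left_mono) linarith+
    also have "\<dots> \<le> 7 * s\<^sup>2" using r by (simp add: power2_eq_square mult_mono)
    finally show ?thesis .
  qed
  have "\<bar>F s - F 0\<bar> \<le> 7 * s\<^sup>2 * \<bar>s - 0\<bar>"
    by (rule abs_diff_le_of_deriv_bound[OF dF]) (use F'b s in auto)
  moreover have "F 0 = 0" by (simp add: F_def)
  ultimately show ?thesis using s by (simp add: F_def power3_eq_cube power2_eq_square)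
qed

lemma Phi_heat_step:
  assumes "0 \<le> s" "0 < t"
  shows "\<bar>(Phi ((x + s) / sqrt t) + Phi ((x - s) / sqrt t)) / 2 - Phi (x / sqrt (t + s\<^sup>2))\<bar> \<le> 7 * (s / sqrt t) ^ 3"
proof -
  have "sqrt (t + s\<^sup>2) = sqrt t * sqrt (1 + (s / sqrt t)\<^sup>2)"
    using assms by (simp add: real_sqrt_mult[symmetric] power_divide field_simps)
  then show ?thesis
    using Phi_heat_step_unit[of "s / sqrt t" "x / sqrt t"] assms
    by (simp add: add_divide_distrib diff_divide_distrib)
qed

section \<open>Rademacher sums, their distance from the normal law, and the quantile map\<close>

definition sign_lists :: "nat \<Rightarrow> int list set" where
  "sign_lists m = {xs. set xs \<subseteq> {-1, 1} \<and> length xs = m}"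

lemma finite_sign_lists [simp]: "finite (sign_lists m)"
  unfolding sign_lists_def by (rule finite_lists_length_eq) simp

lemma card_sign_lists [simp]: "card (sign_lists m) = 2 ^ m"
  unfolding sign_lists_def by (subst card_lists_length_eq) (auto simp: numeral_2_eq_2)

lemma sum_sign_lists_Suc:
  "(\<Sum>v\<in>sign_lists (Suc m). f v) = (\<Sum>v\<in>sign_lists m. f (1 # v) + f (- 1 # v))" for f :: "int list \<Rightarrow> real"
proof -
  have eq: "sign_lists (Suc m) = (#) 1 ` sign_lists m \<union> (#) (- 1) ` sign_lists m"
    unfolding sign_lists_def by (auto simp: image_iff length_Suc_conv)
  show ?thesis unfolding eq
    by (subst sum.union_disjoint) (auto simp: sum.reindex sum.distrib)
qed

text \<open>The law of a sum of \<open>m\<close> fair signs, kept as an average over sign vectors.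
  The normal approximation thereby speaks directly about numbers of sign vectors, which is what the
  quantile map needs.\<close>

definition rad_mean :: "nat \<Rightarrow> (real \<Rightarrow> real) \<Rightarrow> real" where
  "rad_mean m f = (\<Sum>v\<in>sign_lists m. f (real_of_int (sum_list v))) / 2 ^ m"

lemma rad_mean_0 [simp]: "rad_mean 0 f = f 0"
proof -
  have "sign_lists 0 = {[]}" by (auto simp: sign_lists_def)
  then show ?thesis by (simp add: rad_mean_def)
qed

lemma rad_mean_Suc: "rad_mean (Suc m) f = (rad_mean m (\<lambda>k. f (1 + k)) + rad_mean m (\<lambda>k. f (- 1 + k))) / 2"
  unfolding rad_mean_def sum_sign_lists_Suc by (simp add: sum.distrib field_simps)

lemma rad_mean_mono: "(\<And>k. f k \<le> g k) \<Longrightarrow> rad_mean m f \<le> rad_mean m g"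
  unfolding rad_mean_def by (intro divide_right_mono sum_mono) auto

lemma rad_mean_add_const: "rad_mean m (\<lambda>k. f k + c) = rad_mean m f + c"
  unfolding rad_mean_def by (simp add: sum.distrib add_divide_distrib)

text \<open>Lindeberg replacement: each sign is exchanged for an advance of the heat flow by time
  \<open>s\<^sup>2\<close>. The time never falls below \<open>t\<close>, so each of the
  \<open>m\<close> exchanges costs at most the error of a step at time \<open>t\<close>.\<close>

lemma rad_mean_Phi:
  assumes "0 \<le> s" "0 < t"
  shows "\<bar>rad_mean m (\<lambda>k. Phi ((a - s * k) / sqrt t)) - Phi (a / sqrt (t + real m * s\<^sup>2))\<bar> \<le> real m * (7 * (s / sqrt t) ^ 3)"
proof (induction m arbitrary: a)
  case (Suc m)
  let ?t = "t + real m * s\<^sup>2"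
  have t: "t \<le> ?t" by simp
  have e: "\<bar>(Phi ((a + s) / sqrt ?t) + Phi ((a - s) / sqrt ?t)) / 2 - Phi (a / sqrt (?t + s\<^sup>2))\<bar> \<le> 7 * (s / sqrt t) ^ 3"
  proof (rule order_trans[OF Phi_heat_step])
    show "7 * (s / sqrt ?t) ^ 3 \<le> 7 * (s / sqrt t) ^ 3"
      using assms t by (intro mult_left_mono power_mono divide_left_mono) (auto intro!: add_pos_nonneg mult_pos_pos)
  qed (use assms in \<open>auto intro: add_pos_nonneg\<close>)
  have avg: "\<bar>(p + q) / 2 - Phi z\<bar> \<le> E + e"
    if "\<bar>p - P\<bar> \<le> E" "\<bar>q - Q\<bar> \<le> E" "\<bar>(Q + P) / 2 - Phi z\<bar> \<le> e" for p q P Q E e z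
    using that[THEN abs_le_D1] that[THEN abs_le_D2] by (intro abs_leI) argo+
  have "rad_mean (Suc m) (\<lambda>k. Phi ((a - s * k) / sqrt t)) =
    (rad_mean m (\<lambda>k. Phi ((a - s - s * k) / sqrt t)) + rad_mean m (\<lambda>k. Phi ((a + s - s * k) / sqrt t))) / 2"
    unfolding rad_mean_Suc by (simp add: algebra_simps)
  moreover have "t + real (Suc m) * s\<^sup>2 = ?t + s\<^sup>2" by (simp add: algebra_simps)
  moreover have "real (Suc m) * (7 * (s / sqrt t) ^ 3) = real m * (7 * (s / sqrt t) ^ 3) + 7 * (s / sqrt t) ^ 3"
    by (simp add: distrib_right)
  ultimately show ?case
    using avg[OF Suc.IH[of "a - s"] Suc.IH[of "a + s"] e] by (simp only:)
qed simp

lemma Phi_tail: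
  assumes "0 < A" shows "1 - Phi A \<le> 4 / A\<^sup>2" "Phi (- A) \<le> 4 / A\<^sup>2"
proof -
  interpret prob_space std_normal_distribution by (rule prob_space_std_normal_distribution)
  note N = std_normal_identity
  have sg: "subgaussian (\<lambda>x. x)" by (rule subgaussian_std_normal[OF N])
  have "prob {x\<in>space std_normal_distribution. A \<le> \<bar>x\<bar>} \<le> 2 * exp (- A\<^sup>2 / (2 * 1))"
    using sg assms by (intro chernoff_two_sided) (auto simp: subgaussian_def)
  also have "\<dots> = 2 / exp (A\<^sup>2 / 2)" by (simp add: exp_minus field_simps)
  also have "\<dots> \<le> 2 / (A\<^sup>2 / 2)"
  proof (rule divide_left_mono)
    show "A\<^sup>2 / 2 \<le> exp (A\<^sup>2 / 2)" using exp_ge_add_one_self[of "A\<^sup>2 / 2"] by linarith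
  qed (use assms in auto)
  finally have tail: "prob {x. A \<le> \<bar>x\<bar>} \<le> 4 / A\<^sup>2" by (simp add: field_simps)
  have "Phi (- A) \<le> prob {x. A \<le> \<bar>x\<bar>}" unfolding Phi_def by (intro finite_measure_mono) auto
  with tail show "Phi (- A) \<le> 4 / A\<^sup>2" by simp
  have "1 - Phi A = prob (space std_normal_distribution - {..A})" unfolding Phi_def by (subst prob_compl) auto
  also have "\<dots> \<le> prob {x. A \<le> \<bar>x\<bar>}" by (intro finite_measure_mono) auto
  finally show "1 - Phi A \<le> 4 / A\<^sup>2" using tail by simp
qed

text \<open>Of the constant 13, the heat flow takes 7, the Gaussian tail 4, the dilation 1 and the
  shift 1.\<close>

definition kolm :: "nat \<Rightarrow> real" where
  "kolm m = 13 * real m powr (- 1 / 16)"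

text \<open>The indicator of a half-line is compared with \<open>Phi\<close> at width
  \<open>d\<close>, shifted by \<open>A * d\<close>. With \<open>d = m powr (- 1 / 8)\<close> the
  heat flow costs \<open>m * (s / d) ^ 3\<close>, of order \<open>m powr (- 1 / 8)\<close>; with
  \<open>A = m powr (1 / 16)\<close> the tail \<open>4 / A\<^sup>2\<close> equals
  \<open>4 * d\<close>. The shift \<open>A * d = m powr (- 1 / 16)\<close> dominates. The weak and
  the strict inequality are needed on the two sides of an atom of the sum.\<close>

lemma rad_mean_kolmogorov:
  assumes m: "0 < m"
  shows "rad_mean m (\<lambda>k. if k \<le> y then 1 else 0) \<le> Phi (y / sqrt (real m)) + kolm m"
    and "Phi (y / sqrt (real m)) - kolm m \<le> rad_mean m (\<lambda>k. if k < y then 1 else 0)"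
proof -
  define s where "s = 1 / sqrt (real m)"
  define d where "d = real m powr (- 1 / 8)"
  define A where "A = real m powr (1 / 16)"
  have m1: "1 \<le> real m" using m by simp
  have pos: "0 < s" "0 < d" "0 < A" using m by (auto simp: s_def d_def A_def)
  have sm: "real m * s\<^sup>2 = 1" using m by (simp add: s_def power_divide)
  have A2: "4 / A\<^sup>2 = 4 * d"
    using m by (simp add: A_def d_def power2_eq_square powr_add[symmetric] powr_minus divide_simps)
  have Ad: "A * d = real m powr (- 1 / 16)" by (simp add: A_def d_def powr_add[symmetric])
  have d1: "d \<le> real m powr (- 1 / 16)" unfolding d_def using m1 by (intro powr_mono) auto
  have err: "real m * (7 * (s / d) ^ 3) \<le> 7 * real m powr (- 1 / 16)"
  proof -
    have "s = real m powr (- 1 / 2)" using m by (simp add: s_def powr_minus powr_half_sqrt inverse_eq_divide)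
    then have "s / d = real m powr (- 3 / 8)" by (simp add: d_def powr_diff[symmetric])
    then have "(s / d) ^ 3 = real m powr (- 9 / 8)" using m by (simp add: powr_power)
    then have "real m * (7 * (s / d) ^ 3) = 7 * (real m powr 1 * real m powr (- 9 / 8))" using m by simp
    also have "\<dots> = 7 * real m powr (- 1 / 8)" by (subst powr_add[symmetric]) simp
    also have "\<dots> \<le> 7 * real m powr (- 1 / 16)" using m1 by (intro mult_left_mono powr_mono) auto
    finally show ?thesis .
  qed
  have sq: "sqrt (d\<^sup>2) = d" using pos by simp
  have mean: "\<bar>rad_mean m (\<lambda>k. Phi ((a - s * k) / d)) - Phi (a / sqrt (1 + d\<^sup>2))\<bar> \<le> 7 * real m powr (- 1 / 16)" for a
    using rad_mean_Phi[of s "d\<^sup>2" m a] pos sm err unfolding sq by (simp add: add.commute)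
  have dil: "\<bar>Phi a - Phi (a / sqrt (1 + d\<^sup>2))\<bar> \<le> d" for a
    using Phi_dilation[of "sqrt (1 + d\<^sup>2)" "a / sqrt (1 + d\<^sup>2)"] sqrt_one_plus_square_le[of d] pos
    by (auto simp: add_nonneg_eq_0_iff)
  have ys: "y / sqrt (real m) = s * y" by (simp add: s_def)
  have tail: "1 - Phi A \<le> 4 * d" "Phi (- A) \<le> 4 * d" using Phi_tail[OF pos(3)] A2 by auto
  have "rad_mean m (\<lambda>k. if k \<le> y then 1 else 0) \<le> rad_mean m (\<lambda>k. Phi ((s * y + A * d - s * k) / d) + 4 * d)"
  proof (rule rad_mean_mono)
    fix k :: real
    show "(if k \<le> y then 1 else 0) \<le> Phi ((s * y + A * d - s * k) / d) + 4 * d"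
    proof (cases "k \<le> y")
      case True
      then have "s * k \<le> s * y" using pos by simp
      then have "A \<le> (s * y + A * d - s * k) / d" using pos by (simp add: le_divide_eq)
      then have "Phi A \<le> Phi ((s * y + A * d - s * k) / d)" by (simp add: Phi_le_iff)
      then show ?thesis using True tail by simp
    qed (use pos Phi_bounds(1)[of "(s * y + A * d - s * k) / d"] in simp)
  qed
  also have "\<dots> = rad_mean m (\<lambda>k. Phi ((s * y + A * d - s * k) / d)) + 4 * d" by (rule rad_mean_add_const)
  also have "\<dots> \<le> Phi (s * y) + kolm m"
    using mean[of "s * y + A * d"] dil[of "s * y + A * d"] Phi_lipschitz[of "s * y + A * d" "s * y"] Ad d1 pos
    by (simp add: kolm_def)
  finally show "rad_mean m (\<lambda>k. if k \<le> y then 1 else 0) \<le> Phi (y / sqrt (real m)) + kolm m"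
    unfolding ys .
  have "rad_mean m (\<lambda>k. Phi ((s * y - A * d - s * k) / d)) \<le> rad_mean m (\<lambda>k. (if k < y then 1 else 0) + 4 * d)"
  proof (rule rad_mean_mono)
    fix k :: real
    show "Phi ((s * y - A * d - s * k) / d) \<le> (if k < y then 1 else 0) + 4 * d"
    proof (cases "k < y")
      case False
      then have "s * y \<le> s * k" using pos by simp
      then have "(s * y - A * d - s * k) / d \<le> - A" using pos by (simp add: divide_le_eq)
      then have "Phi ((s * y - A * d - s * k) / d) \<le> Phi (- A)" by (simp add: Phi_le_iff)
      then show ?thesis using False tail by simp
    qed (use pos Phi_bounds(2)[of "(s * y - A * d - s * k) / d"] in simp)
  qed
  also have "\<dots> = rad_mean m (\<lambda>k. if k < y then 1 else 0) + 4 * d" by (rule rad_mean_add_const)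
  finally show "Phi (y / sqrt (real m)) - kolm m \<le> rad_mean m (\<lambda>k. if k < y then 1 else 0)"
    using mean[of "s * y - A * d"] dil[of "s * y - A * d"] Phi_lipschitz[of "s * y - A * d" "s * y"] Ad d1 pos
    unfolding ys by (simp add: kolm_def)
qed

lemma sorted_sign_enumeration:
  "\<exists>e. bij_betw e {..<2 ^ m :: nat} (sign_lists m) \<and> (\<forall>i j. i \<le> j \<longrightarrow> j < 2 ^ m \<longrightarrow> sum_list (e i) \<le> sum_list (e j))"
proof -
  obtain xs where xs: "set xs = sign_lists m" "distinct xs"
    using finite_distinct_list[of "sign_lists m"] by auto
  define ys where "ys = sort_key sum_list xs"
  have ys: "set ys = sign_lists m" "distinct ys" "sorted (map sum_list ys)"
    using xs by (simp_all add: ys_def)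
  have len: "length ys = 2 ^ m" using distinct_card[OF ys(2)] ys(1) by simp
  show ?thesis
  proof (intro exI[of _ "(!) ys"] conjI allI impI)
    show "bij_betw ((!) ys) {..<2 ^ m} (sign_lists m)"
      using bij_betw_nth[OF ys(2)] len ys(1) by simp
    show "sum_list (ys ! i) \<le> sum_list (ys ! j)" if "i \<le> j" "j < 2 ^ m" for i j
      using sorted_nth_mono[OF ys(3), of i j] that len by simp
  qed
qed

text \<open>Only the order by sums matters; vectors with equal sums may come in any order.\<close>

definition sign_enum :: "nat \<Rightarrow> nat \<Rightarrow> int list" where
  "sign_enum m = (SOME e. bij_betw e {..<2 ^ m} (sign_lists m) \<and> (\<forall>i j. i \<le> j \<longrightarrow> j < 2 ^ m \<longrightarrow> sum_list (e i) \<le> sum_list (e j)))"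

lemma sign_enum:
  "bij_betw (sign_enum m) {..<2 ^ m} (sign_lists m)"
  "i \<le> j \<Longrightarrow> j < 2 ^ m \<Longrightarrow> sum_list (sign_enum m i) \<le> sum_list (sign_enum m j)"
  using someI_ex[OF sorted_sign_enumeration[of m]] unfolding sign_enum_def by blast+

text \<open>\<open>Phi\<close> makes a standard normal argument uniform, so the number of its dyadic
  cell is uniform among the \<open>2 ^ m\<close> indices of sign vectors.\<close>

definition quantile_index :: "nat \<Rightarrow> real \<Rightarrow> nat" where
  "quantile_index m x = nat \<lfloor>2 ^ m * Phi x\<rfloor>"

definition quantile_signs :: "nat \<Rightarrow> real \<Rightarrow> int list" where
  "quantile_signs m x = sign_enum m (quantile_index m x)"

lemma quantile_index_bounds:
  "quantile_index m x < 2 ^ m" "real (quantile_index m x) \<le> 2 ^ m * Phi x" "2 ^ m * Phi x < real (quantile_index m x) + 1"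
proof -
  have "0 \<le> 2 ^ m * Phi x" using Phi_bounds[of x] by simp
  then show a: "real (quantile_index m x) \<le> 2 ^ m * Phi x" "2 ^ m * Phi x < real (quantile_index m x) + 1"
    unfolding quantile_index_def by (auto simp: of_nat_nat)
  have "2 ^ m * Phi x < 2 ^ m" using Phi_bounds[of x] by simp
  with a(1) have "real (quantile_index m x) < 2 ^ m" by linarith
  then have "real (quantile_index m x) < real (2 ^ m)" by (simp only: of_nat_power of_nat_numeral)
  then show "quantile_index m x < 2 ^ m" by (simp only: of_nat_less_iff)
qed

lemma quantile_signs_in: "quantile_signs m x \<in> sign_lists m"
  unfolding quantile_signs_def using bij_betw_apply[OF sign_enum(1)] quantile_index_bounds(1) by simp

lemma rad_mean_indicator:
  "rad_mean m (\<lambda>k. if P k then 1 else 0) = real (card {v\<in>sign_lists m. P (real_of_int (sum_list v))}) / 2 ^ m"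
  unfolding rad_mean_def by (simp add: sum.If_cases Int_def)

text \<open>Let \<open>y\<close> be the sum of the selected vector, with index \<open>i\<close>.
  Since the enumeration is sorted, at most \<open>i\<close> vectors have a sum below
  \<open>y\<close> and at least \<open>i + 1\<close> have a sum up to \<open>y\<close>. Hence
  \<open>Phi x\<close> lies between the left limit and the value at \<open>y\<close> of the
  distribution function of the sum, and both are within \<open>kolm m\<close> of the normal
  value.\<close>

lemma quantile_signs_close:
  assumes m: "0 < m"
  shows "\<bar>Phi x - Phi (real_of_int (sum_list (quantile_signs m x)) / sqrt (real m))\<bar> \<le> kolm m"
proof -
  define i where "i = quantile_index m x"
  define y where "y = real_of_int (sum_list (quantile_signs m x))"
  have y: "y = real_of_int (sum_list (sign_enum m i))" by (simp add: y_def quantile_signs_def i_def)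
  note i = quantile_index_bounds[of m x, folded i_def]
  have inj: "inj_on (sign_enum m) {..<2 ^ m}" and img: "sign_enum m ` {..<2 ^ m} = sign_lists m"
    using sign_enum(1)[of m] by (auto simp: bij_betw_def)
  have "sign_enum m ` {..i} \<subseteq> {v\<in>sign_lists m. real_of_int (sum_list v) \<le> y}"
    using i(1) img sign_enum(2)[of _ i m] by (auto simp: y)
  then have "card (sign_enum m ` {..i}) \<le> card {v\<in>sign_lists m. real_of_int (sum_list v) \<le> y}"
    by (intro card_mono) auto
  also have "card (sign_enum m ` {..i}) = Suc i"
    using i(1) by (subst card_image) (auto intro: inj_on_subset[OF inj])
  finally have up: "real i + 1 \<le> real (card {v\<in>sign_lists m. real_of_int (sum_list v) \<le> y})" by simp
  have "{v\<in>sign_lists m. real_of_int (sum_list v) < y} \<subseteq> sign_enum m ` {..<i}"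
  proof
    fix v assume v: "v \<in> {v\<in>sign_lists m. real_of_int (sum_list v) < y}"
    then obtain k where k: "k < 2 ^ m" "v = sign_enum m k" using img by (auto simp: image_iff)
    have "\<not> i \<le> k" using v k sign_enum(2)[of i k m] by (auto simp: y)
    then show "v \<in> sign_enum m ` {..<i}" using k by auto
  qed
  then have "card {v\<in>sign_lists m. real_of_int (sum_list v) < y} \<le> card (sign_enum m ` {..<i})"
    by (intro card_mono) auto
  also have "\<dots> \<le> i" using card_image_le[of "{..<i}" "sign_enum m"] by simp
  finally have lo: "real (card {v\<in>sign_lists m. real_of_int (sum_list v) < y}) \<le> real i" by simp
  have "Phi x \<le> rad_mean m (\<lambda>k. if k \<le> y then 1 else 0)"
    unfolding rad_mean_indicator using up i by (simp add: le_divide_eq mult.commute)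
  moreover have "rad_mean m (\<lambda>k. if k < y then 1 else 0) \<le> Phi x"
    unfolding rad_mean_indicator using lo i by (simp add: divide_le_eq mult.commute)
  ultimately show ?thesis
    using rad_mean_kolmogorov[OF m, of y] unfolding y_def[symmetric] by linarith
qed

section \<open>Quantile coupling of signs with a normal variable\<close>

lemma sum_sign_lists_prod:
  "(\<Sum>v\<in>sign_lists m. \<Prod>j<m. f j (v ! j)) = (\<Prod>j<m. f j 1 + f j (- 1 :: int) :: real)"
proof (induction m arbitrary: f)
  case 0
  have "sign_lists 0 = {[]}" by (auto simp: sign_lists_def)
  then show ?case by simp
next
  case (Suc m)
  have "(\<Sum>v\<in>sign_lists (Suc m). \<Prod>j<Suc m. f j (v ! j))
      = (f 0 1 + f 0 (- 1)) * (\<Sum>v\<in>sign_lists m. \<Prod>j<m. f (Suc j) (v ! j))"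
    by (simp add: sum_sign_lists_Suc prod.lessThan_Suc_shift sum.distrib distrib_right sum_distrib_left
        del: prod.lessThan_Suc)
  also have "\<dots> = (\<Prod>j<Suc m. f j 1 + f j (- 1))"
    unfolding Suc.IH[of "\<lambda>j. f (Suc j)"] by (simp add: prod.lessThan_Suc_shift del: prod.lessThan_Suc)
  finally show ?case .
qed

lemma quantile_index_measurable [measurable]: "quantile_index m \<in> borel \<rightarrow>\<^sub>M count_space UNIV"
  unfolding quantile_index_def[abs_def] by measurable

lemma quantile_signs_measurable [measurable]: "quantile_signs m \<in> borel \<rightarrow>\<^sub>M count_space UNIV"
  unfolding quantile_signs_def[abs_def] by measurable

lemma (in prob_space) prob_quantile_signs_eq:
  assumes X: "std_normal X" and v: "v \<in> sign_lists m"
  shows "prob {\<omega>\<in>space M. quantile_signs m (X \<omega>) = v} = 1 / 2 ^ m"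
proof -
  have [measurable]: "random_variable borel X" using std_normal_random_variable[OF X] .
  have "v \<in> sign_enum m ` {..<2 ^ m}"
    using v unfolding bij_betw_imp_surj_on[OF sign_enum(1)] .
  then obtain i where i: "i < 2 ^ m" "sign_enum m i = v" by auto
  have i1: "real i + 1 \<le> 2 ^ m"
  proof -
    have "real (i + 1) \<le> real (2 ^ m)" using i(1) by (simp only: of_nat_le_iff)
    then show ?thesis by simp
  qed
  have "quantile_signs m x = v \<longleftrightarrow> quantile_index m x = i" for x
    using i quantile_index_bounds(1)[of m x] sign_enum(1)[of m]
    by (auto simp: quantile_signs_def bij_betw_def dest: inj_onD)
  moreover have "quantile_index m x = i \<longleftrightarrow> Phi x < (real i + 1) / 2 ^ m \<and> \<not> Phi x < real i / 2 ^ m" for x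
  proof -
    have "quantile_index m x = i \<longleftrightarrow> real i \<le> 2 ^ m * Phi x \<and> 2 ^ m * Phi x < real i + 1"
      using quantile_index_bounds(2,3)[of m x] by (auto; linarith)
    then show ?thesis by (auto simp: field_simps)
  qed
  ultimately have "{\<omega>\<in>space M. quantile_signs m (X \<omega>) = v}
      = {\<omega>\<in>space M. Phi (X \<omega>) < (real i + 1) / 2 ^ m} - {\<omega>\<in>space M. Phi (X \<omega>) < real i / 2 ^ m}"
    by auto
  also have "prob \<dots> = prob {\<omega>\<in>space M. Phi (X \<omega>) < (real i + 1) / 2 ^ m} - prob {\<omega>\<in>space M. Phi (X \<omega>) < real i / 2 ^ m}"
  proof (rule finite_measure_Diff)
    have "real i / 2 ^ m \<le> (real i + 1) / 2 ^ m" by (simp add: divide_right_mono)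
    then show "{\<omega>\<in>space M. Phi (X \<omega>) < real i / 2 ^ m} \<subseteq> {\<omega>\<in>space M. Phi (X \<omega>) < (real i + 1) / 2 ^ m}"
      by (auto intro: less_le_trans)
  qed auto
  also have "\<dots> = (real i + 1) / 2 ^ m - real i / 2 ^ m"
    using i1 i(1) by (subst (1 2) prob_std_normal_Phi_less[OF X]) auto
  also have "\<dots> = 1 / 2 ^ m" by (simp add: add_divide_distrib)
  finally show ?thesis .
qed

lemma (in prob_space) prob_quantile_signs:
  assumes X: "std_normal X"
  shows "prob {\<omega>\<in>space M. P (quantile_signs m (X \<omega>))} = (\<Sum>v\<in>sign_lists m. if P v then 1 else 0) / 2 ^ m"
proof -
  have [measurable]: "random_variable borel X" using std_normal_random_variable[OF X] .
  have "{\<omega>\<in>space M. P (quantile_signs m (X \<omega>))}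
      = (\<Union>v\<in>{v\<in>sign_lists m. P v}. {\<omega>\<in>space M. quantile_signs m (X \<omega>) = v})"
    using quantile_signs_in by auto
  also have "prob \<dots> = (\<Sum>v\<in>{v\<in>sign_lists m. P v}. prob {\<omega>\<in>space M. quantile_signs m (X \<omega>) = v})"
    by (rule finite_measure_finite_Union) (auto simp: disjoint_family_on_def)
  also have "\<dots> = (\<Sum>v\<in>{v\<in>sign_lists m. P v}. 1 / 2 ^ m)"
    by (intro sum.cong prob_quantile_signs_eq[OF X]) auto
  also have "\<dots> = (\<Sum>v\<in>sign_lists m. if P v then 1 else 0) / 2 ^ m"
    by (simp add: sum.If_cases Int_def)
  finally show ?thesis .
qed

definition (in prob_space) fair_sign :: "('a \<Rightarrow> int) \<Rightarrow> bool" where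
  "fair_sign \<xi> \<longleftrightarrow> random_variable (count_space UNIV) \<xi> \<and> (\<forall>\<omega>. \<xi> \<omega> = 1 \<or> \<xi> \<omega> = - 1) \<and>
     prob {\<omega>\<in>space M. \<xi> \<omega> = 1} = 1 / 2 \<and> prob {\<omega>\<in>space M. \<xi> \<omega> = - 1} = 1 / 2"

text \<open>A uniform sign vector has independent fair coordinates: the indicator of a box is a
  product over coordinates, and its sum over all sign vectors factors. Here \<open>h\<close> is the
  law of one fair sign.\<close>

lemma (in prob_space) quantile_signs_components:
  assumes X: "std_normal X"
  shows "indep_vars (\<lambda>_. count_space UNIV) (\<lambda>j \<omega>. quantile_signs m (X \<omega>) ! j) {..<m}"
    and "j < m \<Longrightarrow> fair_sign (\<lambda>\<omega>. quantile_signs m (X \<omega>) ! j)"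
proof -
  have [measurable]: "random_variable borel X" using std_normal_random_variable[OF X] .
  define h where "h A = (indicator A (1::int) + indicator A (- 1)) / (2::real)" for A
  have box: "prob {\<omega>\<in>space M. \<forall>j<m. quantile_signs m (X \<omega>) ! j \<in> A j} = (\<Prod>j<m. h (A j))" for A
  proof -
    have "prob {\<omega>\<in>space M. \<forall>j<m. quantile_signs m (X \<omega>) ! j \<in> A j}
        = (\<Sum>v\<in>sign_lists m. if \<forall>j<m. v ! j \<in> A j then 1 else 0) / 2 ^ m"
      by (rule prob_quantile_signs[OF X])
    also have "(\<Sum>v\<in>sign_lists m. if \<forall>j<m. v ! j \<in> A j then 1 else 0)
        = (\<Sum>v\<in>sign_lists m. \<Prod>j<m. indicator (A j) (v ! j) :: real)"
      by (intro sum.cong refl) (auto simp: indicator_def intro!: prod_zero)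
    also have "\<dots> = (\<Prod>j<m. indicator (A j) 1 + indicator (A j) (- 1))" by (rule sum_sign_lists_prod)
    also have "\<dots> / 2 ^ m = (\<Prod>j<m. h (A j))" by (simp add: h_def prod_dividef)
    finally show ?thesis .
  qed
  have single: "prob {\<omega>\<in>space M. quantile_signs m (X \<omega>) ! j \<in> A} = h A" if j: "j < m" for j A
  proof -
    have "{\<omega>\<in>space M. quantile_signs m (X \<omega>) ! j \<in> A}
        = {\<omega>\<in>space M. \<forall>i<m. quantile_signs m (X \<omega>) ! i \<in> (if i = j then A else UNIV)}"
      using j by auto
    also have "prob \<dots> = (\<Prod>i<m. h (if i = j then A else UNIV))" by (rule box)
    also have "\<dots> = (\<Prod>i<m. if i = j then h A else 1)" by (intro prod.cong) (auto simp: h_def)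
    also have "\<dots> = h A" using j by simp
    finally show ?thesis .
  qed
  show "indep_vars (\<lambda>_. count_space UNIV) (\<lambda>j \<omega>. quantile_signs m (X \<omega>) ! j) {..<m}"
  proof (cases "m = 0")
    case True then show ?thesis by (simp add: indep_vars_def2 indep_sets_def)
  next
    case False
    show ?thesis
    proof (subst indep_vars_finite[where E = "\<lambda>_. UNIV"])
      show "\<forall>A\<in>{..<m} \<rightarrow> UNIV. prob (\<Inter>j<m. (\<lambda>\<omega>. quantile_signs m (X \<omega>) ! j) -` A j \<inter> space M) =
          (\<Prod>j<m. prob ((\<lambda>\<omega>. quantile_signs m (X \<omega>) ! j) -` A j \<inter> space M))"
      proof
        fix A :: "nat \<Rightarrow> int set"
        have "(\<Inter>j<m. (\<lambda>\<omega>. quantile_signs m (X \<omega>) ! j) -` A j \<inter> space M)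
            = {\<omega>\<in>space M. \<forall>j<m. quantile_signs m (X \<omega>) ! j \<in> A j}"
          using False by auto
        moreover have "(\<Prod>j<m. prob ((\<lambda>\<omega>. quantile_signs m (X \<omega>) ! j) -` A j \<inter> space M)) = (\<Prod>j<m. h (A j))"
        proof (rule prod.cong[OF refl])
          fix j assume "j \<in> {..<m}"
          then show "prob ((\<lambda>\<omega>. quantile_signs m (X \<omega>) ! j) -` A j \<inter> space M) = h (A j)"
            using single[of j "A j"] by (simp add: vimage_def Int_def conj_commute)
        qed
        ultimately show "prob (\<Inter>j<m. (\<lambda>\<omega>. quantile_signs m (X \<omega>) ! j) -` A j \<inter> space M) =
            (\<Prod>j<m. prob ((\<lambda>\<omega>. quantile_signs m (X \<omega>) ! j) -` A j \<inter> space M))"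
          using box[of A] by simp
      qed
    qed (use False in \<open>auto simp: Int_stable_def sigma_sets.Basic set_eq_iff intro: sigma_sets.Basic\<close>)
  qed
  show "fair_sign (\<lambda>\<omega>. quantile_signs m (X \<omega>) ! j)" if j: "j < m"
  proof -
    have "quantile_signs m (X \<omega>) ! j = 1 \<or> quantile_signs m (X \<omega>) ! j = - 1" for \<omega>
    proof -
      have "quantile_signs m (X \<omega>) ! j \<in> set (quantile_signs m (X \<omega>))"
        using quantile_signs_in[of m "X \<omega>"] j by (intro nth_mem) (simp add: sign_lists_def)
      then show ?thesis using quantile_signs_in[of m "X \<omega>"] by (auto simp: sign_lists_def)
    qed
    then show ?thesis
      using single[OF j, of "{1}"] single[OF j, of "{- 1}"] unfolding fair_sign_def by (auto simp: h_def)
  qed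
qed

lemma cosh_le_exp_half_square: "(exp l + exp (- l)) / 2 \<le> exp (l\<^sup>2 / 2)" for l :: real
proof -
  have pos: "(exp l + exp (- l)) / 2 \<le> exp (l\<^sup>2 / 2)" if l: "0 \<le> l" for l :: real
  proof -
    \<comment> \<open>The convexity estimate behind Hoeffding's lemma with weight 1/2 and argument
      \<open>2 * l\<close>; its left side is the logarithm of \<open>cosh l\<close>.\<close>
    have "- (2 * l) * (1 / 2) + ln (1 + 1 / 2 * (exp (2 * l) - 1)) \<le> (2 * l)\<^sup>2 / 8"
      by (rule Hoeffdings_lemma_aux) (use l in auto)
    then have "exp (- l + ln ((1 + exp (2 * l)) / 2)) \<le> exp (l\<^sup>2 / 2)"
      by (simp add: field_simps power2_eq_square)
    moreover have "exp (- l + ln ((1 + exp (2 * l)) / 2)) = (exp l + exp (- l)) / 2"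
    proof -
      have "exp (- l) * exp (2 * l) = exp l" by (simp add: mult_exp_exp)
      moreover have "exp (- l + ln ((1 + exp (2 * l)) / 2)) = exp (- l) * ((1 + exp (2 * l)) / 2)"
        unfolding exp_add by (simp add: add_pos_pos)
      ultimately show ?thesis by (simp add: distrib_left add.commute)
    qed
    ultimately show ?thesis by (simp only:)
  qed
  show ?thesis using pos[of l] pos[of "- l"] by (cases "0 \<le> l") (auto simp: add.commute)
qed

lemma (in prob_space) fair_sign_expectation:
  assumes "fair_sign \<xi>"
  shows "integrable M (\<lambda>\<omega>. f (\<xi> \<omega>) :: real)" and "expectation (\<lambda>\<omega>. f (\<xi> \<omega>)) = (f 1 + f (- 1)) / 2"
proof -
  have [measurable]: "random_variable (count_space UNIV) \<xi>" using assms by (simp add: fair_sign_def)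
  let ?A = "{\<omega>\<in>space M. \<xi> \<omega> = 1}" and ?B = "{\<omega>\<in>space M. \<xi> \<omega> = - 1}"
  have eq: "f (\<xi> \<omega>) = f 1 * indicator ?A \<omega> + f (- 1) * indicator ?B \<omega>" if "\<omega> \<in> space M" for \<omega>
    using assms that by (auto simp: fair_sign_def indicator_def)
  have int: "integrable M (\<lambda>\<omega>. f 1 * indicator ?A \<omega> + f (- 1) * indicator ?B \<omega>)"
    by (intro Bochner_Integration.integrable_add integrable_mult_right) (auto simp: emeasure_eq_measure)
  show "integrable M (\<lambda>\<omega>. f (\<xi> \<omega>))"
    using int by (rule Bochner_Integration.integrable_cong[THEN iffD1, rotated -1]) (auto simp: eq)
  have "expectation (\<lambda>\<omega>. f (\<xi> \<omega>)) = expectation (\<lambda>\<omega>. f 1 * indicator ?A \<omega> + f (- 1) * indicator ?B \<omega>)"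
    by (intro Bochner_Integration.integral_cong) (auto simp: eq)
  also have "\<dots> = f 1 * prob ?A + f (- 1) * prob ?B"
    by (subst Bochner_Integration.integral_add) (auto simp: emeasure_eq_measure)
  also have "prob ?A = 1 / 2" using assms unfolding fair_sign_def by blast
  also have "prob ?B = 1 / 2" using assms unfolding fair_sign_def by blast
  also have "f 1 * (1 / 2) + f (- 1) * (1 / 2) = (f 1 + f (- 1)) / 2" by (simp add: add_divide_distrib)
  finally show "expectation (\<lambda>\<omega>. f (\<xi> \<omega>)) = (f 1 + f (- 1)) / 2" .
qed

lemma (in prob_space) subgaussian_fair_sign:
  assumes "fair_sign \<xi>" shows "subgaussian (\<lambda>\<omega>. real_of_int (\<xi> \<omega>))"
  unfolding subgaussian_def
proof (intro conjI allI)
  show "random_variable borel (\<lambda>\<omega>. real_of_int (\<xi> \<omega>))"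
    using assms by (auto simp: fair_sign_def)
  fix l :: real
  show "integrable M (\<lambda>\<omega>. exp (l * real_of_int (\<xi> \<omega>)))"
    by (rule fair_sign_expectation(1)[OF assms, of "\<lambda>x. exp (l * real_of_int x)"])
  show "expectation (\<lambda>\<omega>. exp (l * real_of_int (\<xi> \<omega>))) \<le> exp (l\<^sup>2 / 2)"
    using fair_sign_expectation(2)[OF assms, of "\<lambda>x. exp (l * real_of_int x)"] cosh_le_exp_half_square[of l]
    by simp
qed

text \<open>On the interval from \<open>- A - 1\<close> to \<open>A + 1\<close> the slope of
  \<open>Phi\<close> is at least \<open>std_normal_density (A + 1)\<close>. As \<open>K\<close> is
  smaller than this slope, \<open>z\<close> cannot be farther than 1 from \<open>x\<close>; the
  truncations \<open>min z (x + 1)\<close> and \<open>max z (x - 1)\<close> express this, and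
  afterwards the slope bound applies to \<open>z\<close> itself.\<close>

lemma Phi_inverse_close:
  assumes A: "0 \<le> A" "\<bar>x\<bar> \<le> A" and K: "\<bar>Phi x - Phi z\<bar> \<le> K" "K < std_normal_density (A + 1)"
  shows "\<bar>z - x\<bar> \<le> K / std_normal_density (A + 1)"
proof -
  define p where "p = (std_normal_density (A + 1) :: real)"
  have p: "0 < p" unfolding p_def by (rule normal_density_pos) simp
  have dens: "p \<le> std_normal_density w" if "\<bar>w\<bar> \<le> A + 1" for w
  proof -
    have "w\<^sup>2 \<le> (A + 1)\<^sup>2" using that A by (simp add: abs_le_square_iff[symmetric])
    then show ?thesis unfolding p_def std_normal_density_def by (intro mult_left_mono) auto
  qed
  have growth: "p * (b - a) \<le> Phi b - Phi a" if "a \<le> b" "- A - 1 \<le> a" "b \<le> A + 1" for a b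
  proof (cases "a = b")
    case False
    then have "a < b" using that by simp
    from MVT2[OF this Phi_has_real_derivative] obtain w where "a < w" "w < b" "Phi b - Phi a = (b - a) * std_normal_density w"
      by blast
    then show ?thesis using dens[of w] that by (simp add: mult.commute mult_left_mono abs_le_iff)
  qed simp
  have "p * \<bar>z - x\<bar> \<le> K"
  proof (cases "x \<le> z")
    case True
    have "p * (min z (x + 1) - x) \<le> Phi (min z (x + 1)) - Phi x"
      using A True by (intro growth) auto
    also have "\<dots> \<le> Phi z - Phi x" by (simp add: Phi_le_iff)
    finally have *: "p * (min z (x + 1) - x) \<le> K" using K(1) by linarith
    then have "p * (min z (x + 1) - x) < p * 1" using K(2) by (simp add: p_def)
    then have "min z (x + 1) - x < 1" using p by (simp only: mult_less_cancel_left_pos)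
    then have "min z (x + 1) = z" by auto
    then show ?thesis using * True by simp
  next
    case False
    have "p * (x - max z (x - 1)) \<le> Phi x - Phi (max z (x - 1))"
      using A False by (intro growth) auto
    also have "\<dots> \<le> Phi x - Phi z" by (simp add: Phi_le_iff)
    finally have *: "p * (x - max z (x - 1)) \<le> K" using K(1) by linarith
    then have "p * (x - max z (x - 1)) < p * 1" using K(2) by (simp add: p_def)
    then have "x - max z (x - 1) < 1" using p by (simp only: mult_less_cancel_left_pos)
    then have "max z (x - 1) = z" by auto
    then show ?thesis using * False by simp
  qed
  then show ?thesis using p by (simp add: p_def[symmetric] pos_le_divide_eq mult.commute)
qed

lemma power4_le_exp: "x ^ 4 \<le> 256 * (exp x + exp (- x))" for x :: real
proof -
  have pos: "x ^ 4 \<le> 256 * (exp x + exp (- x))" if "0 \<le> x" for x :: real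
  proof -
    have "(x / 4) ^ 4 \<le> (1 + x / real 4) ^ 4" using that by (intro power_mono) auto
    also have "\<dots> \<le> exp x" using that by (intro exp_ge_one_plus_x_over_n_power_n) auto
    also have "\<dots> \<le> exp x + exp (- x)" by simp
    finally show ?thesis by (simp add: power_divide)
  qed
  show ?thesis using pos[of x] pos[of "- x"] by (cases "0 \<le> x") (auto simp: add.commute)
qed

lemma power4_add_le: "(x - y) ^ 4 \<le> 8 * (x ^ 4 + y ^ 4)" for x y :: real
proof -
  have 1: "(x - y)\<^sup>2 \<le> 2 * (x\<^sup>2 + y\<^sup>2)"
    using zero_le_power2[of "x + y"] by (simp add: power2_eq_square algebra_simps)
  have 2: "(x\<^sup>2 + y\<^sup>2)\<^sup>2 \<le> 2 * (x ^ 4 + y ^ 4)"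
    using zero_le_power2[of "x\<^sup>2 - y\<^sup>2"] by (simp add: power2_eq_square numeral_eq_Suc algebra_simps)
  have "(x - y) ^ 4 = ((x - y)\<^sup>2)\<^sup>2" by (simp add: power_mult[symmetric])
  also have "\<dots> \<le> (2 * (x\<^sup>2 + y\<^sup>2))\<^sup>2" using 1 by (intro power_mono) auto
  also have "\<dots> = 4 * (x\<^sup>2 + y\<^sup>2)\<^sup>2" unfolding power_mult_distrib by simp
  finally show ?thesis using 2 by simp
qed

text \<open>No coupling enters: both terms of \<open>D\<close> have fourth moments bounded uniformly
  in \<open>m\<close>. The normalised sign sum is controlled by its exponential moments at 1 and -1,
  each at most \<open>exp (1 / 2) \<le> 2\<close>, and the normal variable contributes 3. This gives
  8 (256 * 4 + 3) = 8216.\<close>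

lemma (in prob_space) quantile_signs_fourth_moment:
  assumes X: "std_normal X" and m: "0 < m"
  defines "D \<equiv> \<lambda>\<omega>. real_of_int (sum_list (quantile_signs m (X \<omega>))) / sqrt (real m) - X \<omega>"
  shows "integrable M (\<lambda>\<omega>. D \<omega> ^ 4)" and "expectation (\<lambda>\<omega>. D \<omega> ^ 4) \<le> 9000"
proof -
  have [measurable]: "random_variable borel X" using std_normal_random_variable[OF X] .
  define B where "B \<omega> = real_of_int (sum_list (quantile_signs m (X \<omega>)))" for \<omega>
  have [measurable]: "random_variable borel B" unfolding B_def by measurable
  have B_sum: "B \<omega> = (\<Sum>j<m. real_of_int (quantile_signs m (X \<omega>) ! j))" for \<omega>
  proof -
    have "length (quantile_signs m (X \<omega>)) = m" using quantile_signs_in[of m "X \<omega>"] by (simp add: sign_lists_def)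
    then show ?thesis by (simp add: B_def sum_list_sum_nth atLeast0LessThan)
  qed
  have ind: "indep_vars (\<lambda>_. borel) (\<lambda>j \<omega>. real_of_int (quantile_signs m (X \<omega>) ! j)) {..<m}"
    by (rule indep_vars_compose2[OF quantile_signs_components(1)[OF X]]) auto
  have mgf: "integrable M (\<lambda>\<omega>. exp (l * B \<omega>))" "expectation (\<lambda>\<omega>. exp (l * B \<omega>)) \<le> exp (real m * l\<^sup>2 / 2)" for l
    using subgaussian_sum[OF _ ind subgaussian_fair_sign[OF quantile_signs_components(2)[OF X]], of l]
    unfolding B_sum by simp_all
  let ?s = "1 / sqrt (real m)"
  have bnd: "D \<omega> ^ 4 \<le> 8 * (256 * (exp (?s * B \<omega>) + exp ((- ?s) * B \<omega>)) + X \<omega> ^ 4)" for \<omega>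
  proof -
    have "D \<omega> ^ 4 \<le> 8 * ((B \<omega> / sqrt (real m)) ^ 4 + X \<omega> ^ 4)"
      unfolding D_def B_def by (rule power4_add_le)
    also have "(B \<omega> / sqrt (real m)) ^ 4 \<le> 256 * (exp (B \<omega> / sqrt (real m)) + exp (- (B \<omega> / sqrt (real m))))"
      by (rule power4_le_exp)
    finally show ?thesis by simp
  qed
  have X4: "integrable M (\<lambda>\<omega>. X \<omega> ^ 4)" "expectation (\<lambda>\<omega>. X \<omega> ^ 4) = 3"
    using std_normal_even_moment[OF X, of 2] by (simp_all add: fact_numeral)
  have int: "integrable M (\<lambda>\<omega>. 8 * (256 * (exp (?s * B \<omega>) + exp ((- ?s) * B \<omega>)) + X \<omega> ^ 4))"
    using mgf(1)[of ?s] mgf(1)[of "- ?s"] X4 by (intro Bochner_Integration.integrable_add integrable_mult_right) auto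
  show intD: "integrable M (\<lambda>\<omega>. D \<omega> ^ 4)"
  proof (rule Bochner_Integration.integrable_bound[OF int])
    show "AE \<omega> in M. norm (D \<omega> ^ 4) \<le> norm (8 * (256 * (exp (?s * B \<omega>) + exp ((- ?s) * B \<omega>)) + X \<omega> ^ 4))"
    proof (intro AE_I2)
      fix \<omega>
      have "0 \<le> D \<omega> ^ 4" by simp
      then show "norm (D \<omega> ^ 4) \<le> norm (8 * (256 * (exp (?s * B \<omega>) + exp ((- ?s) * B \<omega>)) + X \<omega> ^ 4))"
        using bnd[of \<omega>] unfolding real_norm_def by linarith
    qed
    show "random_variable borel (\<lambda>\<omega>. D \<omega> ^ 4)" unfolding D_def by measurable
  qed
  have "expectation (\<lambda>\<omega>. D \<omega> ^ 4) \<le> expectation (\<lambda>\<omega>. 8 * (256 * (exp (?s * B \<omega>) + exp ((- ?s) * B \<omega>)) + X \<omega> ^ 4))"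
    by (rule integral_mono[OF intD int]) (rule bnd)
  also have "\<dots> = 8 * (256 * (expectation (\<lambda>\<omega>. exp (?s * B \<omega>)) + expectation (\<lambda>\<omega>. exp ((- ?s) * B \<omega>))) + 3)"
    using mgf(1)[of ?s] mgf(1)[of "- ?s"] X4
    by (subst integral_mult_right_zero, subst Bochner_Integration.integral_add) (simp_all del: mult_minus_left)
  also have "\<dots> \<le> 8 * (256 * (exp (1 / 2) + exp (1 / 2)) + 3)"
    using mgf(2)[of ?s] mgf(2)[of "- ?s"] m by (simp add: power_divide)
  also have "\<dots> \<le> 8 * (256 * (2 + 2) + 3)"
  proof -
    have "exp (1 / 2 :: real) \<le> 2"
      using exp_bound_half[of "1 / 2 :: real"] by simp
    then show ?thesis by simp
  qed
  finally show "expectation (\<lambda>\<omega>. D \<omega> ^ 4) \<le> 9000" by simp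
qed

text \<open>After division by \<open>sqrt m\<close> the error is split at
  \<open>\<bar>X\<bar> = A\<close>. In the bulk the Kolmogorov distance
  \<open>m powr (- 1 / 16)\<close> is divided by the density, at least of order
  \<open>m powr (- 1 / 32)\<close>, so the squared error has order \<open>m powr (- 1 / 16)\<close>.
  In the tails the fourth moment is played against the small probability. The tails dominate and
  lose only \<open>m powr (- 1 / 128)\<close> against the trivial bound \<open>m\<close>.\<close>

lemma (in prob_space) quantile_signs_L2:
  "\<exists>C. \<forall>m X. 0 < m \<longrightarrow> std_normal X \<longrightarrow>
     integrable M (\<lambda>\<omega>. (real_of_int (sum_list (quantile_signs m (X \<omega>))) - sqrt (real m) * X \<omega>)\<^sup>2) \<and>
     expectation (\<lambda>\<omega>. (real_of_int (sum_list (quantile_signs m (X \<omega>))) - sqrt (real m) * X \<omega>)\<^sup>2) \<le> C * real m powr (127 / 128)"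
proof -
  define c0 where "c0 = exp (- 1) / sqrt (2 * pi)"
  have c0: "0 < c0" by (simp add: c0_def)
  define c1 where "c1 = (13 / c0)\<^sup>2"
  define C where "C = c1 + 5000 + 5000 * (13 / c0)"
  have c1: "0 \<le> c1" by (simp add: c1_def)
  show ?thesis
  proof (intro exI[of _ C] allI impI)
    fix m :: nat and X assume m: "0 < m" and X: "std_normal X"
    have [measurable]: "random_variable borel X" using std_normal_random_variable[OF X] .
    define D where "D \<omega> = real_of_int (sum_list (quantile_signs m (X \<omega>))) / sqrt (real m) - X \<omega>" for \<omega>
    note D4 = quantile_signs_fourth_moment[OF X m, folded D_def]
    have [measurable]: "random_variable borel D" unfolding D_def by measurable
    have m1: "1 \<le> real m" using m by simp
    have sq: "D \<omega> ^ 4 = (D \<omega> * D \<omega>) * (D \<omega> * D \<omega>)" for \<omega> by (simp add: numeral_eq_Suc)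
    \<comment> \<open>AM-GM with a free weight: 1 gives the crude bound, a small weight serves on
      the tail event.\<close>
    have am: "(D \<omega>)\<^sup>2 \<le> (r * D \<omega> ^ 4 + 1 / r) / 2" if "0 < r" for r \<omega>
    proof -
      have "0 \<le> (r * (D \<omega>)\<^sup>2 - 1)\<^sup>2 / r" using that by simp
      also have "\<dots> = r * D \<omega> ^ 4 + 1 / r - 2 * (D \<omega>)\<^sup>2"
        using that by (simp add: field_simps power2_eq_square sq)
      finally show ?thesis by simp
    qed
    have intD2: "integrable M (\<lambda>\<omega>. (D \<omega>)\<^sup>2)"
    proof (rule Bochner_Integration.integrable_bound)
      show "integrable M (\<lambda>\<omega>. (1 * D \<omega> ^ 4 + 1 / 1) / 2)" using D4(1) by simp
      show "AE \<omega> in M. norm ((D \<omega>)\<^sup>2) \<le> norm ((1 * D \<omega> ^ 4 + 1 / 1) / 2)"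
        using am[of 1] by (intro AE_I2) (auto intro: order_trans[OF _ abs_ge_self])
    qed simp
    have trivial: "expectation (\<lambda>\<omega>. (D \<omega>)\<^sup>2) \<le> 5000"
    proof -
      have "expectation (\<lambda>\<omega>. (D \<omega>)\<^sup>2) \<le> expectation (\<lambda>\<omega>. (1 * D \<omega> ^ 4 + 1 / 1) / 2)"
        using D4(1) am[of 1] by (intro integral_mono intD2) auto
      also have "\<dots> = (expectation (\<lambda>\<omega>. D \<omega> ^ 4) + 1) / 2" using D4(1) by (simp add: prob_space)
      also have "\<dots> \<le> 5000" using D4(2) by simp
      finally show ?thesis .
    qed
    \<comment> \<open>\<open>A\<close> grows so slowly that the density at \<open>A + 1\<close> is
      at least of order \<open>m powr (- 1 / 32)\<close>, larger than the Kolmogorov distance, while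
      the tail beyond \<open>A\<close> is still polynomially small.\<close>
    define A where "A = sqrt (ln (real m) / 32)"
    have A: "0 \<le> A" "A\<^sup>2 = ln (real m) / 32" using m1 by (simp_all add: A_def)
    have eA: "exp (- A\<^sup>2) = real m powr (- 1 / 32)" "exp (- A\<^sup>2 / 2) = real m powr (- 1 / 64)"
      using m A(2) by (simp_all add: powr_def)
    have dens: "c0 * real m powr (- 1 / 32) \<le> std_normal_density (A + 1)"
    proof -
      have "(A + 1)\<^sup>2 / 2 \<le> A\<^sup>2 + 1" using zero_le_power2[of "A - 1"] by (simp add: power2_eq_square algebra_simps)
      then have "exp (- 1 + - A\<^sup>2) \<le> exp (- (A + 1)\<^sup>2 / 2)" by simp
      then have "exp (- 1) * exp (- A\<^sup>2) \<le> exp (- (A + 1)\<^sup>2 / 2)" by (simp only: exp_add)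
      then show ?thesis unfolding eA(1) c0_def std_normal_density_def by (simp add: divide_right_mono)
    qed
    have pw: "real m powr (- 1 / 16) = real m powr (- 1 / 32) * real m powr (- 1 / 32)"
      "real m powr (- 1 / 64) = real m powr (- 1 / 128) * real m powr (- 1 / 128)"
      by (simp_all add: powr_add[symmetric])
    have mono: "real m powr (- 1 / 16) \<le> real m powr (- 1 / 128)" "real m powr (- 1 / 32) \<le> real m powr (- 1 / 128)"
      using m1 by (auto intro!: powr_mono)
    have mp: "0 < real m powr a" for a using m by simp
    have main: "expectation (\<lambda>\<omega>. (D \<omega>)\<^sup>2) \<le> C * real m powr (- 1 / 128)"
    proof (cases "kolm m < std_normal_density (A + 1)")
      \<comment> \<open>This occurs for boundedly many \<open>m\<close> only. There the crude bound
        5000 suffices, and the last summand of \<open>C\<close> pays for it.\<close>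
      case False
      have "c0 * real m powr (- 1 / 32) \<le> 13 * (real m powr (- 1 / 32) * real m powr (- 1 / 32))"
        using False dens unfolding kolm_def pw(1) by linarith
      then have "c0 \<le> 13 * real m powr (- 1 / 32)"
        using mp[of "- 1 / 32"] by (simp add: mult.assoc[symmetric])
      also have "\<dots> \<le> 13 * real m powr (- 1 / 128)" using mono by simp
      finally have "1 \<le> 13 / c0 * real m powr (- 1 / 128)" using c0 by (simp add: field_simps)
      then have "5000 \<le> 5000 * (13 / c0) * real m powr (- 1 / 128)" by simp
      also have "\<dots> \<le> C * real m powr (- 1 / 128)"
        using c1 by (intro mult_right_mono) (auto simp: C_def)
      finally show ?thesis using trivial by simp
    next
      case True
      \<comment> \<open>The square root of the order of the tail probability, so that
        \<open>prob ?T / r\<close> and \<open>r\<close> times the fourth moment are both of order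
        \<open>r\<close>.\<close>
      define r where "r = real m powr (- 1 / 128)"
      have r: "0 < r" using m by (simp add: r_def)
      let ?T = "{\<omega>\<in>space M. A \<le> \<bar>X \<omega>\<bar>}"
      have bnd: "(D \<omega>)\<^sup>2 \<le> c1 * r + (r * D \<omega> ^ 4 + indicator ?T \<omega> / r) / 2" if "\<omega> \<in> space M" for \<omega>
      proof (cases "A \<le> \<bar>X \<omega>\<bar>")
        case True
        have "(D \<omega>)\<^sup>2 \<le> (r * D \<omega> ^ 4 + 1 / r) / 2" by (rule am[OF r])
        then show ?thesis using True that c1 r by (simp add: add_increasing)
      next
        case False
        have "\<bar>D \<omega>\<bar> \<le> kolm m / std_normal_density (A + 1)"
          unfolding D_def using False A True quantile_signs_close[OF m, of "X \<omega>"]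
          by (intro Phi_inverse_close) auto
        also have "\<dots> \<le> 13 * real m powr (- 1 / 16) / (c0 * real m powr (- 1 / 32))"
          unfolding kolm_def using dens c0 mp by (intro frac_le) auto
        also have "\<dots> = 13 / c0 * real m powr (- 1 / 32)"
          using c0 mp[of "- 1 / 32"] unfolding pw(1) by (simp add: field_simps)
        finally have "(D \<omega>)\<^sup>2 \<le> (13 / c0 * real m powr (- 1 / 32))\<^sup>2"
          by (metis abs_ge_zero power2_abs power_mono)
        also have "\<dots> = c1 * real m powr (- 1 / 16)" unfolding c1_def pw(1) by (simp add: power2_eq_square)
        also have "\<dots> \<le> c1 * r" unfolding r_def using mono c1 by (intro mult_left_mono) auto
        finally show ?thesis using r by (auto intro: order_trans)
      qed
      have tail: "prob ?T \<le> 2 * (r * r)"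
      proof -
        have sg: "subgaussian X" by (rule subgaussian_std_normal[OF X])
        have "prob ?T \<le> 2 * exp (- A\<^sup>2 / (2 * 1))"
          using sg A by (intro chernoff_two_sided) (auto simp: subgaussian_def)
        then show ?thesis using eA(2) pw(2) by (simp add: r_def)
      qed
      have intR: "integrable M (\<lambda>\<omega>. c1 * r + (r * D \<omega> ^ 4 + indicator ?T \<omega> / r) / 2)"
        using D4(1) by (auto simp: emeasure_eq_measure intro!: Bochner_Integration.integrable_add integrable_divide_zero)
      have "expectation (\<lambda>\<omega>. (D \<omega>)\<^sup>2) \<le> expectation (\<lambda>\<omega>. c1 * r + (r * D \<omega> ^ 4 + indicator ?T \<omega> / r) / 2)"
        by (rule integral_mono[OF intD2 intR bnd])
      also have "\<dots> = c1 * r + (r * expectation (\<lambda>\<omega>. D \<omega> ^ 4) + prob ?T / r) / 2"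
        using D4(1) by (simp add: emeasure_eq_measure prob_space)
      also have "\<dots> \<le> c1 * r + (r * 9000 + (2 * (r * r)) / r) / 2"
        using tail r D4(2) by (intro add_left_mono divide_right_mono add_mono mult_left_mono) auto
      also have "\<dots> = (c1 + 4501) * r" using r by (simp add: field_simps)
      also have "\<dots> \<le> C * r" using r c0 by (intro mult_right_mono) (auto simp: C_def)
      finally show ?thesis by (simp add: r_def)
    qed
    have eq: "(real_of_int (sum_list (quantile_signs m (X \<omega>))) - sqrt (real m) * X \<omega>)\<^sup>2 = real m * (D \<omega>)\<^sup>2" for \<omega>
    proof -
      have "real_of_int (sum_list (quantile_signs m (X \<omega>))) - sqrt (real m) * X \<omega> = sqrt (real m) * D \<omega>"
        using m by (simp add: D_def right_diff_distrib)
      then show ?thesis using m by (simp add: power_mult_distrib)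
    qed
    have "real m * expectation (\<lambda>\<omega>. (D \<omega>)\<^sup>2) \<le> real m * (C * real m powr (- 1 / 128))"
      using main by (intro mult_left_mono) auto
    also have "\<dots> = C * (real m powr 1 * real m powr (- 1 / 128))" using m by simp
    also have "\<dots> = C * real m powr (127 / 128)" by (subst powr_add[symmetric]) simp
    finally show "integrable M (\<lambda>\<omega>. (real_of_int (sum_list (quantile_signs m (X \<omega>))) - sqrt (real m) * X \<omega>)\<^sup>2) \<and>
       expectation (\<lambda>\<omega>. (real_of_int (sum_list (quantile_signs m (X \<omega>))) - sqrt (real m) * X \<omega>)\<^sup>2) \<le> C * real m powr (127 / 128)"
      unfolding eq using intD2 by simp
  qed
qed

section \<open>Levy's construction of the Wiener process\<close>

text \<open>The increment over the dyadic interval from \<open>k / 2 ^ n\<close> to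
  \<open>(k + 1) / 2 ^ n\<close>, normalised to variance 1. Each halving consumes one fresh
  coefficient per interval. Level 0 supplies one coefficient for every unit interval, so the
  construction covers the whole half-line.\<close>

fun levy_increment :: "(nat \<times> nat \<Rightarrow> real) \<Rightarrow> nat \<Rightarrow> nat \<Rightarrow> real" where
  "levy_increment a 0 k = a (0, k)"
| "levy_increment a (Suc n) k =
     (levy_increment a n (k div 2) + (if even k then 1 else - 1) * a (Suc n, k div 2)) / sqrt 2"

text \<open>Step functions take the place of the usual polygonal approximations; continuity of the
  limit is derived from its modulus instead.\<close>

definition levy_step :: "(nat \<times> nat \<Rightarrow> real) \<Rightarrow> nat \<Rightarrow> real \<Rightarrow> real" where
  "levy_step a n t = (\<Sum>k<nat \<lfloor>2 ^ n * t\<rfloor>. levy_increment a n k) / sqrt (2 ^ n)"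

definition levy_path :: "(nat \<times> nat \<Rightarrow> real) \<Rightarrow> real \<Rightarrow> real" where
  "levy_path a t = lim (\<lambda>n. levy_step a n t)"

definition (in prob_space) gaussian_family :: "('i \<Rightarrow> 'a \<Rightarrow> real) \<Rightarrow> 'i set \<Rightarrow> bool" where
  "gaussian_family x I \<longleftrightarrow> indep_vars (\<lambda>_. borel) x I \<and> (\<forall>i\<in>I. std_normal (x i))"

lemma (in prob_space) indep_vars_pairI:
  assumes ind: "indep_var borel (Y i) borel (Y j)" and ij: "i \<noteq> j"
  shows "indep_vars (\<lambda>_. borel) Y {i, j}"
proof -
  have rv: "random_variable borel (Y k)" if "k \<in> {i, j}" for k
    using indep_var_rv1[OF ind] indep_var_rv2[OF ind] that by auto
  show ?thesis unfolding indep_vars_def2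
  proof (intro conjI ballI rv)
    show "indep_sets (\<lambda>i. {Y i -` A \<inter> space M |A. A \<in> sets borel}) {i, j}"
    proof (subst indep_sets_finite)
      show "\<forall>A\<in>Pi {i, j} (\<lambda>i. {Y i -` A \<inter> space M |A. A \<in> sets borel}). prob (\<Inter>j\<in>{i, j}. A j) = (\<Prod>j\<in>{i, j}. prob (A j))"
      proof
        fix A assume "A \<in> Pi {i, j} (\<lambda>i. {Y i -` A \<inter> space M |A. A \<in> sets borel})"
        then obtain B C where BC: "A i = Y i -` B \<inter> space M" "A j = Y j -` C \<inter> space M" "B \<in> sets borel" "C \<in> sets borel"
          by auto
        have "(\<Inter>j\<in>{i, j}. A j) = (\<lambda>x. (Y i x, Y j x)) -` (B \<times> C) \<inter> space M" using BC by auto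
        then show "prob (\<Inter>j\<in>{i, j}. A j) = (\<Prod>j\<in>{i, j}. prob (A j))"
          using indep_varD[OF ind BC(3,4)] BC ij by simp
      qed
      show "{Y k -` A \<inter> space M |A. A \<in> sets borel} \<subseteq> events" if "k \<in> {i, j}" for k
        using rv[OF that] by (auto intro: measurable_sets)
      show "space M \<in> {Y k -` A \<inter> space M |A. A \<in> sets borel}" for k
        by (intro CollectI exI[of _ UNIV]) auto
    qed auto
  qed
qed

lemma (in prob_space) indep_vars_imp_indep_var:
  assumes ind: "indep_vars N Y I" and ij: "i \<in> I" "j \<in> I" "i \<noteq> j"
  shows "indep_var (N i) (Y i) (N j) (Y j)"
proof -
  have "indep_var (PiM {i} N) (\<lambda>\<omega>. restrict (\<lambda>k. Y k \<omega>) {i}) (PiM {j} N) (\<lambda>\<omega>. restrict (\<lambda>k. Y k \<omega>) {j})"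
    by (rule indep_var_restrict[OF ind]) (use ij in auto)
  from indep_var_compose[OF this measurable_component_singleton[of i "{i}" N] measurable_component_singleton[of j "{j}" N]]
  show ?thesis by (simp add: comp_def)
qed

text \<open>The induction needs more than one level: the increments of level \<open>n\<close>
  together with all coefficients of later levels form an independent family. Passing to the next
  level rotates disjoint pairs, each made of an increment and its coefficient, and leaves all other
  members alone.\<close>

lemma (in prob_space) levy_increment_gaussian:
  assumes x: "gaussian_family x UNIV"
  shows "gaussian_family (\<lambda>k \<omega>. levy_increment (\<lambda>i. x i \<omega>) n k) UNIV"
proof -
  define Y where "Y n i \<omega> = (if fst i = n then levy_increment (\<lambda>i. x i \<omega>) n (snd i) else x i \<omega>)"
    for n and i :: "nat \<times> nat" and \<omega>
  have step: "gaussian_family (Y n) {i. n \<le> fst i}" for n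
  proof (induction n)
    case 0
    have "Y 0 i = x i" for i by (cases i) (auto simp: Y_def)
    then show ?case using x by (simp add: gaussian_family_def)
  next
    case (Suc n)
    then have indY: "indep_vars (\<lambda>_. borel) (Y n) {i. n \<le> fst i}" and nY: "\<And>i. n \<le> fst i \<Longrightarrow> std_normal (Y n i)"
      by (auto simp: gaussian_family_def)
    \<comment> \<open>A block with first component \<open>n\<close> stands for one dyadic interval:
      \<open>K\<close> lists its increment and its coefficient, \<open>F\<close> the increments over
      its halves. The remaining blocks are single untouched coefficients. Level \<open>Suc n\<close>
      is left out of \<open>C\<close>, as its coefficients are consumed.\<close>
    define C where "C = {c::nat \<times> nat. fst c = n \<or> Suc n < fst c}"
    define F where "F c = (if fst c = n then {(Suc n, 2 * snd c), (Suc n, 2 * snd c + 1)} else {c})" for c :: "nat \<times> nat"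
    define K where "K c = (if fst c = n then {(n, snd c), (Suc n, snd c)} else {c})" for c :: "nat \<times> nat"
    have Yold: "Y (Suc n) i = Y n i" if "Suc n < fst i" for i
      using that by (auto simp: Y_def fun_eq_iff)
    have Yeven: "Y (Suc n) (Suc n, 2 * j) = (\<lambda>\<omega>. (Y n (n, j) \<omega> + Y n (Suc n, j) \<omega>) / sqrt 2)"
      and Yodd: "Y (Suc n) (Suc n, 2 * j + 1) = (\<lambda>\<omega>. (Y n (n, j) \<omega> - Y n (Suc n, j) \<omega>) / sqrt 2)" for j
      by (auto simp: Y_def fun_eq_iff)
    have ind2: "indep_var borel (Y n (n, j)) borel (Y n (Suc n, j))" for j
      by (rule indep_vars_imp_indep_var[OF indY]) auto
    note rot = std_normal_rotation[OF nY nY ind2]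
    have norm: "std_normal (Y (Suc n) i)" if "Suc n \<le> fst i" for i
    proof (cases "fst i = Suc n")
      case True
      then obtain j where "i = (Suc n, 2 * j) \<or> i = (Suc n, 2 * j + 1)"
        by (metis evenE oddE prod.collapse)
      then show ?thesis using rot(1,2)[of j] Yeven[of j] Yodd[of j] by auto
    next
      case False then show ?thesis using that nY[of i] Yold[of i] by auto
    qed
    have un: "(\<Union>c\<in>C. F c) = {i. Suc n \<le> fst i}"
    proof (intro set_eqI iffI)
      fix i :: "nat \<times> nat" assume "i \<in> {i. Suc n \<le> fst i}"
      then show "i \<in> (\<Union>c\<in>C. F c)"
      proof (cases "fst i = Suc n")
        case True
        then obtain j where "i = (Suc n, 2 * j) \<or> i = (Suc n, 2 * j + 1)"
          by (metis evenE oddE prod.collapse)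
        then show ?thesis by (intro UN_I[of "(n, j)"]) (auto simp: C_def F_def)
      qed (auto simp: C_def F_def)
    qed (auto simp: C_def F_def split: if_splits)
    define g where "g c f = (\<lambda>i\<in>F c. if fst c = n then
        (f (n, snd c) + (if even (snd i) then 1 else - 1) * f (Suc n, snd c)) / sqrt 2 else f i)"
      for c :: "nat \<times> nat" and f :: "nat \<times> nat \<Rightarrow> real"
    have gm: "g c \<in> PiM (K c) (\<lambda>_. borel) \<rightarrow>\<^sub>M PiM (F c) (\<lambda>_. borel)" for c
    proof -
      have comp: "(\<lambda>f. f i) \<in> borel_measurable (PiM (K c) (\<lambda>_. borel :: real measure))" if "i \<in> K c" for i
        by (rule measurable_component_singleton[OF that])
      show ?thesis unfolding g_def[abs_def]
      proof (rule measurable_restrict)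
        fix i assume i: "i \<in> F c"
        show "(\<lambda>f. if fst c = n then (f (n, snd c) + (if even (snd i) then 1 else - 1) * f (Suc n, snd c)) / sqrt 2 else f i)
          \<in> borel_measurable (PiM (K c) (\<lambda>_. borel))"
        proof (cases "fst c = n")
          case True
          have "(\<lambda>f. (f (n, snd c) + (if even (snd i) then 1 else - 1) * f (Suc n, snd c)) / sqrt 2)
            \<in> borel_measurable (PiM (K c) (\<lambda>_. borel :: real measure))"
            by (intro borel_measurable_divide borel_measurable_add borel_measurable_times comp) (auto simp: K_def True)
          then show ?thesis using True by simp
        next
          case False
          then show ?thesis using comp[of i] i by (simp add: K_def F_def)
        qed
      qed
    qed
    have "indep_vars (\<lambda>_. borel) (Y (Suc n)) (\<Union>c\<in>C. F c)"
    proof (rule indep_vars_blocks)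
      have "indep_vars (\<lambda>c. PiM (K c) (\<lambda>_. borel)) (\<lambda>c \<omega>. restrict (\<lambda>i. Y n i \<omega>) (K c)) C"
      proof (rule indep_vars_restrict[OF indY])
        show "K c \<subseteq> {i. n \<le> fst i}" if "c \<in> C" for c using that by (auto simp: C_def K_def)
        show "disjoint_family_on K C" by (auto simp: disjoint_family_on_def C_def K_def)
      qed
      then have "indep_vars (\<lambda>c. PiM (F c) (\<lambda>_. borel)) (\<lambda>c \<omega>. g c (restrict (\<lambda>i. Y n i \<omega>) (K c))) C"
        by (rule indep_vars_compose2) (rule gm)
      moreover have "g c (restrict (\<lambda>i. Y n i \<omega>) (K c)) = (\<lambda>k\<in>F c. Y (Suc n) k \<omega>)" if "c \<in> C" for c \<omega>
      proof (rule ext)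
        fix i
        show "g c (restrict (\<lambda>i. Y n i \<omega>) (K c)) i = (\<lambda>k\<in>F c. Y (Suc n) k \<omega>) i"
        proof (cases "i \<in> F c")
          case i: True
          show ?thesis
          proof (cases "fst c = n")
            case True
            with i have "i = (Suc n, 2 * snd c) \<or> i = (Suc n, 2 * snd c + 1)" by (auto simp: F_def)
            then show ?thesis using i True Yeven[of "snd c"] Yodd[of "snd c"] by (auto simp: g_def K_def)
          next
            case False
            then have "i = c" "Suc n < fst c" using i that by (auto simp: F_def C_def)
            then show ?thesis using False i Yold[of c] by (simp add: g_def K_def)
          qed
        qed (simp add: g_def)
      qed
      ultimately show "indep_vars (\<lambda>c. PiM (F c) (\<lambda>_. borel)) (\<lambda>c \<omega>. \<lambda>k\<in>F c. Y (Suc n) k \<omega>) C"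
        by (subst indep_vars_cong[OF refl _ refl]) auto
      show "indep_vars (\<lambda>_. borel) (Y (Suc n)) (F c)" if c: "c \<in> C" for c
      proof (cases "fst c = n")
        case True
        have "indep_vars (\<lambda>_. borel) (Y (Suc n)) {(Suc n, 2 * snd c), (Suc n, 2 * snd c + 1)}"
          by (rule indep_vars_pairI) (use rot(3)[of "snd c"] Yeven[of "snd c"] Yodd[of "snd c"] in auto)
        then show ?thesis using True by (simp add: F_def)
      next
        case False
        then have "n \<le> fst c" "Suc n < fst c" using c by (auto simp: C_def)
        have "indep_vars (\<lambda>_. borel) (Y n) (F c)"
          by (rule indep_vars_subset[OF indY]) (use False \<open>n \<le> fst c\<close> in \<open>auto simp: F_def\<close>)
        then show ?thesis
          by (subst indep_vars_cong[of _ "F c" _ "Y n"]) (use Yold[of c] \<open>Suc n < fst c\<close> False in \<open>auto simp: F_def\<close>)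
      qed
      show "disjoint_family_on F C"
        by (auto simp: disjoint_family_on_def C_def F_def)
    qed
    then show ?case using norm unfolding un by (auto simp: gaussian_family_def)
  qed
  have ind: "indep_vars (\<lambda>_. borel) (Y n) {i. n \<le> fst i}" using step[of n] by (simp add: gaussian_family_def)
  have "indep_vars (\<lambda>_. borel) (\<lambda>k. Y n (n, k)) UNIV"
  proof -
    have r: "indep_vars (\<lambda>k. PiM {(n, k)} (\<lambda>_. borel)) (\<lambda>k \<omega>. restrict (\<lambda>i. Y n i \<omega>) {(n, k)}) UNIV"
      by (rule indep_vars_restrict[OF ind]) (auto simp: disjoint_family_on_def)
    have "indep_vars (\<lambda>_. borel) (\<lambda>k \<omega>. (restrict (\<lambda>i. Y n i \<omega>) {(n, k)}) (n, k)) UNIV"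
      by (rule indep_vars_compose2[OF r]) (auto intro: measurable_component_singleton)
    then show ?thesis by (simp add: eta_contract_eq)
  qed
  moreover have "std_normal (Y n (n, k))" for k using step[of n] by (simp add: gaussian_family_def)
  moreover have "Y n (n, k) = (\<lambda>\<omega>. levy_increment (\<lambda>i. x i \<omega>) n k)" for k by (auto simp: Y_def)
  ultimately show ?thesis by (simp add: gaussian_family_def)
qed

lemma levy_increment_measurable [measurable]:
  "(\<lambda>a. levy_increment a n k) \<in> borel_measurable (PiM UNIV (\<lambda>_. borel))"
proof (induction n arbitrary: k)
  case (Suc n)
  note Suc.IH[measurable]
  show ?case by simp
qed simp

lemma levy_path_measurable [measurable]:
  "(\<lambda>a. levy_path a t) \<in> borel_measurable (PiM UNIV (\<lambda>_. borel))"
  unfolding levy_path_def levy_step_def by measurable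

text \<open>An exponent below 1/2 makes the increments divided by \<open>sqrt (2 ^ n)\<close> decay
  geometrically in the level. Adding \<open>k\<close> to \<open>2 ^ n\<close> lets one constant
  serve all positions, at the price of a factor \<open>(1 + t) powr (1 / 4)\<close>.\<close>

definition levy_bounded :: "(nat \<times> nat \<Rightarrow> real) \<Rightarrow> real \<Rightarrow> bool" where
  "levy_bounded a C \<longleftrightarrow> 0 \<le> C \<and> (\<forall>n k. \<bar>levy_increment a n k\<bar> \<le> C * (2 ^ n + real k) powr (1 / 4))"

text \<open>The twelfth powers divided by \<open>(2 ^ n + k) ^ 3\<close> have a finite expected sum
  over all \<open>n\<close> and \<open>k\<close>, because the cube is at least
  \<open>2 ^ n * (k + 1)\<^sup>2\<close>. Hence they are almost surely bounded, and the twelfth root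
  turns the cube into the exponent 1/4.\<close>

lemma (in prob_space) AE_levy_bounded:
  assumes x: "gaussian_family x UNIV"
  shows "AE \<omega> in M. \<exists>C. levy_bounded (\<lambda>i. x i \<omega>) C"
proof -
  define d where "d n k \<omega> = levy_increment (\<lambda>i. x i \<omega>) n k" for n k \<omega>
  have d: "std_normal (d n k)" for n k
    using levy_increment_gaussian[OF x, of n] by (simp add: gaussian_family_def d_def[abs_def])
  have [measurable]: "random_variable borel (d n k)" for n k using std_normal_random_variable[OF d] .
  define c :: real where "c = fact (2 * 6) / (2 ^ 6 * fact 6)"
  have c: "0 \<le> c" by (simp add: c_def)
  have d12: "integrable M (\<lambda>\<omega>. d n k \<omega> ^ 12)" "expectation (\<lambda>\<omega>. d n k \<omega> ^ 12) = c" for n k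
    using std_normal_even_moment[OF d, of n k 6] by (simp_all add: c_def)
  define Y where "Y n k \<omega> = d n k \<omega> ^ 12 / (2 ^ n + real k) ^ 3" for n k \<omega>
  have [measurable]: "random_variable borel (Y n k)" for n k unfolding Y_def by measurable
  have Yeq: "Y n k = (\<lambda>\<omega>. d n k \<omega> ^ 12 / (2 ^ n + real k) ^ 3)" for n k by (auto simp: Y_def)
  have Y0: "0 \<le> Y n k \<omega>" for n k \<omega> unfolding Y_def by (intro divide_nonneg_nonneg zero_le_power zero_le_even_power) auto
  have EY: "(\<integral>\<^sup>+\<omega>. ennreal (Y n k \<omega>) \<partial>M) \<le> ennreal (c * (1 / 2) ^ n) * ennreal (1 / (real k + 1) ^ 2)" for n k
  proof -
    have "(\<integral>\<^sup>+\<omega>. ennreal (Y n k \<omega>) \<partial>M) = ennreal (c / (2 ^ n + real k) ^ 3)"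
      using d12[of n k] Y0 by (subst nn_integral_eq_integral) (auto simp: Yeq)
    also have "\<dots> \<le> ennreal (c * (1 / 2) ^ n * (1 / (real k + 1) ^ 2))"
    proof (rule ennreal_leI)
      have p1: "(1::real) \<le> 2 ^ n" by simp
      have "2 ^ n * (real k + 1) ^ 2 \<le> (2 ^ n + real k) * (2 ^ n + real k) ^ 2"
        using p1 by (intro mult_mono power_mono) auto
      then have "c / (2 ^ n + real k) ^ 3 \<le> c / (2 ^ n * (real k + 1) ^ 2)"
        using c p1 by (intro divide_left_mono) (auto simp: power3_eq_cube power2_eq_square add_pos_nonneg mult.assoc)
      also have "\<dots> = c * (1 / 2) ^ n * (1 / (real k + 1) ^ 2)" by (simp add: power_divide)
      finally show "c / (2 ^ n + real k) ^ 3 \<le> c * (1 / 2) ^ n * (1 / (real k + 1) ^ 2)" .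
    qed
    also have "\<dots> = ennreal (c * (1 / 2) ^ n) * ennreal (1 / (real k + 1) ^ 2)"
      using c by (intro ennreal_mult) auto
    finally show ?thesis .
  qed
  have S1: "summable (\<lambda>n. c * (1 / 2) ^ n)" by (intro summable_mult summable_geometric) simp
  have S2: "summable (\<lambda>k. 1 / (real k + 1) ^ 2)"
  proof -
    have "summable (\<lambda>k. inverse ((real (Suc k))\<^sup>2))"
      using inverse_power_summable[of 2, where 'a=real] by (subst summable_Suc_iff) simp
    then show ?thesis by (simp add: inverse_eq_divide add.commute)
  qed
  have "(\<integral>\<^sup>+\<omega>. (\<Sum>n. \<Sum>k. ennreal (Y n k \<omega>)) \<partial>M) = (\<Sum>n. \<Sum>k. \<integral>\<^sup>+\<omega>. ennreal (Y n k \<omega>) \<partial>M)"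
    by (subst nn_integral_suminf, simp, subst nn_integral_suminf) simp_all
  also have "\<dots> \<le> (\<Sum>n. \<Sum>k. ennreal (c * (1 / 2) ^ n) * ennreal (1 / (real k + 1) ^ 2))"
    by (intro suminf_le EY) auto
  also have "\<dots> = (\<Sum>n. ennreal (c * (1 / 2) ^ n)) * (\<Sum>k. ennreal (1 / (real k + 1) ^ 2))"
    by simp
  also have "\<dots> = ennreal (\<Sum>n. c * (1 / 2) ^ n) * ennreal (\<Sum>k. 1 / (real k + 1) ^ 2)"
    using c S1 S2 by (subst (1 2) suminf_ennreal2) auto
  also have "\<dots> < \<infinity>" by (simp add: ennreal_mult_less_top)
  finally have "AE \<omega> in M. (\<Sum>n. \<Sum>k. ennreal (Y n k \<omega>)) \<noteq> \<infinity>"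
    by (intro nn_integral_noteq_infinite) auto
  then show ?thesis
  proof eventually_elim
    case (elim \<omega>)
    then obtain B where B: "0 \<le> B" "(\<Sum>n. \<Sum>k. ennreal (Y n k \<omega>)) = ennreal B"
      by (cases "\<Sum>n. \<Sum>k. ennreal (Y n k \<omega>)") auto
    have YB: "Y n k \<omega> \<le> B" for n k
    proof -
      have "ennreal (Y n k \<omega>) \<le> (\<Sum>k. ennreal (Y n k \<omega>))"
        using sum_le_suminf[of "\<lambda>k. ennreal (Y n k \<omega>)" "{k}"] by simp
      also have "\<dots> \<le> (\<Sum>n. \<Sum>k. ennreal (Y n k \<omega>))"
        using sum_le_suminf[of "\<lambda>n. \<Sum>k. ennreal (Y n k \<omega>)" "{n}"] by simp
      finally show ?thesis using B by (simp add: ennreal_le_iff)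
    qed
    have "\<bar>d n k \<omega>\<bar> \<le> B powr (1 / 12) * (2 ^ n + real k) powr (1 / 4)" for n k
    proof -
      have pos: "0 < 2 ^ n + real k" by (simp add: add_pos_nonneg)
      have "\<bar>d n k \<omega>\<bar> ^ 12 \<le> B * (2 ^ n + real k) ^ 3"
        using YB[of n k] pos by (simp add: Y_def pos_divide_le_eq)
      then have "(\<bar>d n k \<omega>\<bar> ^ 12) powr (1 / 12) \<le> (B * (2 ^ n + real k) ^ 3) powr (1 / 12)"
        by (intro powr_mono2) auto
      also have "(\<bar>d n k \<omega>\<bar> ^ 12) powr (1 / 12) = \<bar>d n k \<omega>\<bar>"
        by (cases "d n k \<omega> = 0") (simp_all add: powr_realpow[symmetric] powr_powr del: powr_numeral)
      also have "(B * (2 ^ n + real k) ^ 3) powr (1 / 12) = B powr (1 / 12) * (2 ^ n + real k) powr (1 / 4)"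
        using B pos by (simp add: powr_mult powr_realpow[symmetric] powr_powr del: powr_numeral)
      finally show ?thesis .
    qed
    then show ?case by (intro exI[of _ "B powr (1 / 12)"]) (simp add: levy_bounded_def d_def)
  qed
qed

context
  fixes a :: "nat \<times> nat \<Rightarrow> real" and C :: real
  assumes bounded: "levy_bounded a C"
begin

definition levy_rate :: real where "levy_rate = 2 powr (- 1 / 4)"

lemma levy_rate: "0 < levy_rate" "levy_rate < 1" "levy_rate ^ n = 2 powr (- real n / 4)"
proof -
  show "0 < levy_rate" by (simp add: levy_rate_def)
  have "2 powr (- 1 / 4) < (2::real) powr 0" by (intro powr_less_mono) auto
  then show "levy_rate < 1" by (simp add: levy_rate_def)
  show "levy_rate ^ n = 2 powr (- real n / 4)" by (simp add: levy_rate_def powr_power)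
qed

lemma levy_increment_le:
  assumes "0 \<le> t" "real k \<le> 2 ^ n * t"
  shows "\<bar>levy_increment a n k\<bar> / sqrt (2 ^ n) \<le> C * (1 + t) powr (1 / 4) * levy_rate ^ n"
proof -
  have C: "0 \<le> C" using bounded by (simp add: levy_bounded_def)
  have "\<bar>levy_increment a n k\<bar> \<le> C * (2 ^ n + real k) powr (1 / 4)"
    using bounded by (simp add: levy_bounded_def)
  also have "\<dots> \<le> C * (2 ^ n * (1 + t)) powr (1 / 4)"
    using assms C by (intro mult_left_mono powr_mono2) (auto simp: distrib_left)
  also have "\<dots> = C * (1 + t) powr (1 / 4) * 2 powr (real n / 4)"
    using assms by (simp add: powr_mult powr_realpow[symmetric] powr_powr)
  finally have "\<bar>levy_increment a n k\<bar> / sqrt (2 ^ n) \<le> C * (1 + t) powr (1 / 4) * 2 powr (real n / 4) / sqrt (2 ^ n)"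
    by (intro divide_right_mono) auto
  also have "\<dots> = C * (1 + t) powr (1 / 4) * (2 powr (real n / 4) / sqrt (2 ^ n))" by simp
  also have "2 powr (real n / 4) / sqrt (2 ^ n) = levy_rate ^ n"
  proof -
    have "sqrt (2 ^ n) = 2 powr (real n / 2)"
      by (simp add: powr_half_sqrt[symmetric] powr_realpow[symmetric] powr_powr)
    then have "2 powr (real n / 4) / sqrt (2 ^ n) = 2 powr (real n / 4 - real n / 2)"
      by (simp only: powr_diff)
    also have "real n / 4 - real n / 2 = - real n / 4" by simp
    finally show ?thesis by (simp only: levy_rate(3))
  qed
  finally show ?thesis .
qed

text \<open>The two halves of an interval add up to the interval, so the levels agree at common
  dyadic points. The finer grid adds at most the one increment with index
  \<open>2 * i\<close>.\<close>

lemma levy_step_Suc: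
  assumes t: "0 \<le> t"
  shows "\<bar>levy_step a (Suc n) t - levy_step a n t\<bar> \<le> C * (1 + t) powr (1 / 4) * levy_rate ^ Suc n"
proof -
  define i where "i = nat \<lfloor>2 ^ n * t\<rfloor>"
  define j where "j = nat \<lfloor>2 ^ Suc n * t\<rfloor>"
  have i: "real i \<le> 2 ^ n * t" "2 ^ n * t < real i + 1" using t by (auto simp: i_def)
  have jb: "real j \<le> 2 ^ Suc n * t" "2 ^ Suc n * t < real j + 1" using t by (auto simp: j_def)
  have "real (2 * i) < real j + 1" "real j < real (2 * i + 2)" using i jb by auto
  then have "2 * i < j + 1" "j < 2 * i + 2" by linarith+
  then have j: "j = 2 * i \<or> j = 2 * i + 1" by linarith
  have pairs: "(\<Sum>k<2 * i. levy_increment a (Suc n) k) = sqrt 2 * (\<Sum>k<i. levy_increment a n k)" for i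
  proof (induction i)
    case (Suc i)
    have s: "2 / sqrt 2 = sqrt (2::real)" by (rule real_div_sqrt) simp
    have "levy_increment a (Suc n) (2 * i) + levy_increment a (Suc n) (2 * i + 1) = 2 / sqrt 2 * levy_increment a n i"
      by (simp add: add_divide_distrib diff_divide_distrib)
    then show ?case using Suc unfolding s by (simp add: distrib_left)
  qed simp
  have "(\<Sum>k<2 * i. levy_increment a (Suc n) k) / sqrt (2 ^ Suc n) = levy_step a n t"
    unfolding pairs by (simp add: levy_step_def i_def real_sqrt_mult)
  then have "levy_step a (Suc n) t - levy_step a n t = (if j = 2 * i then 0 else levy_increment a (Suc n) (2 * i)) / sqrt (2 ^ Suc n)"
  proof -
    have "levy_step a (Suc n) t = (\<Sum>k<j. levy_increment a (Suc n) k) / sqrt (2 ^ Suc n)"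
      unfolding levy_step_def j_def ..
    moreover have "(\<Sum>k<j. levy_increment a (Suc n) k) / sqrt (2 ^ Suc n) = (\<Sum>k<2 * i. levy_increment a (Suc n) k) / sqrt (2 ^ Suc n)
        + (if j = 2 * i then 0 else levy_increment a (Suc n) (2 * i)) / sqrt (2 ^ Suc n)"
      using j by (auto simp: add_divide_distrib simp del: levy_increment.simps)
    ultimately show ?thesis using \<open>_ = levy_step a n t\<close> by (simp only:)
  qed
  then have "\<bar>levy_step a (Suc n) t - levy_step a n t\<bar> \<le> \<bar>levy_increment a (Suc n) (2 * i)\<bar> / sqrt (2 ^ Suc n)"
    by (simp add: abs_divide)
  also have "\<dots> \<le> C * (1 + t) powr (1 / 4) * levy_rate ^ Suc n"
    using t i by (intro levy_increment_le) auto
  finally show ?thesis .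
qed

lemma levy_step_converges:
  assumes t: "0 \<le> t"
  shows "(\<lambda>n. levy_step a n t) \<longlonglongrightarrow> levy_path a t"
    and "\<bar>levy_path a t - levy_step a n t\<bar> \<le> C / (1 - levy_rate) * (1 + t) powr (1 / 4) * levy_rate ^ n"
proof -
  define q where "q = levy_rate"
  have q: "0 < q" "q < 1" using levy_rate by (auto simp: q_def)
  define B where "B = C * (1 + t) powr (1 / 4)"
  have B: "0 \<le> B" using bounded by (simp add: B_def levy_bounded_def)
  have d: "norm (levy_step a (Suc m) t - levy_step a m t) \<le> B * q ^ m" for m
  proof -
    have "norm (levy_step a (Suc m) t - levy_step a m t) \<le> B * q ^ Suc m"
      using levy_step_Suc[OF t, of m] by (simp add: B_def q_def)
    also have "\<dots> \<le> B * q ^ m" using B q by (intro mult_left_mono power_decreasing) auto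
    finally show ?thesis .
  qed
  have sg: "summable (\<lambda>m. B * q ^ m)" using q by (intro summable_mult summable_geometric) auto
  have sm: "summable (\<lambda>m. norm (levy_step a (Suc m) t - levy_step a m t))"
    by (rule summable_comparison_test'[OF sg]) (use d in simp)
  have tel: "(\<Sum>m<n. levy_step a (Suc m) t - levy_step a m t) = levy_step a n t - levy_step a 0 t" for n
    by (rule sum_lessThan_telescope)
  have "(\<lambda>n. (levy_step a n t - levy_step a 0 t) + levy_step a 0 t) \<longlonglongrightarrow>
      (\<Sum>m. levy_step a (Suc m) t - levy_step a m t) + levy_step a 0 t"
    using summable_LIMSEQ[OF summable_norm_cancel[OF sm]] unfolding tel by (intro tendsto_intros)
  then have conv: "convergent (\<lambda>n. levy_step a n t)" by (auto simp: convergent_def)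
  then show lim: "(\<lambda>n. levy_step a n t) \<longlonglongrightarrow> levy_path a t"
    unfolding levy_path_def by (simp add: convergent_LIMSEQ_iff)
  have bnd: "\<bar>levy_step a (n + k) t - levy_step a n t\<bar> \<le> B / (1 - q) * q ^ n" for k
  proof -
    have "levy_step a (n + k) t - levy_step a n t = (\<Sum>m<k. levy_step a (Suc (n + m)) t - levy_step a (n + m) t)"
      using sum_lessThan_telescope[of "\<lambda>m. levy_step a (n + m) t" k] by simp
    also have "\<bar>\<dots>\<bar> \<le> (\<Sum>m<k. B * q ^ (n + m))"
      using d by (intro order_trans[OF sum_abs] sum_mono) auto
    also have "\<dots> = B * q ^ n * (\<Sum>m<k. q ^ m)" by (simp add: power_add sum_distrib_left mult.assoc)
    also have "\<dots> \<le> B * q ^ n * (1 / (1 - q))"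
    proof (rule mult_left_mono)
      have "(\<Sum>m<k. q ^ m) = (1 - q ^ k) / (1 - q)" using q by (simp add: sum_gp_strict)
      also have "\<dots> \<le> 1 / (1 - q)" using q by (intro divide_right_mono) auto
      finally show "(\<Sum>m<k. q ^ m) \<le> 1 / (1 - q)" .
    qed (use B q in auto)
    finally show ?thesis by simp
  qed
  have "(\<lambda>k. \<bar>levy_step a (n + k) t - levy_step a n t\<bar>) \<longlonglongrightarrow> \<bar>levy_path a t - levy_step a n t\<bar>"
    using LIMSEQ_ignore_initial_segment[OF lim, of n] by (intro tendsto_intros) (simp add: add.commute)
  then have "\<bar>levy_path a t - levy_step a n t\<bar> \<le> B / (1 - q) * q ^ n"
    by (rule LIMSEQ_le_const2) (use bnd in auto)
  then show "\<bar>levy_path a t - levy_step a n t\<bar> \<le> C / (1 - levy_rate) * (1 + t) powr (1 / 4) * levy_rate ^ n"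
    by (simp add: B_def q_def)
qed

text \<open>\<open>s\<close> and \<open>t\<close> lie in the same or in adjacent dyadic intervals of
  level \<open>n\<close>, so the approximations at \<open>s\<close> and \<open>t\<close> differ by
  at most one increment. The two distances to the limit give the other part of the constant.\<close>

lemma levy_path_modulus:
  assumes st: "0 \<le> s" "s \<le> t" "t \<le> T" "t - s < 1 / 2 ^ n"
  shows "\<bar>levy_path a t - levy_path a s\<bar> \<le> (2 * C / (1 - levy_rate) + C) * (1 + T) powr (1 / 4) * levy_rate ^ n"
proof -
  have C: "0 \<le> C" using bounded by (simp add: levy_bounded_def)
  define i where "i = nat \<lfloor>2 ^ n * s\<rfloor>"
  define j where "j = nat \<lfloor>2 ^ n * t\<rfloor>"
  have i: "real i \<le> 2 ^ n * s" "2 ^ n * s < real i + 1" using st by (auto simp: i_def)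
  have j: "real j \<le> 2 ^ n * t" "2 ^ n * t < real j + 1" using st by (auto simp: j_def)
  have "2 ^ n * t < 2 ^ n * s + 1" using st(4) by (simp add: field_simps)
  moreover have "2 ^ n * s \<le> 2 ^ n * t" using st by simp
  ultimately have "real i < real j + 1" "real j < real i + 2" using i j by linarith+
  then have ij: "j = i \<or> j = Suc i" by linarith
  have mono: "(1 + u) powr (1 / 4) \<le> (1 + T) powr (1 / 4)" if "0 \<le> u" "u \<le> T" for u
    using that by (intro powr_mono2) auto
  have q: "0 < levy_rate" "levy_rate < 1" by (rule levy_rate)+
  define R where "R = (1 + T) powr (1 / 4) * levy_rate ^ n"
  have R: "0 \<le> R" using q by (simp add: R_def)
  have close: "\<bar>levy_path a u - levy_step a n u\<bar> \<le> C / (1 - levy_rate) * R" if u: "0 \<le> u" "u \<le> T" for u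
  proof -
    have "C / (1 - levy_rate) * (1 + u) powr (1 / 4) * levy_rate ^ n \<le> C / (1 - levy_rate) * (1 + T) powr (1 / 4) * levy_rate ^ n"
      using mono[OF u] C q by (intro mult_right_mono mult_left_mono) auto
    then show ?thesis using levy_step_converges(2)[OF u(1), of n] by (simp add: R_def mult.assoc)
  qed
  have "\<bar>levy_step a n t - levy_step a n s\<bar> \<le> \<bar>levy_increment a n i\<bar> / sqrt (2 ^ n)"
    using ij by (auto simp: levy_step_def i_def[symmetric] j_def[symmetric] diff_divide_distrib[symmetric] abs_divide)
  also have "\<dots> \<le> C * (1 + s) powr (1 / 4) * levy_rate ^ n"
    using st i by (intro levy_increment_le) auto
  also have "\<dots> \<le> C * (1 + T) powr (1 / 4) * levy_rate ^ n"
    using mono[of s] st C q by (intro mult_right_mono mult_left_mono) auto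
  finally have "\<bar>levy_step a n t - levy_step a n s\<bar> \<le> C * R" by (simp add: R_def mult.assoc)
  moreover have "\<bar>levy_path a t - levy_step a n t\<bar> \<le> C / (1 - levy_rate) * R"
    "\<bar>levy_path a s - levy_step a n s\<bar> \<le> C / (1 - levy_rate) * R"
    by (rule close; use st in linarith)+
  ultimately have "\<bar>levy_path a t - levy_path a s\<bar> \<le> C / (1 - levy_rate) * R + C / (1 - levy_rate) * R + C * R"
    by linarith
  also have "\<dots> = (2 * C / (1 - levy_rate) + C) * R" by (simp add: distrib_right)
  finally show ?thesis by (simp add: R_def mult.assoc)
qed

lemma levy_path_continuous: "continuous_on {0..} (levy_path a)"
proof (rule continuous_onI)
  fix s e :: real assume s: "s \<in> {0..}" and e: "0 < e"
  define D where "D = (2 * C / (1 - levy_rate) + C) * (1 + (s + 1)) powr (1 / 4)"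
  have q: "0 < levy_rate" "levy_rate < 1" by (rule levy_rate)+
  have "(\<lambda>n. D * levy_rate ^ n) \<longlonglongrightarrow> D * 0" using q by (intro tendsto_intros LIMSEQ_realpow_zero) auto
  then have "eventually (\<lambda>n. D * levy_rate ^ n < e) sequentially" using e by (auto dest: order_tendstoD)
  then obtain n where n: "D * levy_rate ^ n < e" by (auto simp: eventually_sequentially)
  show "\<exists>d>0. \<forall>x'\<in>{0..}. dist x' s < d \<longrightarrow> dist (levy_path a x') (levy_path a s) \<le> e"
  proof (intro exI[of _ "1 / 2 ^ n"] conjI ballI impI)
    fix t assume t: "t \<in> {0..}" "dist t s < 1 / 2 ^ n"
    have one: "1 / 2 ^ n \<le> (1::real)" by simp
    have ts: "t - s < 1 / 2 ^ n" "s - t < 1 / 2 ^ n" "t \<le> s + 1"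
      using t(2) one unfolding dist_real_def by linarith+
    have "\<bar>levy_path a (max s t) - levy_path a (min s t)\<bar> \<le> D * levy_rate ^ n"
      unfolding D_def using s t(1) ts by (intro levy_path_modulus) (auto simp: max_def min_def)
    then show "dist (levy_path a t) (levy_path a s) \<le> e"
      using n by (auto simp: dist_real_def max_def min_def abs_minus_commute split: if_splits)
  qed simp
qed

end

section \<open>The law of the limit path\<close>

lemma (in prob_space) normal_no_atoms:
  assumes "distributed M lborel X (normal_density \<mu> \<sigma>)"
  shows "prob {\<omega>\<in>space M. X \<omega> = a} = 0"
proof -
  have d: "distr M lborel X = density lborel (normal_density \<mu> \<sigma>)" "X \<in> M \<rightarrow>\<^sub>M lborel"
    using assms by (auto simp: distributed_def)
  have "emeasure (distr M lborel X) {a} = 0"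
    unfolding d(1) by (subst emeasure_density) (auto simp: nn_integral_0_iff_AE AE_lborel_singleton indicator_def intro: AE_mp[OF AE_lborel_singleton[of a]])
  also have "emeasure (distr M lborel X) {a} = emeasure M {\<omega>\<in>space M. X \<omega> = a}"
    using d(2) by (subst emeasure_distr) (auto intro!: arg_cong[where f="emeasure M"])
  finally show ?thesis by (simp add: measure_def)
qed

lemma (in prob_space) std_normal_of_char:
  assumes [measurable]: "random_variable borel X"
    and "\<And>u. (CLINT \<omega>|M. iexp (u * X \<omega>)) = exp (- (complex_of_real (u\<^sup>2)) / 2)"
  shows "std_normal X"
proof -
  have "distr M borel X = std_normal_distribution"
  proof (rule Levy_uniqueness)
    show "real_distribution (distr M borel X)" by (rule real_distribution_distr) simp
    show "real_distribution std_normal_distribution" by (rule real_dist_normal_dist)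
    show "char (distr M borel X) = char std_normal_distribution"
    proof
      fix u
      have "char (distr M borel X) u = (CLINT \<omega>|M. iexp (u * X \<omega>))"
        unfolding char_def by (subst integral_distr) auto
      also have "\<dots> = exp (- (complex_of_real (u\<^sup>2)) / 2)" by (rule assms(2))
      also have "\<dots> = char std_normal_distribution u"
        by (simp add: char_std_normal_distribution exp_of_real[symmetric])
      finally show "char (distr M borel X) u = char std_normal_distribution u" .
    qed
  qed
  then show ?thesis by (simp add: std_normal_iff_distr)
qed

lemma (in prob_space) char_std_normal:
  assumes X: "std_normal X"
  shows "(CLINT \<omega>|M. iexp (u * X \<omega>)) = exp (- (complex_of_real (u\<^sup>2)) / 2)"
proof -
  have [measurable]: "random_variable borel X" using std_normal_random_variable[OF X] .
  have "(CLINT \<omega>|M. iexp (u * X \<omega>)) = char (distr M borel X) u"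
    unfolding char_def by (subst integral_distr) auto
  also have "distr M borel X = std_normal_distribution" using X by (simp add: std_normal_iff_distr)
  finally show ?thesis by (simp add: char_std_normal_distribution exp_of_real[symmetric])
qed

lemma levy_step_diff:
  assumes "s \<le> t"
  shows "levy_step a n t - levy_step a n s = (\<Sum>k\<in>{nat \<lfloor>2 ^ n * s\<rfloor>..<nat \<lfloor>2 ^ n * t\<rfloor>}. levy_increment a n k) / sqrt (2 ^ n)"
proof -
  have "nat \<lfloor>2 ^ n * s\<rfloor> \<le> nat \<lfloor>2 ^ n * t\<rfloor>" using assms by (intro nat_mono floor_mono) simp
  then have "(\<Sum>k<nat \<lfloor>2 ^ n * t\<rfloor>. levy_increment a n k) - (\<Sum>k<nat \<lfloor>2 ^ n * s\<rfloor>. levy_increment a n k)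
      = (\<Sum>k\<in>{nat \<lfloor>2 ^ n * s\<rfloor>..<nat \<lfloor>2 ^ n * t\<rfloor>}. levy_increment a n k)"
    unfolding lessThan_atLeast0 by (intro sum_diff_nat_ivl) auto
  then show ?thesis by (simp add: levy_step_def diff_divide_distrib[symmetric])
qed

lemma dyadic_floor_tendsto:
  assumes "0 \<le> t" shows "(\<lambda>n. real (nat \<lfloor>2 ^ n * t\<rfloor>) / 2 ^ n) \<longlonglongrightarrow> t"
proof (rule tendsto_sandwich[of "\<lambda>n. t - (1 / 2) ^ n" _ _ "\<lambda>n. t"])
  have nf: "real (nat \<lfloor>2 ^ n * t\<rfloor>) = real_of_int \<lfloor>2 ^ n * t\<rfloor>" for n using assms by simp
  have fl: "real (nat \<lfloor>2 ^ n * t\<rfloor>) \<le> 2 ^ n * t" "2 ^ n * t - 1 \<le> real (nat \<lfloor>2 ^ n * t\<rfloor>)" for n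
    unfolding nf by linarith+
  have "(2 ^ n * t - 1) / 2 ^ n \<le> real (nat \<lfloor>2 ^ n * t\<rfloor>) / 2 ^ n" for n
    using fl(2) by (rule divide_right_mono) simp
  moreover have "real (nat \<lfloor>2 ^ n * t\<rfloor>) / 2 ^ n \<le> t" for n
    using fl(1)[of n] by (simp add: pos_divide_le_eq mult.commute)
  moreover have "(2 ^ n * t - 1) / 2 ^ n = t - (1 / 2) ^ n" for n by (simp add: diff_divide_distrib power_divide)
  ultimately show "\<forall>\<^sub>F n in sequentially. t - (1 / 2) ^ n \<le> real (nat \<lfloor>2 ^ n * t\<rfloor>) / 2 ^ n"
    "\<forall>\<^sub>F n in sequentially. real (nat \<lfloor>2 ^ n * t\<rfloor>) / 2 ^ n \<le> t"
    by (auto intro!: always_eventually)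
  have "(\<lambda>n. t - (1 / 2) ^ n) \<longlonglongrightarrow> t - 0" by (intro tendsto_intros LIMSEQ_realpow_zero) auto
  then show "(\<lambda>n. t - (1 / 2) ^ n) \<longlonglongrightarrow> t" by simp
qed simp

context prob_space
begin

context
  fixes x :: "nat \<times> nat \<Rightarrow> 'a \<Rightarrow> real"
  assumes x: "gaussian_family x UNIV"
begin

lemma gaussian_family_measurable: "random_variable borel (x i)"
proof -
  have "std_normal (x i)" using x unfolding gaussian_family_def by blast
  then show ?thesis by (rule std_normal_random_variable)
qed

lemma gaussian_array_measurable: "(\<lambda>\<omega> i. x i \<omega>) \<in> M \<rightarrow>\<^sub>M PiM UNIV (\<lambda>_. borel)"
  by (rule measurable_PiM_single') (auto intro: gaussian_family_measurable)

lemma levy_increment_rv [measurable]: "random_variable borel (\<lambda>\<omega>. levy_increment (\<lambda>i. x i \<omega>) n k)"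
  using measurable_compose[OF gaussian_array_measurable levy_increment_measurable] by simp

lemma levy_step_rv [measurable]: "random_variable borel (\<lambda>\<omega>. levy_step (\<lambda>i. x i \<omega>) n t)"
  unfolding levy_step_def by measurable

lemma levy_path_rv [measurable]: "random_variable borel (\<lambda>\<omega>. levy_path (\<lambda>i. x i \<omega>) t)"
  using measurable_compose[OF gaussian_array_measurable levy_path_measurable] by simp

lemma AE_levy_step_tendsto:
  assumes "0 \<le> t" shows "AE \<omega> in M. (\<lambda>n. levy_step (\<lambda>i. x i \<omega>) n t) \<longlonglongrightarrow> levy_path (\<lambda>i. x i \<omega>) t"
  using AE_levy_bounded[OF x] by eventually_elim (use levy_step_converges(1)[OF _ assms] in blast)

text \<open>At each level the increment is exactly Gaussian, with variance the number of dyadic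
  intervals counted, divided by \<open>2 ^ n\<close>. This tends to \<open>t - s\<close>, and
  characteristic functions carry the law to the limit.\<close>

lemma levy_path_increment_normal:
  assumes st: "0 \<le> s" "s < t"
  shows "distributed M lborel (\<lambda>\<omega>. levy_path (\<lambda>i. x i \<omega>) t - levy_path (\<lambda>i. x i \<omega>) s) (normal_density 0 (sqrt (t - s)))"
proof -
  define D where "D n \<omega> = levy_step (\<lambda>i. x i \<omega>) n t - levy_step (\<lambda>i. x i \<omega>) n s" for n \<omega>
  define D' where "D' \<omega> = levy_path (\<lambda>i. x i \<omega>) t - levy_path (\<lambda>i. x i \<omega>) s" for \<omega>
  define I where "I n = {nat \<lfloor>2 ^ n * s\<rfloor>..<nat \<lfloor>2 ^ n * t\<rfloor>}" for n
  have [measurable]: "random_variable borel (D n)" "random_variable borel D'" for n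
    unfolding D_def D'_def by measurable
  have Dlim: "AE \<omega> in M. (\<lambda>n. D n \<omega>) \<longlonglongrightarrow> D' \<omega>"
    using AE_levy_step_tendsto[OF st(1)] AE_levy_step_tendsto[OF order_trans[OF st(1) less_imp_le[OF st(2)]]]
    unfolding D_def D'_def by eventually_elim (intro tendsto_diff)
  have charD: "(CLINT \<omega>|M. iexp (u * D n \<omega>)) = exp (- (complex_of_real (u\<^sup>2 * (real (card (I n)) / 2 ^ n))) / 2)" for n u
  \<comment> \<open>At coarse levels no dyadic point may separate \<open>s\<close> and
    \<open>t\<close>; the increment is then 0, and the formula holds with variance 0.\<close>
  proof (cases "I n = {}")
    case True
    then have "D n \<omega> = 0" for \<omega> using st unfolding D_def by (subst levy_step_diff) (auto simp: I_def)
    then show ?thesis using True by (simp add: prob_space)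
  next
    case False
    note g = levy_increment_gaussian[OF x, of n]
    define G where "G \<omega> = (\<Sum>k\<in>I n. levy_increment (\<lambda>i. x i \<omega>) n k) / sqrt (real (card (I n)))" for \<omega>
    have G: "std_normal G" unfolding G_def
      using g False by (intro std_normal_sum) (auto simp: gaussian_family_def I_def intro: indep_vars_subset)
    have c: "0 < card (I n)" using False by (auto simp: I_def card_gt_0_iff)
    have "u * D n \<omega> = (u * (sqrt (real (card (I n))) / sqrt (2 ^ n))) * G \<omega>" for \<omega>
      using st c unfolding D_def G_def I_def by (subst levy_step_diff) auto
    then have "(CLINT \<omega>|M. iexp (u * D n \<omega>)) = exp (- (complex_of_real ((u * (sqrt (real (card (I n))) / sqrt (2 ^ n)))\<^sup>2)) / 2)"
      using char_std_normal[OF G, of "u * (sqrt (real (card (I n))) / sqrt (2 ^ n))"] by simp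
    also have "(u * (sqrt (real (card (I n))) / sqrt (2 ^ n)))\<^sup>2 = u\<^sup>2 * (real (card (I n)) / 2 ^ n)"
      by (simp add: power_mult_distrib power_divide)
    finally show ?thesis .
  qed
  have cI: "(\<lambda>n. real (card (I n)) / 2 ^ n) \<longlonglongrightarrow> t - s"
  proof -
    have "real (card (I n)) / 2 ^ n = real (nat \<lfloor>2 ^ n * t\<rfloor>) / 2 ^ n - real (nat \<lfloor>2 ^ n * s\<rfloor>) / 2 ^ n" for n
    proof -
      have "nat \<lfloor>2 ^ n * s\<rfloor> \<le> nat \<lfloor>2 ^ n * t\<rfloor>" using st by (intro nat_mono floor_mono) simp
      then show ?thesis by (simp add: I_def of_nat_diff diff_divide_distrib)
    qed
    then show ?thesis using st by (simp only:) (intro tendsto_diff dyadic_floor_tendsto; simp)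
  qed
  have charD': "(CLINT \<omega>|M. iexp (u * D' \<omega>)) = exp (- (complex_of_real (u\<^sup>2 * (t - s))) / 2)" for u
  proof (rule LIMSEQ_unique)
    show "(\<lambda>n. CLINT \<omega>|M. iexp (u * D n \<omega>)) \<longlonglongrightarrow> (CLINT \<omega>|M. iexp (u * D' \<omega>))"
    proof (rule integral_dominated_convergence[where w="\<lambda>_. 1"])
      show "AE \<omega> in M. (\<lambda>n. iexp (u * D n \<omega>)) \<longlonglongrightarrow> iexp (u * D' \<omega>)"
        using Dlim by eventually_elim (intro tendsto_intros)
    qed auto
    show "(\<lambda>n. CLINT \<omega>|M. iexp (u * D n \<omega>)) \<longlonglongrightarrow> exp (- (complex_of_real (u\<^sup>2 * (t - s))) / 2)"
      unfolding charD by (intro tendsto_intros cI) simp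
  qed
  have "std_normal (\<lambda>\<omega>. D' \<omega> / sqrt (t - s))"
  proof (rule std_normal_of_char)
    fix u
    have "(CLINT \<omega>|M. iexp (u * (D' \<omega> / sqrt (t - s)))) = (CLINT \<omega>|M. iexp ((u / sqrt (t - s)) * D' \<omega>))"
      by simp
    also have "\<dots> = exp (- (complex_of_real ((u / sqrt (t - s))\<^sup>2 * (t - s))) / 2)" by (rule charD')
    also have "(u / sqrt (t - s))\<^sup>2 * (t - s) = u\<^sup>2" using st by (simp add: power_divide)
    finally show "(CLINT \<omega>|M. iexp (u * (D' \<omega> / sqrt (t - s)))) = exp (- (complex_of_real (u\<^sup>2)) / 2)" .
  qed simp
  then show ?thesis
    using normal_standard_normal_convert[of "sqrt (t - s)" D' 0] st by (simp add: D'_def[abs_def])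
qed

text \<open>At each level the increments are sums over disjoint sets of independent variables;
  \<open>indep_vars_limit\<close> transfers this to the limit.\<close>

lemma levy_path_increments_indep:
  fixes t :: "nat \<Rightarrow> real"
  assumes t0: "0 \<le> t 0" and mono: "\<forall>i<n. t i \<le> t (Suc i)"
  shows "indep_vars (\<lambda>_. borel) (\<lambda>i \<omega>. levy_path (\<lambda>i. x i \<omega>) (t (Suc i)) - levy_path (\<lambda>i. x i \<omega>) (t i)) {..<n}"
proof (rule indep_vars_limit[where X = "\<lambda>m i \<omega>. levy_step (\<lambda>i. x i \<omega>) m (t (Suc i)) - levy_step (\<lambda>i. x i \<omega>) m (t i)"])
  have le: "t i \<le> t j" if "i \<le> j" "j \<le> n" for i j
    using that
  proof (induction j rule: dec_induct)
    case (step j)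
    then have "t i \<le> t j" "t j \<le> t (Suc j)" using mono by auto
    then show ?case by (rule order_trans)
  qed simp
  show "finite {..<n}" by simp
  fix m
  define K where "K i = {nat \<lfloor>2 ^ m * t i\<rfloor>..<nat \<lfloor>2 ^ m * t (Suc i)\<rfloor>}" for i
  have disj: "disjoint_family_on K {..<n}"
  proof -
    have sep: "K i \<inter> K j = {}" if "i < j" "j < n" for i j
    proof -
      have "nat \<lfloor>2 ^ m * t (Suc i)\<rfloor> \<le> nat \<lfloor>2 ^ m * t j\<rfloor>"
        using le[of "Suc i" j] that by (intro nat_mono floor_mono mult_left_mono) auto
      then show ?thesis by (auto simp: K_def)
    qed
    show ?thesis unfolding disjoint_family_on_def
    proof (intro ballI impI)
      fix i j assume "i \<in> {..<n}" "j \<in> {..<n}" "i \<noteq> j"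
      then show "K i \<inter> K j = {}" using sep[of i j] sep[of j i] by (cases "i < j") auto
    qed
  qed
  have "indep_vars (\<lambda>i. PiM (K i) (\<lambda>_. borel)) (\<lambda>i \<omega>. restrict (\<lambda>k. levy_increment (\<lambda>i. x i \<omega>) m k) (K i)) {..<n}"
    using levy_increment_gaussian[OF x, of m] disj by (intro indep_vars_restrict[where I = UNIV]) (auto simp: gaussian_family_def)
  then have "indep_vars (\<lambda>_. borel) (\<lambda>i \<omega>. (\<Sum>k\<in>K i. (restrict (\<lambda>k. levy_increment (\<lambda>i. x i \<omega>) m k) (K i)) k) / sqrt (2 ^ m)) {..<n}"
    by (rule indep_vars_compose2) (auto intro!: borel_measurable_divide borel_measurable_sum measurable_component_singleton)
  then show "indep_vars (\<lambda>_. borel) (\<lambda>i \<omega>. levy_step (\<lambda>i. x i \<omega>) m (t (Suc i)) - levy_step (\<lambda>i. x i \<omega>) m (t i)) {..<n}"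
    by (rule indep_vars_cong[THEN iffD1, rotated -1]) (auto simp: fun_eq_iff levy_step_diff mono K_def)
next
  have le: "t i \<le> t j" if "i \<le> j" "j \<le> n" for i j
    using that
  proof (induction j rule: dec_induct)
    case (step j)
    then have "t i \<le> t j" "t j \<le> t (Suc j)" using mono by auto
    then show ?case by (rule order_trans)
  qed simp
  have nonneg: "0 \<le> t i" if "i \<le> n" for i using le[of 0 i] t0 that by auto
  fix i assume i: "i \<in> {..<n}"
  then have ti: "0 \<le> t i" "0 \<le> t (Suc i)" using nonneg by auto
  show "random_variable borel (\<lambda>\<omega>. levy_path (\<lambda>i. x i \<omega>) (t (Suc i)) - levy_path (\<lambda>i. x i \<omega>) (t i))" by measurable
  show "AE \<omega> in M. (\<lambda>m. levy_step (\<lambda>i. x i \<omega>) m (t (Suc i)) - levy_step (\<lambda>i. x i \<omega>) m (t i))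
      \<longlonglongrightarrow> levy_path (\<lambda>i. x i \<omega>) (t (Suc i)) - levy_path (\<lambda>i. x i \<omega>) (t i)"
    using AE_levy_step_tendsto[OF ti(1)] AE_levy_step_tendsto[OF ti(2)]
    by eventually_elim (intro tendsto_intros)
  show "(\<forall>m. \<forall>\<omega>\<in>space M. levy_step (\<lambda>i. x i \<omega>) m (t (Suc i)) - levy_step (\<lambda>i. x i \<omega>) m (t i) = levy_path (\<lambda>i. x i \<omega>) (t (Suc i)) - levy_path (\<lambda>i. x i \<omega>) (t i)) \<or>
      (\<forall>a. prob {\<omega>\<in>space M. levy_path (\<lambda>i. x i \<omega>) (t (Suc i)) - levy_path (\<lambda>i. x i \<omega>) (t i) = a} = 0)"
  \<comment> \<open>Intervals of length 0 are allowed. Their increments have an atom, but they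
    vanish at every level and in the limit.\<close>
  proof (cases "t i = t (Suc i)")
    case False
    then have "t i < t (Suc i)" using mono i by (simp add: order_less_le)
    from normal_no_atoms[OF levy_path_increment_normal[OF ti(1) this]] show ?thesis by simp
  qed simp
qed

lemma levy_path_wiener: "wiener_process (\<lambda>t \<omega>. levy_path (\<lambda>i. x i \<omega>) t)"
  unfolding wiener_process_def
proof (intro conjI allI impI)
  have "levy_path a 0 = 0" for a by (simp add: levy_path_def levy_step_def)
  then show "AE \<omega> in M. levy_path (\<lambda>i. x i \<omega>) 0 = 0" by simp
  show "AE \<omega> in M. continuous_on {0..} (levy_path (\<lambda>i. x i \<omega>))"
    using AE_levy_bounded[OF x] by eventually_elim (use levy_path_continuous in blast)
qed (auto intro: levy_path_increment_normal levy_path_increments_indep)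

text \<open>The rate of convergence at level 0. It ties the path to the partial sums of the level-0
  coefficients, which are the Gaussian variables with which the signs are coupled.\<close>

lemma AE_levy_path_integer_skeleton:
  "AE \<omega> in M. \<exists>C. \<forall>t\<ge>0. \<bar>levy_path (\<lambda>i. x i \<omega>) t - (\<Sum>k<nat \<lfloor>t\<rfloor>. x (0, k) \<omega>)\<bar> \<le> C * (1 + t) powr (1 / 4)"
  using AE_levy_bounded[OF x]
proof eventually_elim
  case (elim \<omega>)
  then obtain C where C: "levy_bounded (\<lambda>i. x i \<omega>) C" by blast
  show ?case
    using levy_step_converges(2)[OF C, of _ 0] by (intro exI[of _ "C / (1 - levy_rate)"]) (auto simp: levy_step_def)
qed

end

end

lemma (in prob_space) indep_processes_levy_path:
  fixes x :: "'i \<Rightarrow> 'a \<Rightarrow> real"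
  assumes x: "indep_vars (\<lambda>_. borel) x UNIV" and fg: "range f \<inter> range g = {}"
  shows "indep_processes (\<lambda>t \<omega>. levy_path (\<lambda>i. x (f i) \<omega>) t) (\<lambda>t \<omega>. levy_path (\<lambda>i. x (g i) \<omega>) t)"
proof -
  have ind: "indep_var (PiM (range f) (\<lambda>_. borel)) (\<lambda>\<omega>. restrict (\<lambda>i. x i \<omega>) (range f))
      (PiM (range g) (\<lambda>_. borel)) (\<lambda>\<omega>. restrict (\<lambda>i. x i \<omega>) (range g))"
    by (rule indep_var_restrict[OF x fg]) auto
  have m: "(\<lambda>a. \<lambda>t\<in>{0..}. levy_path (\<lambda>i. a (h i)) t) \<in> PiM (range h) (\<lambda>_. borel) \<rightarrow>\<^sub>M PiM {0..} (\<lambda>_. borel)"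
    for h :: "nat \<times> nat \<Rightarrow> 'i"
  proof (rule measurable_restrict)
    fix t :: real
    have "(\<lambda>a i. a (h i)) \<in> PiM (range h) (\<lambda>_. borel :: real measure) \<rightarrow>\<^sub>M PiM UNIV (\<lambda>_. borel)"
      by (rule measurable_PiM_single') (auto intro: measurable_component_singleton)
    from measurable_compose[OF this levy_path_measurable]
    show "(\<lambda>a. levy_path (\<lambda>i. a (h i)) t) \<in> borel_measurable (PiM (range h) (\<lambda>_. borel))" .
  qed
  show ?thesis
    unfolding indep_processes_def using indep_var_compose[OF ind m[of f] m[of g]] by (simp add: comp_def)
qed

section \<open>Fair signs coupled with a Gaussian sequence\<close>

lemma (in prob_space) indep_vars_inj_reindex:
  assumes ind: "indep_vars N X I" and f: "inj_on f J" "f ` J \<subseteq> I"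
  shows "indep_vars (\<lambda>j. N (f j)) (\<lambda>j. X (f j)) J"
proof -
  have r: "indep_vars (\<lambda>j. PiM {f j} N) (\<lambda>j \<omega>. restrict (\<lambda>i. X i \<omega>) {f j}) J"
    by (rule indep_vars_restrict[OF ind]) (use f in \<open>auto simp: disjoint_family_on_def inj_on_def\<close>)
  have "indep_vars (\<lambda>j. N (f j)) (\<lambda>j \<omega>. (restrict (\<lambda>i. X i \<omega>) {f j}) (f j)) J"
    by (rule indep_vars_compose2[OF r]) (auto intro: measurable_component_singleton)
  then show ?thesis by (simp add: eta_contract_eq)
qed

lemma (in prob_space) indep_centered_sum_square:
  fixes X :: "'i \<Rightarrow> 'a \<Rightarrow> real"
  assumes I: "finite I" and ind: "indep_vars (\<lambda>_. borel) X I"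
    and int: "\<And>i. i \<in> I \<Longrightarrow> integrable M (X i)" "\<And>i. i \<in> I \<Longrightarrow> integrable M (\<lambda>\<omega>. (X i \<omega>)\<^sup>2)"
    and mean: "\<And>i. i \<in> I \<Longrightarrow> expectation (X i) = 0"
  shows "integrable M (\<lambda>\<omega>. (\<Sum>i\<in>I. X i \<omega>)\<^sup>2)"
    and "expectation (\<lambda>\<omega>. (\<Sum>i\<in>I. X i \<omega>)\<^sup>2) = (\<Sum>i\<in>I. expectation (\<lambda>\<omega>. (X i \<omega>)\<^sup>2))"
proof -
  have prod: "integrable M (\<lambda>\<omega>. X i \<omega> * X j \<omega>) \<and>
      expectation (\<lambda>\<omega>. X i \<omega> * X j \<omega>) = (if i = j then expectation (\<lambda>\<omega>. (X i \<omega>)\<^sup>2) else 0)"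
    if "i \<in> I" "j \<in> I" for i j
  proof (cases "i = j")
    case True then show ?thesis using int(2)[of i] that by (simp add: power2_eq_square)
  next
    case False
    have "indep_var borel (X i) borel (X j)" by (rule indep_vars_imp_indep_var[OF ind]) (use that False in auto)
    from indep_var_integrable[OF this int(1) int(1)] indep_var_lebesgue_integral[OF this int(1) int(1)]
    show ?thesis using mean[of i] that False by simp
  qed
  have eq: "(\<Sum>i\<in>I. X i \<omega>)\<^sup>2 = (\<Sum>i\<in>I. \<Sum>j\<in>I. X i \<omega> * X j \<omega>)" for \<omega>
    by (simp add: power2_eq_square sum_product)
  show "integrable M (\<lambda>\<omega>. (\<Sum>i\<in>I. X i \<omega>)\<^sup>2)"
    unfolding eq using prod by (intro Bochner_Integration.integrable_sum) auto
  have "expectation (\<lambda>\<omega>. (\<Sum>i\<in>I. X i \<omega>)\<^sup>2) = (\<Sum>i\<in>I. \<Sum>j\<in>I. expectation (\<lambda>\<omega>. X i \<omega> * X j \<omega>))"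
    unfolding eq using prod by (subst Bochner_Integration.integral_sum; (intro Bochner_Integration.integrable_sum sum.cong refl Bochner_Integration.integral_sum)?) auto
  also have "\<dots> = (\<Sum>i\<in>I. \<Sum>j\<in>I. if i = j then expectation (\<lambda>\<omega>. (X i \<omega>)\<^sup>2) else 0)"
    using prod by (intro sum.cong refl) auto
  also have "\<dots> = (\<Sum>i\<in>I. expectation (\<lambda>\<omega>. (X i \<omega>)\<^sup>2))" using I by simp
  finally show "expectation (\<lambda>\<omega>. (\<Sum>i\<in>I. X i \<omega>)\<^sup>2) = (\<Sum>i\<in>I. expectation (\<lambda>\<omega>. (X i \<omega>)\<^sup>2))" .
qed

text \<open>It bounds both the lengths of the coupling blocks and the gaps between eighth powers in
  \<open>AE_horizontal_time\<close>.\<close>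

lemma power_Suc_increment: "(j + 1) ^ Suc n \<le> j ^ Suc n + Suc n * (j + 1) ^ n" for j :: nat
proof (induction n)
  case (Suc n)
  have "(j + 1) ^ Suc (Suc n) = (j + 1) * (j + 1) ^ Suc n" by simp
  also have "\<dots> \<le> (j + 1) * (j ^ Suc n + Suc n * (j + 1) ^ n)" using Suc by (intro mult_left_mono) auto
  also have "\<dots> = j ^ Suc (Suc n) + j ^ Suc n + Suc n * (j + 1) ^ Suc n" by (simp add: algebra_simps)
  also have "\<dots> \<le> j ^ Suc (Suc n) + (j + 1) ^ Suc n + Suc n * (j + 1) ^ Suc n"
    by (intro add_mono power_mono) auto
  finally show ?case by simp
qed simp

text \<open>The block ends \<open>j ^ 257\<close> are sparse enough for Borel--Cantelli at the block ends:
  a block of length \<open>m\<close> is coupled with an \<open>L\<^sup>2\<close> error of order \<open>m powr (127 / 256)\<close>.\<close>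

definition block_end :: "nat \<Rightarrow> nat" where
  "block_end j = j ^ 257"

definition block_length :: "nat \<Rightarrow> nat" where
  "block_length j = block_end (Suc j) - block_end j"

definition block_of :: "nat \<Rightarrow> nat" where
  "block_of n = (LEAST j. n < block_end (Suc j))"

lemma block_end_strict_mono: "strict_mono block_end"
  by (rule strict_monoI) (simp add: block_end_def power_strict_mono)

lemma block_end_0 [simp]: "block_end 0 = 0"
  by (simp add: block_end_def)

lemma block_end_less: "block_end j < block_end (Suc j)"
  using block_end_strict_mono by (simp add: strict_mono_less)

lemma block_length_pos: "0 < block_length j"
  using block_end_less[of j] by (simp add: block_length_def)

lemma block_of_bounds: "block_end (block_of n) \<le> n" "n < block_end (Suc (block_of n))"
proof -
  have "n \<le> block_end n" using strict_mono_imp_increasing[OF block_end_strict_mono] .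
  then have ex: "n < block_end (Suc n)" using block_end_less[of n] by linarith
  show "n < block_end (Suc (block_of n))" unfolding block_of_def by (rule LeastI[of _ n]) (rule ex)
  show "block_end (block_of n) \<le> n"
  proof (cases "block_of n")
    case (Suc j)
    then have "\<not> n < block_end (Suc j)" unfolding block_of_def by (intro not_less_Least) simp
    then show ?thesis using Suc by simp
  qed simp
qed

lemma block_of_eq: "block_of n = j" if "block_end j \<le> n" "n < block_end (Suc j)"
proof -
  have "block_end (block_of n) < block_end (Suc j)" "block_end j < block_end (Suc (block_of n))"
    using block_of_bounds[of n] that by linarith+
  then have "block_of n < Suc j" "j < Suc (block_of n)"
    using block_end_strict_mono by (simp_all add: strict_mono_less)
  then show ?thesis by simp
qed

lemma block_length_le: "block_length j \<le> 257 * (j + 1) ^ 256"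
  using power_Suc_increment[of j 256] by (simp add: block_length_def block_end_def)

lemma disjoint_blocks: "disjoint_family_on (\<lambda>j. {block_end j..<block_end (Suc j)}) UNIV"
  unfolding disjoint_family_on_def
proof (intro ballI impI)
  fix i j :: nat assume "i \<noteq> j"
  moreover have "i = j" if "k \<in> {block_end i..<block_end (Suc i)} \<inter> {block_end j..<block_end (Suc j)}" for k
    using that block_of_eq[of i k] block_of_eq[of j k] by simp
  ultimately show "{block_end i..<block_end (Suc i)} \<inter> {block_end j..<block_end (Suc j)} = {}" by blast
qed

definition block_normal :: "(nat \<Rightarrow> real) \<Rightarrow> nat \<Rightarrow> real" where
  "block_normal z j = (\<Sum>k\<in>{block_end j..<block_end (Suc j)}. z k) / sqrt (real (block_length j))"

text \<open>One normal variable per block produces all signs of the block. A sign thus depends on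
  later Gaussian variables of its block, which is harmless: only the joint law of the signs and the
  almost sure closeness matter.\<close>

definition coupled_sign :: "(nat \<Rightarrow> real) \<Rightarrow> nat \<Rightarrow> int" where
  "coupled_sign z n = quantile_signs (block_length (block_of n)) (block_normal z (block_of n)) ! (n - block_end (block_of n))"

lemma coupled_sign_eq:
  assumes "n \<in> {block_end j..<block_end (Suc j)}"
  shows "coupled_sign z n = quantile_signs (block_length j) (block_normal z j) ! (n - block_end j)"
proof -
  have "block_of n = j" using assms by (intro block_of_eq) auto
  then show ?thesis by (simp add: coupled_sign_def)
qed

lemma sum_blocks:
  "(\<Sum>k<block_end J. f k) = (\<Sum>j<J. \<Sum>k\<in>{block_end j..<block_end (Suc j)}. f k)" for f :: "nat \<Rightarrow> real"
proof (induction J)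
  case (Suc J)
  have "(\<Sum>k<block_end (Suc J). f k) = (\<Sum>k<block_end J. f k) + (\<Sum>k\<in>{block_end J..<block_end (Suc J)}. f k)"
    unfolding lessThan_atLeast0 using block_end_less[of J] by (intro sum.atLeastLessThan_concat[symmetric]) auto
  then show ?case using Suc by simp
qed simp

lemma coupled_sign_block_sum:
  "(\<Sum>k\<in>{block_end j..<block_end (Suc j)}. coupled_sign z k) = sum_list (quantile_signs (block_length j) (block_normal z j))"
proof -
  define v where "v = quantile_signs (block_length j) (block_normal z j)"
  have len: "length v = block_length j" using quantile_signs_in by (simp add: v_def sign_lists_def)
  have "(\<Sum>k\<in>{block_end j..<block_end (Suc j)}. coupled_sign z k) = (\<Sum>k\<in>{block_end j..<block_end (Suc j)}. v ! (k - block_end j))"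
    by (intro sum.cong refl) (simp add: coupled_sign_eq v_def)
  also have "\<dots> = (\<Sum>i<block_length j. v ! i)"
    by (rule sum.reindex_bij_witness[of _ "\<lambda>i. i + block_end j" "\<lambda>k. k - block_end j"])
       (use block_end_less[of j] in \<open>auto simp: block_length_def\<close>)
  also have "\<dots> = sum_list v" by (simp add: sum_list_sum_nth len atLeast0LessThan)
  finally show ?thesis by (simp add: v_def)
qed

context prob_space
begin

context
  fixes z :: "nat \<Rightarrow> 'a \<Rightarrow> real"
  assumes z: "gaussian_family z UNIV"
begin

lemma block_normal_gaussian: "gaussian_family (\<lambda>j \<omega>. block_normal (\<lambda>k. z k \<omega>) j) UNIV"
  unfolding gaussian_family_def
proof (intro conjI ballI)
  let ?K = "\<lambda>j. {block_end j..<block_end (Suc j)}"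
  have ind: "indep_vars (\<lambda>_. borel) z UNIV" using z by (simp add: gaussian_family_def)
  have "indep_vars (\<lambda>j. PiM (?K j) (\<lambda>_. borel)) (\<lambda>j \<omega>. restrict (\<lambda>k. z k \<omega>) (?K j)) UNIV"
    by (rule indep_vars_restrict[OF ind _ disjoint_blocks]) auto
  then have "indep_vars (\<lambda>_. borel) (\<lambda>j \<omega>. (\<Sum>k\<in>?K j. (restrict (\<lambda>k. z k \<omega>) (?K j)) k) / sqrt (real (block_length j))) UNIV"
    by (rule indep_vars_compose2) (auto intro!: borel_measurable_divide borel_measurable_sum measurable_component_singleton)
  then show "indep_vars (\<lambda>_. borel) (\<lambda>j \<omega>. block_normal (\<lambda>k. z k \<omega>) j) UNIV"
    by (simp add: block_normal_def)
  fix j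
  have "std_normal (\<lambda>\<omega>. (\<Sum>k\<in>?K j. z k \<omega>) / sqrt (real (card (?K j))))"
    using block_end_less[of j] z by (intro std_normal_sum indep_vars_subset[OF ind]) (auto simp: gaussian_family_def)
  then show "std_normal (\<lambda>\<omega>. block_normal (\<lambda>k. z k \<omega>) j)"
    by (simp add: block_normal_def block_length_def)
qed

text \<open>Signs of different blocks depend on disjoint parts of \<open>z\<close>, and signs inside
  a block are coordinates of a uniform sign vector; \<open>indep_vars_blocks\<close> combines the
  two.\<close>

lemma coupled_sign_iid:
  shows "indep_vars (\<lambda>_. count_space UNIV) (\<lambda>n \<omega>. coupled_sign (\<lambda>k. z k \<omega>) n) UNIV"
    and "fair_sign (\<lambda>\<omega>. coupled_sign (\<lambda>k. z k \<omega>) n)"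
proof -
  let ?g = "\<lambda>j \<omega>. block_normal (\<lambda>k. z k \<omega>) j"
  let ?F = "\<lambda>j. {block_end j..<block_end (Suc j)}"
  have g: "indep_vars (\<lambda>_. borel) ?g UNIV" "std_normal (?g j)" for j
    using block_normal_gaussian by (auto simp: gaussian_family_def)
  have cs: "coupled_sign (\<lambda>k. z k \<omega>) n = quantile_signs (block_length j) (?g j \<omega>) ! (n - block_end j)" if "n \<in> ?F j" for n j \<omega>
    using that by (rule coupled_sign_eq)
  have un: "(\<Union>j\<in>UNIV. ?F j) = UNIV"
    using block_of_bounds by (auto simp: set_eq_iff intro!: exI[of _ "block_of _"])
  have "indep_vars (\<lambda>_. count_space UNIV) (\<lambda>n \<omega>. coupled_sign (\<lambda>k. z k \<omega>) n) (\<Union>j\<in>UNIV. ?F j)"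
  proof (rule indep_vars_blocks)
    have "indep_vars (\<lambda>j. PiM (?F j) (\<lambda>_. count_space UNIV))
        (\<lambda>j \<omega>. (\<lambda>x. \<lambda>n\<in>?F j. quantile_signs (block_length j) x ! (n - block_end j)) (?g j \<omega>)) UNIV"
      by (rule indep_vars_compose2[OF g(1)], rule measurable_restrict, measurable)
    moreover have "(\<lambda>n\<in>?F j. quantile_signs (block_length j) (?g j \<omega>) ! (n - block_end j)) = (\<lambda>n\<in>?F j. coupled_sign (\<lambda>k. z k \<omega>) n)" for j \<omega>
      using cs by (intro restrict_ext) simp
    ultimately show "indep_vars (\<lambda>j. PiM (?F j) (\<lambda>_. count_space UNIV)) (\<lambda>j \<omega>. \<lambda>n\<in>?F j. coupled_sign (\<lambda>k. z k \<omega>) n) UNIV"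
      by simp
    show "disjoint_family_on ?F UNIV" by (rule disjoint_blocks)
    fix j
    have "indep_vars (\<lambda>_. count_space UNIV) (\<lambda>n \<omega>. quantile_signs (block_length j) (?g j \<omega>) ! (n - block_end j)) (?F j)"
      by (rule indep_vars_inj_reindex[OF quantile_signs_components(1)[OF g(2)]])
         (auto simp: inj_on_def block_length_def)
    then show "indep_vars (\<lambda>_. count_space UNIV) (\<lambda>n \<omega>. coupled_sign (\<lambda>k. z k \<omega>) n) (?F j)"
      by (rule indep_vars_cong[THEN iffD1, rotated -1]) (auto simp: cs fun_eq_iff)
  qed
  then show "indep_vars (\<lambda>_. count_space UNIV) (\<lambda>n \<omega>. coupled_sign (\<lambda>k. z k \<omega>) n) UNIV"
    unfolding un .
  have "n - block_end (block_of n) < block_length (block_of n)"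
    using block_of_bounds[of n] by (simp add: block_length_def)
  then show "fair_sign (\<lambda>\<omega>. coupled_sign (\<lambda>k. z k \<omega>) n)"
    unfolding coupled_sign_def by (rule quantile_signs_components(2)[OF g(2)])
qed

text \<open>The block errors are independent and centred, so their second moments add.
  \<open>J\<close> blocks of error at most of order \<open>J ^ 254\<close> give
  \<open>J ^ 255\<close>, and division by \<open>block_end J = J ^ 257\<close> leaves a summable
  \<open>1 / J\<^sup>2\<close>.\<close>

lemma AE_block_coupling:
  "AE \<omega> in M. (\<lambda>J. ((\<Sum>k<block_end J. real_of_int (coupled_sign (\<lambda>k. z k \<omega>) k)) - (\<Sum>k<block_end J. z k \<omega>))\<^sup>2 / real (block_end J)) \<longlonglongrightarrow> 0"
proof -
  let ?g = "\<lambda>j \<omega>. block_normal (\<lambda>k. z k \<omega>) j"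
  have g: "indep_vars (\<lambda>_. borel) ?g UNIV" "std_normal (?g j)" for j
    using block_normal_gaussian by (auto simp: gaussian_family_def)
  have [measurable]: "random_variable borel (?g j)" for j by (rule std_normal_random_variable[OF g(2)])
  define d where "d j \<omega> = real_of_int (sum_list (quantile_signs (block_length j) (?g j \<omega>))) - sqrt (real (block_length j)) * ?g j \<omega>" for j \<omega>
  define D where "D J \<omega> = (\<Sum>k<block_end J. real_of_int (coupled_sign (\<lambda>k. z k \<omega>) k)) - (\<Sum>k<block_end J. z k \<omega>)" for J \<omega>
  have Dd: "D J \<omega> = (\<Sum>j<J. d j \<omega>)" for J \<omega>
  proof -
    have "(\<Sum>k\<in>{block_end j..<block_end (Suc j)}. z k \<omega>) = sqrt (real (block_length j)) * ?g j \<omega>" for j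
      using block_length_pos[of j] by (simp add: block_normal_def)
    then show ?thesis
      unfolding D_def sum_blocks d_def by (simp add: sum_subtractf of_int_sum[symmetric] coupled_sign_block_sum del: of_int_sum)
  qed
  have dm: "(\<lambda>x. real_of_int (sum_list (quantile_signs m x)) - sqrt (real m) * x) \<in> borel_measurable borel" for m
    by measurable
  have indd: "indep_vars (\<lambda>_. borel) d UNIV"
    using indep_vars_compose2[OF g(1), of "\<lambda>j x. real_of_int (sum_list (quantile_signs (block_length j) x)) - sqrt (real (block_length j)) * x" "\<lambda>_. borel"] dm
    by (simp add: d_def[abs_def])
  obtain C where C: "\<And>m X. 0 < m \<Longrightarrow> std_normal X \<Longrightarrow>
     integrable M (\<lambda>\<omega>. (real_of_int (sum_list (quantile_signs m (X \<omega>))) - sqrt (real m) * X \<omega>)\<^sup>2) \<and>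
     expectation (\<lambda>\<omega>. (real_of_int (sum_list (quantile_signs m (X \<omega>))) - sqrt (real m) * X \<omega>)\<^sup>2) \<le> C * real m powr (127 / 128)"
    using quantile_signs_L2 by blast
  have d2: "integrable M (\<lambda>\<omega>. (d j \<omega>)\<^sup>2)" "expectation (\<lambda>\<omega>. (d j \<omega>)\<^sup>2) \<le> C * real (block_length j) powr (127 / 128)" for j
    using C[OF block_length_pos g(2)] by (auto simp: d_def)
  have C0: "0 \<le> C"
  proof -
    have "0 \<le> expectation (\<lambda>\<omega>. (d 0 \<omega>)\<^sup>2)" by (rule integral_nonneg_AE) simp
    also have "\<dots> \<le> C * real (block_length 0) powr (127 / 128)" by (rule d2)
    finally show ?thesis using block_length_pos[of 0] by (simp add: zero_le_mult_iff)
  qed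
  have d1: "integrable M (d j) \<and> expectation (d j) = 0" for j
  proof -
    let ?m = "block_length j"
    let ?\<xi> = "\<lambda>i \<omega>. real_of_int (quantile_signs ?m (?g j \<omega>) ! i)"
    have eq: "d j = (\<lambda>\<omega>. (\<Sum>i<?m. ?\<xi> i \<omega>) - sqrt (real ?m) * ?g j \<omega>)"
    proof
      fix \<omega>
      have "length (quantile_signs ?m (?g j \<omega>)) = ?m" using quantile_signs_in by (simp add: sign_lists_def)
      then show "d j \<omega> = (\<Sum>i<?m. ?\<xi> i \<omega>) - sqrt (real ?m) * ?g j \<omega>"
        by (simp add: d_def sum_list_sum_nth atLeast0LessThan)
    qed
    have \<xi>: "integrable M (?\<xi> i)" "expectation (?\<xi> i) = 0" if "i < ?m" for i
      using fair_sign_expectation[OF quantile_signs_components(2)[OF g(2) that], of real_of_int] by simp_all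
    have gi: "integrable M (?g j)" "expectation (?g j) = 0"
      using integrable_std_normal_moment[of 1] distributed_integrable[OF g(2)[of j], of "\<lambda>x. x"]
        standard_normal_distributed_expectation[OF g(2)[of j]] by simp_all
    show ?thesis
    proof
      show "integrable M (d j)" unfolding eq
        using \<xi> gi by (intro Bochner_Integration.integrable_diff Bochner_Integration.integrable_sum integrable_mult_right) auto
      have "expectation (d j) = expectation (\<lambda>\<omega>. \<Sum>i<?m. ?\<xi> i \<omega>) - expectation (\<lambda>\<omega>. sqrt (real ?m) * ?g j \<omega>)"
        unfolding eq using \<xi> gi
        by (intro Bochner_Integration.integral_diff Bochner_Integration.integrable_sum integrable_mult_right) auto
      also have "expectation (\<lambda>\<omega>. \<Sum>i<?m. ?\<xi> i \<omega>) = 0"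
        using \<xi> by (subst Bochner_Integration.integral_sum) auto
      also have "expectation (\<lambda>\<omega>. sqrt (real ?m) * ?g j \<omega>) = 0" using gi by simp
      finally show "expectation (d j) = 0" by simp
    qed
  qed
  \<comment> \<open>The exponent is 256 * 127 / 128 = 254.\<close>
  have len: "real (block_length j) powr (127 / 128) \<le> 257 * real J ^ 254" if "j < J" for j J
  proof -
    have J: "1 \<le> real J" using that by simp
    have "real (block_length j) \<le> real (257 * (j + 1) ^ 256)"
      using block_length_le[of j] by (simp only: of_nat_le_iff)
    also have "\<dots> = 257 * (real j + 1) ^ 256" by (simp add: add.commute)
    also have "\<dots> \<le> 257 * real J ^ 256" using that by (intro mult_left_mono power_mono) auto
    finally have "real (block_length j) powr (127 / 128) \<le> (257 * real J ^ 256) powr (127 / 128)"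
      by (intro powr_mono2) auto
    also have "\<dots> = 257 powr (127 / 128) * (real J ^ 256) powr (127 / 128)" using J by (simp add: powr_mult)
    also have "\<dots> \<le> 257 powr 1 * (real J ^ 256) powr (127 / 128)" by (intro mult_right_mono powr_mono) auto
    also have "(real J ^ 256) powr (127 / 128) = real J ^ 254"
      using J by (simp add: powr_realpow[symmetric] powr_powr del: powr_numeral)
    finally show ?thesis by simp
  qed
  have ED: "integrable M (\<lambda>\<omega>. (D J \<omega>)\<^sup>2)" "expectation (\<lambda>\<omega>. (D J \<omega>)\<^sup>2) \<le> C * 257 * real J ^ 255" for J
  proof -
    note sq = indep_centered_sum_square[of "{..<J}" d, OF _ indep_vars_subset[OF indd]]
    show "integrable M (\<lambda>\<omega>. (D J \<omega>)\<^sup>2)" unfolding Dd using d1 d2 by (intro sq) auto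
    have "expectation (\<lambda>\<omega>. (D J \<omega>)\<^sup>2) = (\<Sum>j<J. expectation (\<lambda>\<omega>. (d j \<omega>)\<^sup>2))"
      unfolding Dd using d1 d2 by (intro sq) auto
    also have "\<dots> \<le> (\<Sum>j<J. C * (257 * real J ^ 254))"
      using len C0 by (intro sum_mono order_trans[OF d2(2)] mult_left_mono) auto
    also have "\<dots> = C * 257 * (real J * real J ^ 254)" by simp
    also have "real J * real J ^ 254 = real J ^ Suc 254" by (rule power_Suc[symmetric])
    finally show "expectation (\<lambda>\<omega>. (D J \<omega>)\<^sup>2) \<le> C * 257 * real J ^ 255" by simp
  qed
  have "AE \<omega> in M. summable (\<lambda>J. (D J \<omega>)\<^sup>2 / real (block_end J))"
  proof (rule AE_summable_of_summable_integral)
    show "integrable M (\<lambda>\<omega>. (D J \<omega>)\<^sup>2 / real (block_end J))" for J using ED by simp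
    show "expectation (\<lambda>\<omega>. (D J \<omega>)\<^sup>2 / real (block_end J)) \<le> C * 257 * inverse (real J ^ 2)" for J
    proof (cases "J = 0")
      case False
      have "expectation (\<lambda>\<omega>. (D J \<omega>)\<^sup>2 / real (block_end J)) = expectation (\<lambda>\<omega>. (D J \<omega>)\<^sup>2) / real J ^ 257"
        by (simp add: block_end_def)
      also have "\<dots> \<le> C * 257 * real J ^ 255 / real J ^ 257" using ED by (intro divide_right_mono) auto
      also have "\<dots> = C * 257 * inverse (real J ^ 2)"
      proof -
        have "real J ^ 257 = real J ^ 255 * real J ^ 2" by (simp flip: power_add)
        moreover have "C * 257 * v / (v * w) = C * 257 * inverse w" if "v \<noteq> 0" for v w :: real
          using that by (simp add: inverse_eq_divide)
        moreover have "real J ^ 255 \<noteq> 0" using False by (simp only: power_not_zero of_nat_eq_0_iff not_False_eq_True)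
        ultimately show ?thesis by (simp only:)
      qed
      finally show ?thesis .
    qed simp
    show "summable (\<lambda>J. C * 257 * inverse (real J ^ 2))"
      by (intro summable_mult inverse_power_summable) simp
  qed simp
  then show ?thesis
    by eventually_elim (auto simp: D_def dest: summable_LIMSEQ_zero)
qed

end

end

section \<open>The walk driven by two sign sequences and a clock\<close>

fun walk_state :: "(int \<Rightarrow> real) \<Rightarrow> (nat \<Rightarrow> real) \<Rightarrow> (nat \<Rightarrow> int) \<Rightarrow> (nat \<Rightarrow> int) \<Rightarrow> nat \<Rightarrow> nat \<times> int \<times> int" where
  "walk_state p u a b 0 = (0, 0, 0)"
| "walk_state p u a b (Suc n) = (case walk_state p u a b n of (h, x, y) \<Rightarrow>
     if u n < 2 * p x then (Suc h, x + a h, y) else (h, x, y + b (n - h)))"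

lemma walk_state_invariant:
  "walk_state p u a b n = (h, x, y) \<Longrightarrow> h \<le> n \<and> x = (\<Sum>i<h. a i) \<and> y = (\<Sum>i<n - h. b i)"
proof (induction n arbitrary: h x y)
  case (Suc n)
  obtain h' x' y' where s: "walk_state p u a b n = (h', x', y')" by (cases "walk_state p u a b n")
  from Suc.IH[OF s] have IH: "h' \<le> n" "x' = (\<Sum>i<h'. a i)" "y' = (\<Sum>i<n - h'. b i)" by auto
  show ?case
  proof (cases "u n < 2 * p x'")
    case True then show ?thesis using Suc.prems s IH by auto
  next
    case False
    then have "h = h'" "x = x'" "y = y' + b (n - h')" using Suc.prems s by auto
    then show ?thesis using IH by (simp add: Suc_diff_le)
  qed
qed simp

text \<open>Clock and signs are rows of one array \<open>R\<close>, so that their joint independence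
  is a single assumption about indices and can be applied to any disjoint index sets.\<close>

locale walk_noise = prob_space +
  fixes p :: "int \<Rightarrow> real" and u :: "nat \<Rightarrow> 'a \<Rightarrow> real" and a b :: "nat \<Rightarrow> 'a \<Rightarrow> int"
    and R :: "nat \<times> nat \<Rightarrow> 'a \<Rightarrow> real"
  assumes p: "0 < p j" "p j \<le> 1 / 2"
    and u: "0 \<le> c \<Longrightarrow> c \<le> 1 \<Longrightarrow> prob {\<omega>\<in>space M. u n \<omega> < c} = c"
    and a: "fair_sign (a n)" and b: "fair_sign (b n)"
    and R: "R (0, n) \<omega> = u n \<omega>" "R (1, n) \<omega> = real_of_int (a n \<omega>)" "R (2, n) \<omega> = real_of_int (b n \<omega>)"
    and indep: "indep_vars (\<lambda>_. borel) R UNIV"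
begin

definition st :: "nat \<Rightarrow> 'a \<Rightarrow> nat \<times> int \<times> int" where
  "st n \<omega> = walk_state p (\<lambda>i. u i \<omega>) (\<lambda>i. a i \<omega>) (\<lambda>i. b i \<omega>) n"

definition hor :: "nat \<Rightarrow> 'a \<Rightarrow> nat" where "hor n \<omega> = fst (st n \<omega>)"
definition xpos :: "nat \<Rightarrow> 'a \<Rightarrow> int" where "xpos n \<omega> = fst (snd (st n \<omega>))"
definition path :: "nat \<Rightarrow> 'a \<Rightarrow> (nat \<times> int \<times> int) list" where "path n \<omega> = map (\<lambda>i. st i \<omega>) [0..<Suc n]"

definition past :: "(nat \<times> nat) set \<Rightarrow> 'a measure" where
  "past I = sigma (space M) (\<Union>i\<in>I. {R i -` A \<inter> space M |A. A \<in> sets borel})"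

text \<open>How many signs of each kind have been consumed after \<open>n\<close> steps is random.
  On the event that \<open>hor n\<close> equals \<open>k\<close> the consumed noise lies in this
  fixed index set, so a sum over \<open>k\<close> reduces the random indices to plain independence
  of disjoint index sets.\<close>

definition used :: "nat \<Rightarrow> nat \<Rightarrow> (nat \<times> nat) set" where
  "used n k = {0} \<times> {..<n} \<union> {1} \<times> {..<k} \<union> {2} \<times> {..<n - k}"

lemma space_past [simp]: "space (past I) = space M"
  unfolding past_def by (rule space_measure_of) auto

lemma sets_past: "sets (past I) = sigma_sets (space M) (\<Union>i\<in>I. {R i -` A \<inter> space M |A. A \<in> sets borel})"
  unfolding past_def by (rule sets_measure_of) auto

lemma past_mono: "I \<subseteq> J \<Longrightarrow> A \<in> sets (past I) \<Longrightarrow> A \<in> sets (past J)"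
  unfolding sets_past by (rule subsetD[OF sigma_sets_mono']) auto

lemma past_R: "i \<in> I \<Longrightarrow> A \<in> sets borel \<Longrightarrow> {\<omega>\<in>space M. R i \<omega> \<in> A} \<in> sets (past I)"
  unfolding sets_past by (rule sigma_sets.Basic) (auto simp: vimage_def Int_def)

lemma R_measurable [measurable]: "random_variable borel (R i)"
  using indep unfolding indep_vars_def2 by blast

lemma a_sign: "a n \<omega> = 1 \<or> a n \<omega> = - 1" and b_sign: "b n \<omega> = 1 \<or> b n \<omega> = - 1"
  using a[of n] b[of n] by (auto simp: fair_sign_def)

lemma past_events: "sets (past I) \<subseteq> events"
proof -
  have "(\<Union>i\<in>I. {R i -` A \<inter> space M |A. A \<in> sets borel}) \<subseteq> events"
    by (auto intro: measurable_sets[OF R_measurable])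
  then show ?thesis unfolding sets_past by (rule sets.sigma_sets_subset)
qed

lemma past_fresh:
  assumes E: "E \<in> sets (past I)" and ij: "i \<notin> I" "j \<notin> I" "i \<noteq> j" and AB: "A \<in> sets borel" "B \<in> sets borel"
  shows "prob (E \<inter> {\<omega>\<in>space M. R i \<omega> \<in> A} \<inter> {\<omega>\<in>space M. R j \<omega> \<in> B})
    = prob E * prob {\<omega>\<in>space M. R i \<omega> \<in> A} * prob {\<omega>\<in>space M. R j \<omega> \<in> B}"
proof -
  define L where "L = (\<lambda>k::nat. if k = 0 then I else if k = 1 then {i} else {j})"
  define gen where "gen i = {R i -` A \<inter> space M |A. A \<in> sets borel}" for i
  have "indep_sets gen UNIV" using indep by (simp add: indep_vars_def2 gen_def[abs_def])
  then have "indep_sets gen (\<Union>k\<in>{0, 1, 2}. L k)" by (rule indep_sets_mono_index[rotated]) simp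
  then have "indep_sets (\<lambda>k. sigma_sets (space M) (\<Union>i\<in>L k. gen i)) {0, 1, 2}"
  proof (rule indep_sets_collect_sigma)
    show "Int_stable (gen i)" for i
    proof (rule Int_stableI)
      fix X Y assume "X \<in> gen i" "Y \<in> gen i"
      then obtain A B where "X = R i -` A \<inter> space M" "Y = R i -` B \<inter> space M" "A \<in> sets borel" "B \<in> sets borel"
        by (auto simp: gen_def)
      then show "X \<inter> Y \<in> gen i" by (auto simp: gen_def intro!: exI[of _ "A \<inter> B"])
    qed
    show "disjoint_family_on L {0, 1, 2}" using ij by (auto simp: disjoint_family_on_def L_def)
  qed
  then have ind: "indep_sets (\<lambda>k. sets (past (L k))) {0, 1, 2}" by (simp add: sets_past gen_def)
  define F where "F = (\<lambda>k::nat. if k = 0 then E else if k = 1 then {\<omega>\<in>space M. R i \<omega> \<in> A} else {\<omega>\<in>space M. R j \<omega> \<in> B})"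
  have "prob (\<Inter>k\<in>{0, 1, 2}. F k) = (\<Prod>k\<in>{0, 1, 2}. prob (F k))"
    by (rule indep_setsD[OF ind]) (use E AB in \<open>auto simp: F_def L_def intro!: past_R\<close>)
  then show ?thesis by (simp add: F_def Int_ac mult.assoc)
qed

lemma st_Suc: "st (Suc n) \<omega> = (case st n \<omega> of (h, x, y) \<Rightarrow>
    if u n \<omega> < 2 * p x then (Suc h, x + a h \<omega>, y) else (h, x, y + b (n - h) \<omega>))"
  by (simp add: st_def)

lemma hor_le: "hor n \<omega> \<le> n"
proof -
  obtain h x y where s: "st n \<omega> = (h, x, y)" by (cases "st n \<omega>")
  with walk_state_invariant[of p "\<lambda>i. u i \<omega>" "\<lambda>i. a i \<omega>" "\<lambda>i. b i \<omega>" n h x y]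
  show ?thesis by (simp add: st_def hor_def)
qed

lemma xpos_sum: "xpos n \<omega> = (\<Sum>i<hor n \<omega>. a i \<omega>)"
  and ypos_sum: "snd (snd (st n \<omega>)) = (\<Sum>i<n - hor n \<omega>. b i \<omega>)"
proof -
  obtain h x y where s: "st n \<omega> = (h, x, y)" by (cases "st n \<omega>")
  with walk_state_invariant[of p "\<lambda>i. u i \<omega>" "\<lambda>i. a i \<omega>" "\<lambda>i. b i \<omega>" n h x y]
  show "xpos n \<omega> = (\<Sum>i<hor n \<omega>. a i \<omega>)" "snd (snd (st n \<omega>)) = (\<Sum>i<n - hor n \<omega>. b i \<omega>)"
    by (simp_all add: st_def hor_def xpos_def)
qed

lemma abs_xpos_le: "\<bar>xpos n \<omega>\<bar> \<le> int n"
proof -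
  have "\<bar>xpos n \<omega>\<bar> \<le> (\<Sum>i<hor n \<omega>. \<bar>a i \<omega>\<bar>)" unfolding xpos_sum by (rule sum_abs)
  also have "\<dots> = (\<Sum>i<hor n \<omega>. 1)"
  proof (intro sum.cong refl)
    show "\<bar>a i \<omega>\<bar> = 1" for i using a_sign[of i \<omega>] by auto
  qed
  also have "\<dots> \<le> int n" using hor_le[of n \<omega>] by simp
  finally show ?thesis .
qed

lemma path_Suc: "path (Suc n) \<omega> = path n \<omega> @ [st (Suc n) \<omega>]"
  by (simp add: path_def)

lemma last_path: "last (path n \<omega>) = st n \<omega>"
  by (simp add: path_def)

text \<open>The predicate on paths is arbitrary, which lets the induction absorb the last step:
  given the previous state and the new sign, the event becomes another predicate on the shorter
  path, intersected with one clock condition and one sign condition. States are countable, so the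
  union over them is harmless.\<close>

lemma path_event_past: "{\<omega>\<in>space M. P (path n \<omega>) \<and> hor n \<omega> = k} \<in> sets (past (used n k))"
proof (induction n arbitrary: P k)
  case 0
  have "{\<omega>\<in>space M. P (path 0 \<omega>) \<and> hor 0 \<omega> = k} = (if P [(0, 0, 0)] \<and> k = 0 then space (past (used 0 k)) else {})"
    by (auto simp: path_def hor_def st_def)
  then show ?case using sets.top[of "past (used 0 0)"] by simp
next
  case (Suc n)
  let ?S = "past (used (Suc n) k)"
  \<comment> \<open>The predicate for the shorter path: its last state is fixed, and its extension
    by \<open>l'\<close> satisfies \<open>P\<close>.\<close>
  define Q where "Q h x y l l' = (P (l @ [l']) \<and> last l = (h :: nat, x :: int, y :: int))" for h x y l l'
  \<comment> \<open>\<open>H\<close> and \<open>V\<close> are the cases of a horizontal and a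
    vertical last step with sign \<open>s\<close>. The empty branches exclude \<open>k = 0\<close>
    after a horizontal step and \<open>n < k\<close> after a vertical one, where the natural number
    subtractions would be truncated.\<close>
  define H where "H x y s = (if k = 0 then {} else
      {\<omega>\<in>space M. Q (k - 1) x y (path n \<omega>) (k, x + s, y) \<and> hor n \<omega> = k - 1} \<inter>
      {\<omega>\<in>space M. R (0, n) \<omega> \<in> {..<2 * p x}} \<inter> {\<omega>\<in>space M. R (1, k - 1) \<omega> \<in> {real_of_int s}})" for x y s
  define V where "V x y s = (if n < k then {} else
      {\<omega>\<in>space M. Q k x y (path n \<omega>) (k, x, y + s) \<and> hor n \<omega> = k} \<inter>
      {\<omega>\<in>space M. R (0, n) \<omega> \<in> {2 * p x..}} \<inter> {\<omega>\<in>space M. R (2, n - k) \<omega> \<in> {real_of_int s}})" for x y s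
  have "{\<omega>\<in>space M. P (path (Suc n) \<omega>) \<and> hor (Suc n) \<omega> = k}
      = (\<Union>x. \<Union>y. (H x y 1 \<union> H x y (- 1)) \<union> (V x y 1 \<union> V x y (- 1)))" (is "?L = ?U")
  proof (intro set_eqI iffI)
    fix \<omega> assume "\<omega> \<in> ?L"
    then have w: "\<omega> \<in> space M" "P (path n \<omega> @ [st (Suc n) \<omega>])" "hor (Suc n) \<omega> = k" by (auto simp: path_Suc)
    obtain h x y where s: "st n \<omega> = (h, x, y)" by (cases "st n \<omega>")
    have h: "hor n \<omega> = h" "h \<le> n" using s hor_le[of n \<omega>] by (auto simp: hor_def)
    have "\<omega> \<in> (H x y 1 \<union> H x y (- 1)) \<union> (V x y 1 \<union> V x y (- 1))"
    proof (cases "u n \<omega> < 2 * p x")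
      case True
      then have "st (Suc n) \<omega> = (Suc h, x + a h \<omega>, y)" by (simp add: st_Suc s)
      then show ?thesis using w h s True a_sign[of h \<omega>] by (auto simp: H_def Q_def last_path R[simplified] hor_def)
    next
      case False
      then have "st (Suc n) \<omega> = (h, x, y + b (n - h) \<omega>)" by (simp add: st_Suc s)
      then show ?thesis using w h s False b_sign[of "n - h" \<omega>] by (auto simp: V_def Q_def last_path R[simplified] hor_def)
    qed
    then show "\<omega> \<in> ?U" by blast
  next
    fix \<omega> assume "\<omega> \<in> ?U"
    then obtain x y where "\<omega> \<in> H x y 1 \<or> \<omega> \<in> H x y (- 1) \<or> \<omega> \<in> V x y 1 \<or> \<omega> \<in> V x y (- 1)" by blast
    then obtain s where s: "\<omega> \<in> H x y s \<or> \<omega> \<in> V x y s" by blast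
    then show "\<omega> \<in> ?L"
    proof
      assume "\<omega> \<in> H x y s"
      then show ?thesis
        by (auto simp: H_def Q_def last_path path_Suc R[simplified] hor_def st_Suc split: if_splits)
    next
      assume "\<omega> \<in> V x y s"
      then show ?thesis
        by (auto simp: V_def Q_def last_path path_Suc R[simplified] hor_def st_Suc split: if_splits)
    qed
  qed
  also have "\<dots> \<in> sets ?S"
  proof -
    have "H x y s \<in> sets ?S" for x y s
    proof (cases "k = 0")
      case False
      then have sub: "used n (k - 1) \<subseteq> used (Suc n) k" by (auto simp: used_def)
      have "(0, n) \<in> used (Suc n) k" "(1, k - 1) \<in> used (Suc n) k" using False by (auto simp: used_def)
      then show ?thesis unfolding H_def if_not_P[OF False]
        by (intro sets.Int past_R past_mono[OF sub Suc.IH] lessThan_borel borel_singleton sets.empty_sets) 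
    qed (simp add: H_def)
    moreover have "V x y s \<in> sets ?S" for x y s
    proof (cases "n < k")
      case False
      then have sub: "used n k \<subseteq> used (Suc n) k" by (auto simp: used_def)
      have "(0, n) \<in> used (Suc n) k" "(2, n - k) \<in> used (Suc n) k" using False by (auto simp: used_def)
      then show ?thesis unfolding V_def if_not_P[OF False]
        by (intro sets.Int past_R past_mono[OF sub Suc.IH] atLeast_borel borel_singleton sets.empty_sets)
    qed (simp add: V_def)
    ultimately show ?thesis by (intro sets.countable_UN' sets.Un) auto
  qed
  finally show ?case .
qed

lemma path_event_hor: "{\<omega>\<in>space M. P (path n \<omega>) \<and> hor n \<omega> = k} \<in> events"
  using path_event_past past_events by blast

lemma path_event: "{\<omega>\<in>space M. P (path n \<omega>)} \<in> events"
proof -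
  have "{\<omega>\<in>space M. P (path n \<omega>)} = (\<Union>k. {\<omega>\<in>space M. P (path n \<omega>) \<and> hor n \<omega> = k})" by auto
  also have "\<dots> \<in> events"
    by (rule sets.countable_nat_UN) (use path_event_hor in blast)
  finally show ?thesis .
qed

lemma prob_u: "0 \<le> c \<Longrightarrow> c \<le> 1 \<Longrightarrow> prob {\<omega>\<in>space M. R (0, n) \<omega> \<in> {..<c}} = c"
  and prob_u': "0 \<le> c \<Longrightarrow> c \<le> 1 \<Longrightarrow> prob {\<omega>\<in>space M. R (0, n) \<omega> \<in> {c..}} = 1 - c"
proof -
  assume c: "0 \<le> c" "c \<le> 1"
  show 1: "prob {\<omega>\<in>space M. R (0, n) \<omega> \<in> {..<c}} = c" using u[OF c, of n] by (simp add: R)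
  have "{\<omega>\<in>space M. R (0, n) \<omega> \<in> {c..}} = space M - {\<omega>\<in>space M. R (0, n) \<omega> \<in> {..<c}}" by auto
  also have "prob \<dots> = 1 - prob {\<omega>\<in>space M. R (0, n) \<omega> \<in> {..<c}}" by (rule prob_compl) simp
  finally show "prob {\<omega>\<in>space M. R (0, n) \<omega> \<in> {c..}} = 1 - c" using 1 by simp
qed

lemma prob_sign:
  assumes "s = 1 \<or> s = - 1"
  shows "prob {\<omega>\<in>space M. R (1, n) \<omega> \<in> {real_of_int s}} = 1 / 2" "prob {\<omega>\<in>space M. R (2, n) \<omega> \<in> {real_of_int s}} = 1 / 2"
proof -
  have *: "{\<omega>\<in>space M. real_of_int (x \<omega>) \<in> {real_of_int s}} = {\<omega>\<in>space M. x \<omega> = s}" for x :: "'a \<Rightarrow> int" by auto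
  have "prob {\<omega>\<in>space M. a n \<omega> = s} = 1 / 2" "prob {\<omega>\<in>space M. b n \<omega> = s} = 1 / 2"
    using a[of n] b[of n] assms unfolding fair_sign_def by blast+
  then show "prob {\<omega>\<in>space M. R (1, n) \<omega> \<in> {real_of_int s}} = 1 / 2" "prob {\<omega>\<in>space M. R (2, n) \<omega> \<in> {real_of_int s}} = 1 / 2"
    unfolding R * .
qed

lemma used_fresh: "(0, n) \<notin> used n k" "(1, k) \<notin> used n k" "(2, n - k) \<notin> used n k"
  by (auto simp: used_def)

text \<open>Clock entry \<open>n\<close> and sign \<open>k\<close> are fresh, so the factor is
  \<open>2 * p x\<close> times 1/2. The column \<open>x\<close> is a free parameter; the uses choose
  a predicate \<open>P\<close> that forces the walk to be there.\<close>

lemma horizontal_step_prob: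
  assumes s: "s = 1 \<or> s = - 1"
  shows "prob {\<omega>\<in>space M. P (path n \<omega>) \<and> hor n \<omega> = k \<and> u n \<omega> < 2 * p x \<and> a k \<omega> = s}
    = prob {\<omega>\<in>space M. P (path n \<omega>) \<and> hor n \<omega> = k} * p x"
proof -
  have eq: "{\<omega>\<in>space M. P (path n \<omega>) \<and> hor n \<omega> = k \<and> u n \<omega> < 2 * p x \<and> a k \<omega> = s}
    = {\<omega>\<in>space M. P (path n \<omega>) \<and> hor n \<omega> = k} \<inter> {\<omega>\<in>space M. R (0, n) \<omega> \<in> {..<2 * p x}} \<inter> {\<omega>\<in>space M. R (1, k) \<omega> \<in> {real_of_int s}}"
    unfolding R by auto
  have "prob ({\<omega>\<in>space M. P (path n \<omega>) \<and> hor n \<omega> = k} \<inter> {\<omega>\<in>space M. R (0, n) \<omega> \<in> {..<2 * p x}} \<inter> {\<omega>\<in>space M. R (1, k) \<omega> \<in> {real_of_int s}})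
    = prob {\<omega>\<in>space M. P (path n \<omega>) \<and> hor n \<omega> = k} * prob {\<omega>\<in>space M. R (0, n) \<omega> \<in> {..<2 * p x}} * prob {\<omega>\<in>space M. R (1, k) \<omega> \<in> {real_of_int s}}"
    by (rule past_fresh[OF path_event_past[of P n k] used_fresh(1) used_fresh(2)]) simp_all
  also have "\<dots> = prob {\<omega>\<in>space M. P (path n \<omega>) \<and> hor n \<omega> = k} * (2 * p x) * (1 / 2)"
  proof -
    have "prob {\<omega>\<in>space M. R (0, n) \<omega> \<in> {..<2 * p x}} = 2 * p x"
      by (rule prob_u) (use p(1)[of x] p(2)[of x] in linarith)+
    then show ?thesis unfolding prob_sign(1)[OF s] by (simp only:)
  qed
  finally show ?thesis unfolding eq by (simp add: algebra_simps)
qed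

lemma vertical_step_prob:
  assumes s: "s = 1 \<or> s = - 1"
  shows "prob {\<omega>\<in>space M. P (path n \<omega>) \<and> hor n \<omega> = k \<and> \<not> u n \<omega> < 2 * p x \<and> b (n - k) \<omega> = s}
    = prob {\<omega>\<in>space M. P (path n \<omega>) \<and> hor n \<omega> = k} * (1 / 2 - p x)"
proof -
  have eq: "{\<omega>\<in>space M. P (path n \<omega>) \<and> hor n \<omega> = k \<and> \<not> u n \<omega> < 2 * p x \<and> b (n - k) \<omega> = s}
    = {\<omega>\<in>space M. P (path n \<omega>) \<and> hor n \<omega> = k} \<inter> {\<omega>\<in>space M. R (0, n) \<omega> \<in> {2 * p x..}} \<inter> {\<omega>\<in>space M. R (2, n - k) \<omega> \<in> {real_of_int s}}"
    unfolding R by auto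
  have "prob ({\<omega>\<in>space M. P (path n \<omega>) \<and> hor n \<omega> = k} \<inter> {\<omega>\<in>space M. R (0, n) \<omega> \<in> {2 * p x..}} \<inter> {\<omega>\<in>space M. R (2, n - k) \<omega> \<in> {real_of_int s}})
    = prob {\<omega>\<in>space M. P (path n \<omega>) \<and> hor n \<omega> = k} * prob {\<omega>\<in>space M. R (0, n) \<omega> \<in> {2 * p x..}} * prob {\<omega>\<in>space M. R (2, n - k) \<omega> \<in> {real_of_int s}}"
    by (rule past_fresh[OF path_event_past[of P n k] used_fresh(1) used_fresh(3)]) simp_all
  also have "\<dots> = prob {\<omega>\<in>space M. P (path n \<omega>) \<and> hor n \<omega> = k} * (1 - 2 * p x) * (1 / 2)"
  proof -
    have "prob {\<omega>\<in>space M. R (0, n) \<omega> \<in> {2 * p x..}} = 1 - 2 * p x"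
      by (rule prob_u') (use p(1)[of x] p(2)[of x] in linarith)+
    then show ?thesis unfolding prob_sign(2)[OF s] by (simp only:)
  qed
  finally show ?thesis unfolding eq by (simp add: algebra_simps)
qed

lemma prob_split_hor:
  "prob {\<omega>\<in>space M. P (path n \<omega>)} = (\<Sum>k\<le>n. prob {\<omega>\<in>space M. P (path n \<omega>) \<and> hor n \<omega> = k})"
proof -
  have "{\<omega>\<in>space M. P (path n \<omega>)} = (\<Union>k\<in>{..n}. {\<omega>\<in>space M. P (path n \<omega>) \<and> hor n \<omega> = k})"
    using hor_le by auto
  also have "prob \<dots> = (\<Sum>k\<le>n. prob {\<omega>\<in>space M. P (path n \<omega>) \<and> hor n \<omega> = k})"
    by (rule finite_measure_finite_Union) (auto simp: disjoint_family_on_def intro: path_event_hor)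
  finally show ?thesis .
qed

lemma anisotropic_walk: "anisotropic_walk p (\<lambda>n \<omega>. snd (st n \<omega>))"
  unfolding anisotropic_walk_def
proof (intro conjI allI impI)
  show "random_variable (count_space UNIV) (\<lambda>\<omega>. snd (st n \<omega>))" for n
  proof (subst measurable_count_space_eq2_countable, intro conjI allI ballI)
    fix z :: "int \<times> int"
    have "(\<lambda>\<omega>. snd (st n \<omega>)) -` {z} \<inter> space M = {\<omega>\<in>space M. snd (last (path n \<omega>)) = z}" by (auto simp: last_path)
    then show "(\<lambda>\<omega>. snd (st n \<omega>)) -` {z} \<inter> space M \<in> events" using path_event[of "\<lambda>l. snd (last l) = z"] by simp
  qed auto
  show "AE \<omega> in M. snd (st 0 \<omega>) = (0, 0)" by (simp add: st_def)
  fix n and h :: "nat \<Rightarrow> int \<times> int" and z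
  assume pos: "0 < \<P>(\<omega> in M. \<forall>i\<le>n. snd (st i \<omega>) = h i)"
  define P where "P l = (\<forall>i\<le>n. snd (l ! i) = h i)" for l :: "(nat \<times> int \<times> int) list"
  have Ppath: "P (path n \<omega>) \<longleftrightarrow> (\<forall>i\<le>n. snd (st i \<omega>) = h i)" for \<omega>
    unfolding P_def path_def by (auto simp: nth_append less_Suc_eq_le simp del: upt_Suc)
  obtain x y where hn: "h n = (x, y)" by (cases "h n")
  define E where "E = {\<omega>\<in>space M. P (path n \<omega>)}"
  have "prob {\<omega>\<in>space M. P (path n \<omega>) \<and> snd (st (Suc n) \<omega>) = z} = prob E * step_prob p (h n) z"
  proof -
    \<comment> \<open>A history of positions is split by the number \<open>k\<close> of horizontal
      steps; each piece has a fixed supply of fresh noise and the same transition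
      probability.\<close>
    have summand: "prob {\<omega>\<in>space M. P (path n \<omega>) \<and> snd (st (Suc n) \<omega>) = z \<and> hor n \<omega> = k}
        = prob {\<omega>\<in>space M. P (path n \<omega>) \<and> hor n \<omega> = k} * step_prob p (h n) z" if "k \<le> n" for k
    proof -
      have next_state: "snd (st (Suc n) \<omega>) = (if u n \<omega> < 2 * p x then (x + a k \<omega>, y) else (x, y + b (n - k) \<omega>))"
        if w: "P (path n \<omega>)" "hor n \<omega> = k" for \<omega>
      proof -
        have "st n \<omega> = (k, x, y)" using w hn by (auto simp: Ppath hor_def prod_eq_iff)
        then show ?thesis by (simp add: st_Suc)
      qed
      have step: "step_prob p (h n) z = (if z = (x + 1, y) \<or> z = (x - 1, y) then p x
          else if z = (x, y + 1) \<or> z = (x, y - 1) then 1 / 2 - p x else 0)"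
        by (simp add: step_prob_def hn)
      consider (horizontal) s where "s = 1 \<or> s = - 1" "z = (x + s, y)" | (vertical) s where "s = 1 \<or> s = - 1" "z = (x, y + s)"
        | (other) "z \<noteq> (x + 1, y)" "z \<noteq> (x - 1, y)" "z \<noteq> (x, y + 1)" "z \<noteq> (x, y - 1)"
        by (metis add_uminus_conv_diff)
      then show ?thesis
      proof cases
        case horizontal
        have "{\<omega>\<in>space M. P (path n \<omega>) \<and> snd (st (Suc n) \<omega>) = z \<and> hor n \<omega> = k}
            = {\<omega>\<in>space M. P (path n \<omega>) \<and> hor n \<omega> = k \<and> u n \<omega> < 2 * p x \<and> a k \<omega> = s}"
          using horizontal by (auto simp: next_state split: if_splits)
        moreover have "step_prob p (h n) z = p x" using horizontal unfolding step by auto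
        ultimately show ?thesis using horizontal_step_prob[OF horizontal(1)] by simp
      next
        case vertical
        have bn: "b (n - k) \<omega> \<noteq> 0" for \<omega> using b_sign[of "n - k" \<omega>] by auto
        have "{\<omega>\<in>space M. P (path n \<omega>) \<and> snd (st (Suc n) \<omega>) = z \<and> hor n \<omega> = k}
            = {\<omega>\<in>space M. P (path n \<omega>) \<and> hor n \<omega> = k \<and> \<not> u n \<omega> < 2 * p x \<and> b (n - k) \<omega> = s}"
          using vertical bn by (auto simp: next_state split: if_splits)
        moreover have "step_prob p (h n) z = 1 / 2 - p x" using vertical unfolding step by auto
        ultimately show ?thesis using vertical_step_prob[OF vertical(1)] by simp
      next
        case other
        have "snd (st (Suc n) \<omega>) \<noteq> z" if w: "P (path n \<omega>)" "hor n \<omega> = k" for \<omega>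
          using next_state[OF w] other a_sign[of k \<omega>] b_sign[of "n - k" \<omega>] by (auto split: if_splits)
        then have "{\<omega>\<in>space M. P (path n \<omega>) \<and> snd (st (Suc n) \<omega>) = z \<and> hor n \<omega> = k} = {}" by blast
        then show ?thesis using other unfolding step by (simp only: measure_empty) simp
      qed
    qed
    have eqU: "{\<omega>\<in>space M. P (path n \<omega>) \<and> snd (st (Suc n) \<omega>) = z}
        = (\<Union>k\<in>{..n}. {\<omega>\<in>space M. P (path n \<omega>) \<and> snd (st (Suc n) \<omega>) = z \<and> hor n \<omega> = k})"
      using hor_le by auto
    have "prob {\<omega>\<in>space M. P (path n \<omega>) \<and> snd (st (Suc n) \<omega>) = z}
        = (\<Sum>k\<le>n. prob {\<omega>\<in>space M. P (path n \<omega>) \<and> snd (st (Suc n) \<omega>) = z \<and> hor n \<omega> = k})"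
      unfolding eqU
    proof (rule finite_measure_finite_Union)
      show "(\<lambda>k. {\<omega>\<in>space M. P (path n \<omega>) \<and> snd (st (Suc n) \<omega>) = z \<and> hor n \<omega> = k}) ` {..n} \<subseteq> events"
      proof safe
        fix k
        have "{\<omega>\<in>space M. P (path n \<omega>) \<and> snd (st (Suc n) \<omega>) = z \<and> hor n \<omega> = k}
            = {\<omega>\<in>space M. (\<lambda>l. P (butlast l) \<and> snd (last l) = z \<and> fst (last (butlast l)) = k) (path (Suc n) \<omega>)}"
          by (simp add: path_Suc last_path hor_def)
        then show "{\<omega>\<in>space M. P (path n \<omega>) \<and> snd (st (Suc n) \<omega>) = z \<and> hor n \<omega> = k} \<in> events"
          by (simp only:) (rule path_event)
      qed
    qed (auto simp: disjoint_family_on_def)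
    also have "\<dots> = (\<Sum>k\<le>n. prob {\<omega>\<in>space M. P (path n \<omega>) \<and> hor n \<omega> = k} * step_prob p (h n) z)"
      by (intro sum.cong refl summand) simp
    also have "\<dots> = prob E * step_prob p (h n) z"
      unfolding E_def by (simp only: prob_split_hor[of P n] sum_distrib_right)
    finally show ?thesis .
  qed
  moreover have "0 < prob E" using pos by (simp add: E_def Ppath)
  ultimately show "\<P>(\<omega> in M. snd (st (Suc n) \<omega>) = z \<bar> \<forall>i\<le>n. snd (st i \<omega>) = h i) = step_prob p (h n) z"
    unfolding cond_prob_def E_def Ppath by (simp add: conj_commute)
qed

end

section \<open>Moments of the walk and the number of horizontal steps\<close>

context walk_noise
begin

text \<open>A finite set containing all values of the pair of \<open>hor n\<close> and
  \<open>xpos n\<close>. Every function of the pair is therefore integrable, and its expectation is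
  a finite sum.\<close>

definition box :: "nat \<Rightarrow> (nat \<times> int) set" where
  "box n = {..n} \<times> {- int n..int n}"

definition occ :: "nat \<Rightarrow> nat \<times> int \<Rightarrow> 'a set" where
  "occ n w = {\<omega>\<in>space M. xpos n \<omega> = snd w \<and> hor n \<omega> = fst w}"

lemma finite_box [simp]: "finite (box n)"
  by (simp add: box_def)

lemma in_box: "(hor n \<omega>, xpos n \<omega>) \<in> box n"
  using hor_le[of n \<omega>] abs_xpos_le[of n \<omega>] by (auto simp: box_def)

lemma occ_eq: "occ n (k, x) = {\<omega>\<in>space M. (\<lambda>l. fst (snd (last l)) = x) (path n \<omega>) \<and> hor n \<omega> = k}"
  by (simp add: occ_def last_path xpos_def)

lemma occ_events [measurable]: "occ n w \<in> events"
proof (cases w)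
  case (Pair k x)
  show ?thesis unfolding Pair occ_eq by (rule path_event_hor)
qed

lemma hor_xpos_expand:
  assumes "\<omega> \<in> space M"
  shows "F (hor n \<omega>) (xpos n \<omega>) = (\<Sum>w\<in>box n. F (fst w) (snd w) * indicator (occ n w) \<omega> :: real)"
proof -
  have "(\<Sum>w\<in>box n. F (fst w) (snd w) * indicator (occ n w) \<omega>)
      = (\<Sum>w\<in>box n. if w = (hor n \<omega>, xpos n \<omega>) then F (fst w) (snd w) else 0)"
    using assms by (intro sum.cong) (auto simp: occ_def indicator_def)
  also have "\<dots> = F (hor n \<omega>) (xpos n \<omega>)" using in_box by simp
  finally show ?thesis by simp
qed

lemma hor_xpos_expectation:
  shows "integrable M (\<lambda>\<omega>. F (hor n \<omega>) (xpos n \<omega>) :: real)"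
    and "expectation (\<lambda>\<omega>. F (hor n \<omega>) (xpos n \<omega>)) = (\<Sum>w\<in>box n. F (fst w) (snd w) * prob (occ n w))"
proof -
  have int: "integrable M (\<lambda>\<omega>. \<Sum>w\<in>box n. F (fst w) (snd w) * indicator (occ n w) \<omega>)"
    by (intro Bochner_Integration.integrable_sum integrable_mult_right) (auto simp: emeasure_eq_measure)
  show "integrable M (\<lambda>\<omega>. F (hor n \<omega>) (xpos n \<omega>))"
    using int by (subst Bochner_Integration.integrable_cong[OF refl hor_xpos_expand])
  have "expectation (\<lambda>\<omega>. F (hor n \<omega>) (xpos n \<omega>)) = expectation (\<lambda>\<omega>. \<Sum>w\<in>box n. F (fst w) (snd w) * indicator (occ n w) \<omega>)"
    by (intro Bochner_Integration.integral_cong refl) (rule hor_xpos_expand)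
  also have "\<dots> = (\<Sum>w\<in>box n. F (fst w) (snd w) * prob (occ n w))"
    by (subst Bochner_Integration.integral_sum) (auto simp: emeasure_eq_measure)
  finally show "expectation (\<lambda>\<omega>. F (hor n \<omega>) (xpos n \<omega>)) = (\<Sum>w\<in>box n. F (fst w) (snd w) * prob (occ n w))" .
qed

text \<open>The Markov property in integrated form; the moment estimates below use the law of the
  walk only through it. A vertical step changes neither \<open>hor\<close> nor \<open>xpos\<close>,
  hence the weight \<open>1 - 2 * p\<close>.\<close>

lemma one_step_expectation:
  "expectation (\<lambda>\<omega>. F (hor (Suc n) \<omega>) (xpos (Suc n) \<omega>) :: real)
    = expectation (\<lambda>\<omega>. p (xpos n \<omega>) * (F (Suc (hor n \<omega>)) (xpos n \<omega> + 1) + F (Suc (hor n \<omega>)) (xpos n \<omega> - 1))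
        + (1 - 2 * p (xpos n \<omega>)) * F (hor n \<omega>) (xpos n \<omega>))"
proof -
  \<comment> \<open>The column is read off the last state of the path so that
    \<open>horizontal_step_prob\<close> and \<open>vertical_step_prob\<close> apply as they
    stand.\<close>
  define Hs where "Hs s w = {\<omega>\<in>space M. (\<lambda>l. fst (snd (last l)) = snd w) (path n \<omega>) \<and> hor n \<omega> = fst w \<and> u n \<omega> < 2 * p (snd w) \<and> a (fst w) \<omega> = s}" for s w
  define Vs where "Vs s w = {\<omega>\<in>space M. (\<lambda>l. fst (snd (last l)) = snd w) (path n \<omega>) \<and> hor n \<omega> = fst w \<and> \<not> u n \<omega> < 2 * p (snd w) \<and> b (n - fst w) \<omega> = s}" for s w
  have um [measurable]: "random_variable borel (u n)" using R_measurable[of "(0, n)"] by (simp add: R[abs_def])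
  have am [measurable]: "random_variable (count_space UNIV) (a i)" "random_variable (count_space UNIV) (b i)" for i
    using a[of i] b[of i] by (auto simp: fair_sign_def)
  have atm: "{\<omega>\<in>space M. (\<lambda>l. fst (snd (last l)) = snd w) (path n \<omega>) \<and> hor n \<omega> = fst w} = occ n w" for w
    by (simp add: occ_def last_path xpos_def)
  have HV: "Hs s w = occ n w \<inter> {\<omega>\<in>space M. u n \<omega> < 2 * p (snd w)} \<inter> {\<omega>\<in>space M. a (fst w) \<omega> = s}"
    "Vs s w = occ n w \<inter> {\<omega>\<in>space M. \<not> u n \<omega> < 2 * p (snd w)} \<inter> {\<omega>\<in>space M. b (n - fst w) \<omega> = s}" for s w
    unfolding atm[symmetric] Hs_def Vs_def by auto
  have HVm: "Hs s w \<in> events" "Vs s w \<in> events" for s w unfolding HV by measurable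
  have pH: "prob (Hs 1 w) = prob (occ n w) * p (snd w)" "prob (Hs (- 1) w) = prob (occ n w) * p (snd w)" for w
    unfolding Hs_def by (subst horizontal_step_prob; simp add: atm)+
  have pV: "prob (Vs 1 w) = prob (occ n w) * (1 / 2 - p (snd w))" "prob (Vs (- 1) w) = prob (occ n w) * (1 / 2 - p (snd w))" for w
    unfolding Vs_def by (subst vertical_step_prob; simp add: atm)+
  let ?T = "\<lambda>w \<omega>. F (Suc (fst w)) (snd w + 1) * indicator (Hs 1 w) \<omega> + F (Suc (fst w)) (snd w - 1) * indicator (Hs (- 1) w) \<omega>
      + F (fst w) (snd w) * indicator (Vs 1 w) \<omega> + F (fst w) (snd w) * indicator (Vs (- 1) w) \<omega> :: real"
  have expand: "F (hor (Suc n) \<omega>) (xpos (Suc n) \<omega>) = (\<Sum>w\<in>box n. ?T w \<omega>)" if w: "\<omega> \<in> space M" for \<omega>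
  proof -
    obtain h x y where s: "st n \<omega> = (h, x, y)" by (cases "st n \<omega>")
    have hx: "hor n \<omega> = h" "xpos n \<omega> = x" using s by (auto simp: hor_def xpos_def)
    have zero: "?T w \<omega> = 0" if "w \<noteq> (h, x)" for w
    proof -
      have "\<omega> \<notin> occ n w" using that hx by (auto simp: occ_def prod_eq_iff)
      then show ?thesis by (simp add: HV)
    qed
    have one: "?T (h, x) \<omega> = F (hor (Suc n) \<omega>) (xpos (Suc n) \<omega>)"
    proof -
      have aw: "\<omega> \<in> occ n (h, x)" using w hx by (simp add: occ_def)
      have S: "st (Suc n) \<omega> = (if u n \<omega> < 2 * p x then (Suc h, x + a h \<omega>, y) else (h, x, y + b (n - h) \<omega>))"
        by (simp add: st_Suc s)
      show ?thesis
        using aw w a_sign[of h \<omega>] b_sign[of "n - h" \<omega>]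
        by (cases "u n \<omega> < 2 * p x") (auto simp: HV hor_def xpos_def S indicator_def)
    qed
    have "(\<Sum>w\<in>box n. ?T w \<omega>) = (\<Sum>w\<in>box n. if w = (h, x) then ?T (h, x) \<omega> else 0)"
    proof (rule sum.cong[OF refl])
      fix w
      show "?T w \<omega> = (if w = (h, x) then ?T (h, x) \<omega> else 0)"
        using zero[of w] by (cases "w = (h, x)") (simp_all only: if_True if_False refl simp_thms)
    qed
    also have "\<dots> = ?T (h, x) \<omega>" using in_box[of n \<omega>] hx by simp
    finally show ?thesis using one by (simp only:)
  qed
  have iT: "integrable M (?T w)" for w
    using HVm by (intro Bochner_Integration.integrable_add integrable_mult_right) (auto simp: emeasure_eq_measure)
  have eT: "expectation (?T w) = (p (snd w) * (F (Suc (fst w)) (snd w + 1) + F (Suc (fst w)) (snd w - 1)) + (1 - 2 * p (snd w)) * F (fst w) (snd w)) * prob (occ n w)" for w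
  proof -
    have "expectation (?T w) = F (Suc (fst w)) (snd w + 1) * prob (Hs 1 w) + F (Suc (fst w)) (snd w - 1) * prob (Hs (- 1) w)
      + F (fst w) (snd w) * prob (Vs 1 w) + F (fst w) (snd w) * prob (Vs (- 1) w)"
      using HVm by (simp add: emeasure_eq_measure)
    then show ?thesis unfolding pH pV by (simp add: algebra_simps)
  qed
  have "expectation (\<lambda>\<omega>. F (hor (Suc n) \<omega>) (xpos (Suc n) \<omega>)) = expectation (\<lambda>\<omega>. \<Sum>w\<in>box n. ?T w \<omega>)"
    by (intro Bochner_Integration.integral_cong refl) (rule expand)
  also have "\<dots> = (\<Sum>w\<in>box n. expectation (?T w))"
    by (rule Bochner_Integration.integral_sum) (rule iT)
  also have "\<dots> = expectation (\<lambda>\<omega>. p (xpos n \<omega>) * (F (Suc (hor n \<omega>)) (xpos n \<omega> + 1) + F (Suc (hor n \<omega>)) (xpos n \<omega> - 1))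
        + (1 - 2 * p (xpos n \<omega>)) * F (hor n \<omega>) (xpos n \<omega>))"
    unfolding eT using hor_xpos_expectation(2)[of "\<lambda>h x. p x * (F (Suc h) (x + 1) + F (Suc h) (x - 1)) + (1 - 2 * p x) * F h x" n]
    by simp
  finally show ?thesis .
qed

lemma hor_0 [simp]: "hor 0 \<omega> = 0" and xpos_0 [simp]: "xpos 0 \<omega> = 0"
  by (simp_all add: hor_def xpos_def st_def)

lemma int_hx [simp]: "integrable M (\<lambda>\<omega>. f (xpos n \<omega>) :: real)"
  using hor_xpos_expectation(1)[of "\<lambda>_ x. f x"] by simp

lemma xpos_second_moment: "expectation (\<lambda>\<omega>. (real_of_int (xpos n \<omega>))\<^sup>2) \<le> real n"
proof (induction n)
  case (Suc n)
  have "expectation (\<lambda>\<omega>. (real_of_int (xpos (Suc n) \<omega>))\<^sup>2)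
      \<le> expectation (\<lambda>\<omega>. (real_of_int (xpos n \<omega>))\<^sup>2 + 1)"
    unfolding one_step_expectation[of "\<lambda>_ x. (real_of_int x)\<^sup>2"]
  proof (rule integral_mono)
    fix \<omega>
    have "p x * ((real_of_int (x + 1))\<^sup>2 + (real_of_int (x - 1))\<^sup>2) + (1 - 2 * p x) * (real_of_int x)\<^sup>2 = (real_of_int x)\<^sup>2 + 2 * p x" for x
      by (simp add: power2_eq_square algebra_simps)
    then show "p (xpos n \<omega>) * ((real_of_int (xpos n \<omega> + 1))\<^sup>2 + (real_of_int (xpos n \<omega> - 1))\<^sup>2) + (1 - 2 * p (xpos n \<omega>)) * (real_of_int (xpos n \<omega>))\<^sup>2
        \<le> (real_of_int (xpos n \<omega>))\<^sup>2 + 1"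
      using p(2)[of "xpos n \<omega>"] by simp
  qed (use int_hx[of "\<lambda>x. p x * ((real_of_int (x + 1))\<^sup>2 + (real_of_int (x - 1))\<^sup>2) + (1 - 2 * p x) * (real_of_int x)\<^sup>2" n] int_hx[of "\<lambda>x. (real_of_int x)\<^sup>2 + 1" n] in simp_all)
  also have "\<dots> = expectation (\<lambda>\<omega>. (real_of_int (xpos n \<omega>))\<^sup>2) + 1"
    using int_hx[of "\<lambda>x. (real_of_int x)\<^sup>2" n] by (simp add: prob_space)
  finally show ?case using Suc by simp
qed simp

lemma xpos_fourth_moment: "expectation (\<lambda>\<omega>. (real_of_int (xpos n \<omega>)) ^ 4) \<le> 3 * (real n)\<^sup>2"
proof (induction n)
  case (Suc n)
  have "expectation (\<lambda>\<omega>. (real_of_int (xpos (Suc n) \<omega>)) ^ 4)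
      \<le> expectation (\<lambda>\<omega>. (real_of_int (xpos n \<omega>)) ^ 4 + (6 * (real_of_int (xpos n \<omega>))\<^sup>2 + 1))"
    unfolding one_step_expectation[of "\<lambda>_ x. (real_of_int x) ^ 4"]
  proof (rule integral_mono)
    fix \<omega>
    \<comment> \<open>The second difference of the fourth power is
      \<open>12 * x\<^sup>2 + 2\<close>. With the linear bound on the second moment the increments
      sum to order \<open>n\<^sup>2\<close>.\<close>
    have eq: "p x * ((real_of_int (x + 1)) ^ 4 + (real_of_int (x - 1)) ^ 4) + (1 - 2 * p x) * (real_of_int x) ^ 4
        = (real_of_int x) ^ 4 + 2 * p x * (6 * (real_of_int x)\<^sup>2 + 1)" for x
      by (simp add: power2_eq_square power4_eq_xxxx algebra_simps)
    have "2 * p (xpos n \<omega>) * (6 * (real_of_int (xpos n \<omega>))\<^sup>2 + 1) \<le> 1 * (6 * (real_of_int (xpos n \<omega>))\<^sup>2 + 1)"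
      using p(2)[of "xpos n \<omega>"] by (intro mult_right_mono) auto
    then show "p (xpos n \<omega>) * ((real_of_int (xpos n \<omega> + 1)) ^ 4 + (real_of_int (xpos n \<omega> - 1)) ^ 4) + (1 - 2 * p (xpos n \<omega>)) * (real_of_int (xpos n \<omega>)) ^ 4
        \<le> (real_of_int (xpos n \<omega>)) ^ 4 + (6 * (real_of_int (xpos n \<omega>))\<^sup>2 + 1)"
      unfolding eq by simp
  qed (use int_hx[of "\<lambda>x. p x * ((real_of_int (x + 1)) ^ 4 + (real_of_int (x - 1)) ^ 4) + (1 - 2 * p x) * (real_of_int x) ^ 4" n]
      int_hx[of "\<lambda>x. (real_of_int x) ^ 4 + (6 * (real_of_int x)\<^sup>2 + 1)" n] in simp_all)
  also have "\<dots> = expectation (\<lambda>\<omega>. (real_of_int (xpos n \<omega>)) ^ 4) + (6 * expectation (\<lambda>\<omega>. (real_of_int (xpos n \<omega>))\<^sup>2) + 1)"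
    using int_hx[of "\<lambda>x. (real_of_int x) ^ 4" n] int_hx[of "\<lambda>x. (real_of_int x)\<^sup>2" n] by (simp add: prob_space)
  also have "\<dots> \<le> 3 * (real n)\<^sup>2 + (6 * real n + 1)"
    using Suc xpos_second_moment[of n] by simp
  also have "\<dots> \<le> 3 * (real (Suc n))\<^sup>2" by (simp add: power2_eq_square algebra_simps)
  finally show ?case .
qed simp

text \<open>AM-GM with the weight \<open>r\<close> replaces Cauchy-Schwarz; \<open>n + 1\<close>
  keeps \<open>r\<close> positive at \<open>n = 0\<close>.\<close>

lemma xpos_abs_moment: "expectation (\<lambda>\<omega>. \<bar>real_of_int (xpos n \<omega>)\<bar>) \<le> sqrt (real n + 1)"
proof -
  define r where "r = sqrt (real n + 1)"
  have r: "0 < r" "r * r = real n + 1" by (simp_all add: r_def)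
  have "expectation (\<lambda>\<omega>. \<bar>real_of_int (xpos n \<omega>)\<bar>) \<le> expectation (\<lambda>\<omega>. (real_of_int (xpos n \<omega>))\<^sup>2 / (2 * r) + r / 2)"
  proof (rule integral_mono)
    fix \<omega>
    define v where "v = \<bar>real_of_int (xpos n \<omega>)\<bar>"
    have "0 \<le> (v - r)\<^sup>2 / (2 * r)" using r by simp
    also have "\<dots> = v\<^sup>2 / (2 * r) + r / 2 - v"
      using r(1) by (simp add: power2_eq_square field_simps)
    finally have "v \<le> v\<^sup>2 / (2 * r) + r / 2" by simp
    then show "\<bar>real_of_int (xpos n \<omega>)\<bar> \<le> (real_of_int (xpos n \<omega>))\<^sup>2 / (2 * r) + r / 2"
      by (simp add: v_def)
  qed (use int_hx[of "\<lambda>x. \<bar>real_of_int x\<bar>" n] int_hx[of "\<lambda>x. (real_of_int x)\<^sup>2 / (2 * r) + r / 2" n] in simp_all)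
  also have "\<dots> = expectation (\<lambda>\<omega>. (real_of_int (xpos n \<omega>))\<^sup>2) / (2 * r) + r / 2"
    using int_hx[of "\<lambda>x. (real_of_int x)\<^sup>2" n] by (simp add: prob_space)
  also have "\<dots> \<le> (r * r) / (2 * r) + r / 2"
    using xpos_second_moment[of n] r by (intro add_right_mono divide_right_mono) auto
  also have "\<dots> = r" using r(1) by simp
  finally show ?thesis by (simp add: r_def)
qed

lemma xpos_third_moment: "expectation (\<lambda>\<omega>. \<bar>real_of_int (xpos n \<omega>)\<bar> ^ 3) \<le> 2 * (real n * sqrt (real n))"
proof (cases "n = 0")
  case False
  define r where "r = sqrt (real n)"
  have r: "0 < r" "r * r = real n" using False by (simp_all add: r_def)
  have "expectation (\<lambda>\<omega>. \<bar>real_of_int (xpos n \<omega>)\<bar> ^ 3) \<le> expectation (\<lambda>\<omega>. (real_of_int (xpos n \<omega>)) ^ 4 / (2 * r) + r / 2 * (real_of_int (xpos n \<omega>))\<^sup>2)"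
  proof (rule integral_mono)
    fix \<omega>
    define v where "v = \<bar>real_of_int (xpos n \<omega>)\<bar>"
    have "0 \<le> v\<^sup>2 * ((v - r)\<^sup>2 / (2 * r))" using r by simp
    also have "\<dots> = v ^ 4 / (2 * r) + r / 2 * v\<^sup>2 - v ^ 3"
      using r(1) by (simp add: power2_diff power2_eq_square power3_eq_cube power4_eq_xxxx field_simps)
    finally have "v ^ 3 \<le> v ^ 4 / (2 * r) + r / 2 * v\<^sup>2" by simp
    then show "\<bar>real_of_int (xpos n \<omega>)\<bar> ^ 3 \<le> (real_of_int (xpos n \<omega>)) ^ 4 / (2 * r) + r / 2 * (real_of_int (xpos n \<omega>))\<^sup>2"
      by (simp add: v_def power_even_abs)
  qed (use int_hx[of "\<lambda>x. \<bar>real_of_int x\<bar> ^ 3" n] int_hx[of "\<lambda>x. (real_of_int x) ^ 4 / (2 * r) + r / 2 * (real_of_int x)\<^sup>2" n] in simp_all)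
  also have "\<dots> = expectation (\<lambda>\<omega>. (real_of_int (xpos n \<omega>)) ^ 4) / (2 * r) + r / 2 * expectation (\<lambda>\<omega>. (real_of_int (xpos n \<omega>))\<^sup>2)"
    using int_hx[of "\<lambda>x. (real_of_int x) ^ 4" n] int_hx[of "\<lambda>x. (real_of_int x)\<^sup>2" n] by (simp add: prob_space)
  also have "\<dots> \<le> 3 * (real n)\<^sup>2 / (2 * r) + r / 2 * real n"
    using xpos_second_moment[of n] xpos_fourth_moment[of n] r by (intro add_mono divide_right_mono mult_left_mono) auto
  also have "\<dots> = 2 * (real n * r)"
    using r(1) by (simp add: r(2)[symmetric] power2_eq_square field_simps)
  finally show ?thesis by (simp add: r_def)
qed simp

text \<open>\<open>lap\<close> makes \<open>Q\<close> a martingale along the walk, so its second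
  moment is the sum of the squared increments. These are of order \<open>1 + \<bar>x\<bar>\<close>
  by \<open>grad\<close>, with mean of order \<open>sqrt n\<close>, which gives order
  \<open>n * sqrt n\<close>. The correction \<open>f\<close> evaluated at \<open>xpos\<close> has
  squares of cubic growth, and the third moment is of the same order, so neither term
  dominates.\<close>

lemma horizontal_time_variance:
  assumes \<theta>: "0 \<le> \<theta>" "\<theta> \<le> 1" and C: "0 \<le> C"
    and lap: "\<And>j. p j * (f (j + 1) + f (j - 1) - 2 * f j) = 2 * p j - \<theta>"
    and f0: "f 0 = (0::real)" and grad: "\<And>j. (f (j + 1) - f j)\<^sup>2 \<le> C * (1 + \<bar>real_of_int j\<bar>)"
    and growth: "\<And>j. (f j)\<^sup>2 \<le> C * ((real_of_int j)\<^sup>2 * (1 + \<bar>real_of_int j\<bar>))"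
  shows "integrable M (\<lambda>\<omega>. (real (hor n \<omega>) - \<theta> * real n)\<^sup>2)"
    and "expectation (\<lambda>\<omega>. (real (hor n \<omega>) - \<theta> * real n)\<^sup>2) \<le> (12 + 16 * C) * (real n * sqrt (real n))"
proof -
  define Q where "Q n h x = real h - \<theta> * real n - f x" for n h x
  have intQ: "integrable M (\<lambda>\<omega>. (Q m (hor n \<omega>) (xpos n \<omega>))\<^sup>2)" for m n
    by (rule hor_xpos_expectation(1)[of "\<lambda>h x. (Q m h x)\<^sup>2"])
  have step: "expectation (\<lambda>\<omega>. (Q (Suc n) (hor (Suc n) \<omega>) (xpos (Suc n) \<omega>))\<^sup>2)
      \<le> expectation (\<lambda>\<omega>. (Q n (hor n \<omega>) (xpos n \<omega>))\<^sup>2) + (3 + 3 * C + 2 * C * sqrt (real n + 1))" for n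
  proof -
    have "expectation (\<lambda>\<omega>. (Q (Suc n) (hor (Suc n) \<omega>) (xpos (Suc n) \<omega>))\<^sup>2)
      \<le> expectation (\<lambda>\<omega>. (Q n (hor n \<omega>) (xpos n \<omega>))\<^sup>2 + (3 + 3 * C + 2 * C * \<bar>real_of_int (xpos n \<omega>)\<bar>))"
      unfolding one_step_expectation[of "\<lambda>h x. (Q (Suc n) h x)\<^sup>2"]
    proof (rule integral_mono)
      fix \<omega>
      define h x where "h = hor n \<omega>" and "x = xpos n \<omega>"
      define q where "q = Q n h x"
      define v where "v = p x"
      \<comment> \<open>The increments of \<open>Q\<close> in a step to the right and to the left; a
        vertical step changes \<open>Q\<close> by \<open>- \<theta>\<close>. \<open>drift\<close>
        says that the weighted increments cancel, which removes the term linear in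
        \<open>q\<close>.\<close>
      define A B where "A = 1 - \<theta> - (f (x + 1) - f x)" and "B = 1 - \<theta> + (f x - f (x - 1))"
      have v: "0 < v" "v \<le> 1 / 2" using p[of x] by (auto simp: v_def)
      have vals: "Q (Suc n) (Suc h) (x + 1) = q + A" "Q (Suc n) (Suc h) (x - 1) = q + B" "Q (Suc n) h x = q - \<theta>"
        by (simp_all add: Q_def q_def A_def B_def algebra_simps)
      have drift: "v * (A + B) - (1 - 2 * v) * \<theta> = 0"
        using lap[of x] unfolding A_def B_def v_def by (simp add: algebra_simps)
      have "v * ((q + A)\<^sup>2 + (q + B)\<^sup>2) + (1 - 2 * v) * (q - \<theta>)\<^sup>2
          = q\<^sup>2 + v * (A\<^sup>2 + B\<^sup>2) + (1 - 2 * v) * \<theta>\<^sup>2 + 2 * q * (v * (A + B) - (1 - 2 * v) * \<theta>)"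
        by (simp add: power2_eq_square algebra_simps)
      also have "\<dots> = q\<^sup>2 + v * (A\<^sup>2 + B\<^sup>2) + (1 - 2 * v) * \<theta>\<^sup>2" unfolding drift by simp
      also have "\<dots> \<le> q\<^sup>2 + (1 / 2) * (4 + 2 * C * (3 + 2 * \<bar>real_of_int x\<bar>)) + 1 * 1"
      proof (rule add_mono[OF add_mono[OF order_refl mult_mono] mult_mono])
        have sq: "(1 - \<theta> + d)\<^sup>2 \<le> 2 + 2 * d\<^sup>2" for d
        proof -
          have "(1 - \<theta> + d)\<^sup>2 \<le> 2 * (1 - \<theta>)\<^sup>2 + 2 * d\<^sup>2"
            using zero_le_power2[of "1 - \<theta> - d"] by (simp add: power2_eq_square algebra_simps)
          moreover have "(1 - \<theta>)\<^sup>2 \<le> 1\<^sup>2" using \<theta> by (intro power_mono) auto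
          ultimately show ?thesis by simp
        qed
        have "A\<^sup>2 \<le> 2 + 2 * (f (x + 1) - f x)\<^sup>2" using sq[of "f x - f (x + 1)"] power2_commute[of "f x" "f (x + 1)"] by (simp add: A_def algebra_simps del: power2_commute)
        moreover have "(f (x + 1) - f x)\<^sup>2 \<le> C * (1 + \<bar>real_of_int x\<bar>)" by (rule grad)
        moreover have "B\<^sup>2 \<le> 2 + 2 * (f x - f (x - 1))\<^sup>2" using sq[of "f x - f (x - 1)"] by (simp add: B_def)
        moreover have "(f x - f (x - 1))\<^sup>2 \<le> C * (1 + \<bar>real_of_int (x - 1)\<bar>)" using grad[of "x - 1"] by simp
        moreover have "C * (1 + \<bar>real_of_int (x - 1)\<bar>) \<le> C * (2 + \<bar>real_of_int x\<bar>)"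
          using C by (intro mult_left_mono) auto
        ultimately have "A\<^sup>2 + B\<^sup>2 \<le> 4 + 2 * (C * (1 + \<bar>real_of_int x\<bar>)) + 2 * (C * (2 + \<bar>real_of_int x\<bar>))"
          by linarith
        also have "\<dots> = 4 + 2 * C * (3 + 2 * \<bar>real_of_int x\<bar>)" by (simp add: algebra_simps)
        finally show "A\<^sup>2 + B\<^sup>2 \<le> 4 + 2 * C * (3 + 2 * \<bar>real_of_int x\<bar>)" .
        have "\<theta>\<^sup>2 \<le> 1\<^sup>2" using \<theta> by (intro power_mono) auto
        then show "\<theta>\<^sup>2 \<le> 1" by simp
      qed (use v in auto)
      also have "\<dots> = q\<^sup>2 + (3 + 3 * C + 2 * C * \<bar>real_of_int x\<bar>)" by (simp add: algebra_simps)
      finally show "p (xpos n \<omega>) * ((Q (Suc n) (Suc (hor n \<omega>)) (xpos n \<omega> + 1))\<^sup>2 + (Q (Suc n) (Suc (hor n \<omega>)) (xpos n \<omega> - 1))\<^sup>2)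
          + (1 - 2 * p (xpos n \<omega>)) * (Q (Suc n) (hor n \<omega>) (xpos n \<omega>))\<^sup>2
        \<le> (Q n (hor n \<omega>) (xpos n \<omega>))\<^sup>2 + (3 + 3 * C + 2 * C * \<bar>real_of_int (xpos n \<omega>)\<bar>)"
        unfolding h_def[symmetric] x_def[symmetric] vals v_def[symmetric] q_def[symmetric] .
    qed (rule hor_xpos_expectation(1)[of "\<lambda>h x. p x * ((Q (Suc n) (Suc h) (x + 1))\<^sup>2 + (Q (Suc n) (Suc h) (x - 1))\<^sup>2) + (1 - 2 * p x) * (Q (Suc n) h x)\<^sup>2"]
        hor_xpos_expectation(1)[of "\<lambda>h x. (Q n h x)\<^sup>2 + (3 + 3 * C + 2 * C * \<bar>real_of_int x\<bar>)"])+
    also have "\<dots> = expectation (\<lambda>\<omega>. (Q n (hor n \<omega>) (xpos n \<omega>))\<^sup>2) + (3 + 3 * C + 2 * C * expectation (\<lambda>\<omega>. \<bar>real_of_int (xpos n \<omega>)\<bar>))"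
      using intQ[of n n] int_hx[of "\<lambda>x. \<bar>real_of_int x\<bar>" n] by (simp add: prob_space)
    also have "\<dots> \<le> expectation (\<lambda>\<omega>. (Q n (hor n \<omega>) (xpos n \<omega>))\<^sup>2) + (3 + 3 * C + 2 * C * sqrt (real n + 1))"
      using C xpos_abs_moment[of n] by (intro add_left_mono mult_left_mono) auto
    finally show ?thesis .
  qed
  have Qb: "expectation (\<lambda>\<omega>. (Q n (hor n \<omega>) (xpos n \<omega>))\<^sup>2) \<le> real n * (3 + 3 * C + 2 * C * sqrt (real n))" for n
  proof (induction n)
    case 0 then show ?case by (simp add: Q_def f0)
  next
    case (Suc n)
    have "real n * (3 + 3 * C + 2 * C * sqrt (real n)) \<le> real n * (3 + 3 * C + 2 * C * sqrt (real n + 1))"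
      using C by (intro mult_left_mono add_left_mono) auto
    then show ?case using step[of n] Suc by (simp add: algebra_simps)
  qed
  have fb: "expectation (\<lambda>\<omega>. (f (xpos n \<omega>))\<^sup>2) \<le> 3 * C * (real n * sqrt (real n))" for n
  proof -
    have "expectation (\<lambda>\<omega>. (f (xpos n \<omega>))\<^sup>2) \<le> expectation (\<lambda>\<omega>. C * (real_of_int (xpos n \<omega>))\<^sup>2 + C * \<bar>real_of_int (xpos n \<omega>)\<bar> ^ 3)"
    proof (rule integral_mono)
      fix \<omega>
      have "\<bar>real_of_int (xpos n \<omega>)\<bar> ^ 3 = (real_of_int (xpos n \<omega>))\<^sup>2 * \<bar>real_of_int (xpos n \<omega>)\<bar>"
        by (simp add: power3_eq_cube power2_eq_square abs_mult[symmetric])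
      then show "(f (xpos n \<omega>))\<^sup>2 \<le> C * (real_of_int (xpos n \<omega>))\<^sup>2 + C * \<bar>real_of_int (xpos n \<omega>)\<bar> ^ 3"
        using growth[of "xpos n \<omega>"] by (simp add: algebra_simps)
    qed (rule int_hx[of "\<lambda>x. (f x)\<^sup>2"] int_hx[of "\<lambda>x. C * (real_of_int x)\<^sup>2 + C * \<bar>real_of_int x\<bar> ^ 3"])+
    also have "\<dots> = C * expectation (\<lambda>\<omega>. (real_of_int (xpos n \<omega>))\<^sup>2) + C * expectation (\<lambda>\<omega>. \<bar>real_of_int (xpos n \<omega>)\<bar> ^ 3)"
      using int_hx[of "\<lambda>x. (real_of_int x)\<^sup>2" n] int_hx[of "\<lambda>x. \<bar>real_of_int x\<bar> ^ 3" n] by simp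
    also have "\<dots> \<le> C * real n + C * (2 * (real n * sqrt (real n)))"
      using C xpos_second_moment[of n] xpos_third_moment[of n] by (intro add_mono mult_left_mono) auto
    also have "\<dots> \<le> C * (real n * sqrt (real n)) + C * (2 * (real n * sqrt (real n)))"
    proof -
      have "real n \<le> real n * sqrt (real n)" by (cases "n = 0") auto
      then show ?thesis using C by (intro add_right_mono mult_left_mono)
    qed
    finally show ?thesis by (simp add: algebra_simps)
  qed
  show "integrable M (\<lambda>\<omega>. (real (hor n \<omega>) - \<theta> * real n)\<^sup>2)"
    by (rule hor_xpos_expectation(1)[of "\<lambda>h x. (real h - \<theta> * real n)\<^sup>2"])
  have "expectation (\<lambda>\<omega>. (real (hor n \<omega>) - \<theta> * real n)\<^sup>2) \<le> expectation (\<lambda>\<omega>. 2 * (Q n (hor n \<omega>) (xpos n \<omega>))\<^sup>2 + 2 * (f (xpos n \<omega>))\<^sup>2)"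
  proof (rule integral_mono)
    fix \<omega>
    have "(c + d)\<^sup>2 \<le> 2 * c\<^sup>2 + 2 * d\<^sup>2" for c d :: real
      using zero_le_power2[of "c - d"] by (simp add: power2_eq_square algebra_simps)
    from this[of "Q n (hor n \<omega>) (xpos n \<omega>)" "f (xpos n \<omega>)"]
    show "(real (hor n \<omega>) - \<theta> * real n)\<^sup>2 \<le> 2 * (Q n (hor n \<omega>) (xpos n \<omega>))\<^sup>2 + 2 * (f (xpos n \<omega>))\<^sup>2"
      by (simp add: Q_def)
  qed (rule hor_xpos_expectation(1)[of "\<lambda>h x. (real h - \<theta> * real n)\<^sup>2"]
      hor_xpos_expectation(1)[of "\<lambda>h x. 2 * (Q n h x)\<^sup>2 + 2 * (f x)\<^sup>2"])+
  also have "\<dots> = 2 * expectation (\<lambda>\<omega>. (Q n (hor n \<omega>) (xpos n \<omega>))\<^sup>2) + 2 * expectation (\<lambda>\<omega>. (f (xpos n \<omega>))\<^sup>2)"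
    using intQ[of n n] int_hx[of "\<lambda>x. (f x)\<^sup>2" n] by simp
  also have "\<dots> \<le> 2 * (real n * (3 + 3 * C + 2 * C * sqrt (real n))) + 2 * (3 * C * (real n * sqrt (real n)))"
    using Qb[of n] fb[of n] by simp
  also have "\<dots> = (6 + 6 * C) * real n + 10 * C * (real n * sqrt (real n))" by (simp add: algebra_simps)
  also have "\<dots> \<le> (6 + 6 * C) * (real n * sqrt (real n)) + 10 * C * (real n * sqrt (real n))"
  proof -
    have "real n \<le> real n * sqrt (real n)" by (cases "n = 0") auto
    then show ?thesis using C by (intro add_right_mono mult_left_mono) auto
  qed
  also have "\<dots> \<le> (12 + 16 * C) * (real n * sqrt (real n))" by (simp add: algebra_simps)
  finally show "expectation (\<lambda>\<omega>. (real (hor n \<omega>) - \<theta> * real n)\<^sup>2) \<le> (12 + 16 * C) * (real n * sqrt (real n))" .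
qed

lemma hor_Suc: "hor n \<omega> \<le> hor (Suc n) \<omega>" "hor (Suc n) \<omega> \<le> Suc (hor n \<omega>)"
  by (auto simp: hor_def st_Suc split: prod.splits)

lemma hor_increment: "m \<le> n \<Longrightarrow> hor m \<omega> \<le> hor n \<omega> \<and> hor n \<omega> \<le> hor m \<omega> + (n - m)"
proof (induction n rule: dec_induct)
  case (step n) then show ?case using hor_Suc[of n \<omega>] by linarith
qed simp

text \<open>At times \<open>k ^ 8\<close> the second moment is of order \<open>k ^ 12\<close>, and
  dividing it by the square of \<open>k ^ 7\<close> gives a summable series. Between consecutive
  eighth powers the error changes by at most the gap, which is again of order \<open>k ^ 7\<close>,
  that is \<open>n powr (7 / 8)\<close>.\<close>

lemma AE_horizontal_time:
  assumes \<theta>: "0 \<le> \<theta>" "\<theta> \<le> 1"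
    and int: "\<And>n. integrable M (\<lambda>\<omega>. (real (hor n \<omega>) - \<theta> * real n)\<^sup>2)"
    and var: "\<And>n. expectation (\<lambda>\<omega>. (real (hor n \<omega>) - \<theta> * real n)\<^sup>2) \<le> K * (real n * sqrt (real n))"
  shows "AE \<omega> in M. \<forall>\<^sub>F n in sequentially. \<bar>real (hor n \<omega>) - \<theta> * real n\<bar> \<le> 1152 * real n powr (7 / 8)"
proof -
  define D where "D n \<omega> = real (hor n \<omega>) - \<theta> * real n" for n \<omega>
  have "AE \<omega> in M. summable (\<lambda>k. (D (k ^ 8) \<omega>)\<^sup>2 / real k ^ 14)"
  proof (rule AE_summable_of_summable_integral)
    show "integrable M (\<lambda>\<omega>. (D (k ^ 8) \<omega>)\<^sup>2 / real k ^ 14)" for k using int[of "k ^ 8"] by (simp add: D_def)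
    show "expectation (\<lambda>\<omega>. (D (k ^ 8) \<omega>)\<^sup>2 / real k ^ 14) \<le> K * inverse (real k ^ 2)" for k
    proof (cases "k = 0")
      case False
      have s: "sqrt (real (k ^ 8)) = real k ^ 4"
        by (rule real_sqrt_unique) (simp_all flip: power_mult)
      have "expectation (\<lambda>\<omega>. (D (k ^ 8) \<omega>)\<^sup>2 / real k ^ 14) \<le> K * (real k ^ 8 * real k ^ 4) / real k ^ 14"
        using var[of "k ^ 8"] unfolding s D_def by (simp add: divide_right_mono)
      also have "\<dots> = K * inverse (real k ^ 2)"
      proof -
        have "real k ^ 14 = (real k ^ 8 * real k ^ 4) * real k ^ 2" by (simp flip: power_add)
        moreover have "K * v / (v * w) = K * inverse w" if "v \<noteq> 0" for v w :: real
          using that by (simp add: inverse_eq_divide)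
        moreover have "real k ^ 8 * real k ^ 4 \<noteq> 0" using False by simp
        ultimately show ?thesis by (simp only:)
      qed
      finally show ?thesis .
    qed simp
    show "summable (\<lambda>k. K * inverse (real k ^ 2))"
      by (intro summable_mult inverse_power_summable) simp
  qed simp
  then show ?thesis
  proof eventually_elim
    case (elim \<omega>)
    then have "(\<lambda>k. (D (k ^ 8) \<omega>)\<^sup>2 / real k ^ 14) \<longlonglongrightarrow> 0" by (rule summable_LIMSEQ_zero)
    then have "\<forall>\<^sub>F k in sequentially. (D (k ^ 8) \<omega>)\<^sup>2 / real k ^ 14 < 1" by (rule order_tendstoD) simp
    then obtain k0 where k0: "\<And>k. k0 \<le> k \<Longrightarrow> (D (k ^ 8) \<omega>)\<^sup>2 / real k ^ 14 < 1" by (auto simp: eventually_sequentially)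
    show ?case
    proof (rule eventually_sequentiallyI[of "(k0 + 1) ^ 8"])
      fix n assume n: "(k0 + 1) ^ 8 \<le> n"
      have "\<exists>k. k ^ 8 \<le> n \<and> n < (k + 1) ^ 8"
      proof (induction n)
        case 0 show ?case by (rule exI[of _ 0]) simp
      next
        case (Suc n)
        then obtain k where k: "k ^ 8 \<le> n" "n < (k + 1) ^ 8" by blast
        show ?case
        proof (cases "Suc n < (k + 1) ^ 8")
          case True then show ?thesis using k by (intro exI[of _ k]) auto
        next
          case False
          then have "Suc n = (k + 1) ^ 8" using k by simp
          then show ?thesis by (intro exI[of _ "k + 1"]) (auto intro!: power_strict_mono)
        qed
      qed
      then obtain k where k: "k ^ 8 \<le> n" "n < (k + 1) ^ 8" by blast
      have "(k0 + 1) ^ 8 < (k + 1) ^ 8" using n k by linarith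
      then have "k0 + 1 < k + 1" by (rule power_less_imp_less_base) simp
      then have kk0: "k0 < k" by simp
      have k1: "1 \<le> real k" using kk0 by simp
      have "(D (k ^ 8) \<omega>)\<^sup>2 < real k ^ 14" using k0[of k] kk0 by (simp add: divide_less_eq)
      also have "real k ^ 14 = (real k ^ 7)\<^sup>2" by (simp flip: power_mult)
      finally have Dk: "\<bar>D (k ^ 8) \<omega>\<bar> \<le> real k ^ 7"
        by (intro power2_le_imp_le[of "\<bar>D (k ^ 8) \<omega>\<bar>"]) auto
      define m where "m = k ^ 8"
      have mn: "m \<le> n" using k by (simp add: m_def)
      have "\<bar>D n \<omega> - D m \<omega>\<bar> \<le> real (n - m)"
      proof -
        have h: "real (hor m \<omega>) \<le> real (hor n \<omega>)" "real (hor n \<omega>) \<le> real (hor m \<omega>) + real (n - m)"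
          using hor_increment[OF mn, of \<omega>] by linarith+
        have "D n \<omega> - D m \<omega> = (real (hor n \<omega>) - real (hor m \<omega>)) - \<theta> * real (n - m)"
          using mn by (simp add: D_def of_nat_diff algebra_simps)
        moreover have "0 \<le> \<theta> * real (n - m)" "\<theta> * real (n - m) \<le> 1 * real (n - m)"
          using \<theta> mult_right_mono[OF \<theta>(2), of "real (n - m)"] by simp_all
        ultimately show ?thesis using h by (intro abs_leI) linarith+
      qed
      moreover have "real (n - m) \<le> 8 * (real k + 1) ^ 7"
      proof -
        have "n - m \<le> 8 * (k + 1) ^ 7" using power_Suc_increment[of k 7] k by (simp add: m_def)
        then have "real (n - m) \<le> real (8 * (k + 1) ^ 7)" by (simp only: of_nat_le_iff)
        then show ?thesis by (simp add: add.commute)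
      qed
      ultimately have "\<bar>D n \<omega>\<bar> \<le> real k ^ 7 + 8 * (real k + 1) ^ 7" using Dk unfolding m_def by linarith
      \<comment> \<open>The constant 1152 is (1 + 8) * 2 ^ 7.\<close>
      also have "\<dots> \<le> (2 * real k) ^ 7 + 8 * (2 * real k) ^ 7"
        using k1 by (intro add_mono mult_left_mono power_mono) auto
      also have "\<dots> = 1152 * real k ^ 7" by (simp add: power_mult_distrib)
      also have "real k ^ 7 \<le> real n powr (7 / 8)"
      proof -
        have "real k ^ 7 = (real k ^ 8) powr (7 / 8)"
          using k1 by (simp add: powr_realpow[symmetric] powr_powr del: powr_numeral)
        also have "\<dots> \<le> real n powr (7 / 8)"
        proof (rule powr_mono2)
          have "real (k ^ 8) \<le> real n" using k by (simp only: of_nat_le_iff)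
          then show "real k ^ 8 \<le> real n" by simp
        qed simp_all
        finally show ?thesis .
      qed
      finally show "\<bar>real (hor n \<omega>) - \<theta> * real n\<bar> \<le> 1152 * real n powr (7 / 8)" by (simp add: D_def)
    qed
  qed
qed

end

section \<open>Pathwise estimates\<close>

lemma int_pos_neg_cases [case_names nonneg neg]:
  obtains n where "j = int n" | n where "j = - int (Suc n)"
  by (cases j) (auto simp: that)

text \<open>Two discrete integrations: \<open>G\<close> is the gradient with differences
  \<open>c\<close>, and \<open>f\<close> has gradient \<open>G\<close>. The partial sums of
  \<open>c\<close> bound \<open>G\<close> by the square root of the distance, and summing
  \<open>G\<close> bounds \<open>f\<close> by distance times its square root.\<close>

lemma potential_with_gradient_bound:
  fixes c :: "int \<Rightarrow> real"
  assumes B: "0 \<le> B" "\<And>k::nat. \<bar>\<Sum>j = 1..k. c (int j)\<bar> \<le> B * sqrt (real k)"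
    "\<And>k::nat. \<bar>\<Sum>j = 1..k. c (- int j)\<bar> \<le> B * sqrt (real k)"
  shows "\<exists>f C. 0 \<le> C \<and> f 0 = (0::real) \<and> (\<forall>j. f (j + 1) + f (j - 1) - 2 * f j = c j) \<and>
    (\<forall>j. (f (j + 1) - f j)\<^sup>2 \<le> C * (1 + \<bar>real_of_int j\<bar>)) \<and>
    (\<forall>j. (f j)\<^sup>2 \<le> C * ((real_of_int j)\<^sup>2 * (1 + \<bar>real_of_int j\<bar>)))"
proof -
  \<comment> \<open>The constants of integration are chosen such that \<open>f\<close> vanishes at 0
    and at 1. On the negative side \<open>G\<close> therefore also carries the term
    \<open>c 0\<close>, which enters the constant \<open>C\<close>.\<close>
  define G where "G j = (if 0 \<le> j then \<Sum>i = 1..nat j. c (int i) else - c 0 - (\<Sum>i = 1..nat (- 1 - j). c (- int i)))" for j :: int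
  define f where "f j = (if 0 \<le> j then \<Sum>i<nat j. G (int i) else - (\<Sum>i = 1..nat (- j). G (- int i)))" for j :: int
  define C where "C = 2 * B\<^sup>2 + 2 * (c 0)\<^sup>2"
  have C: "0 \<le> C" by (simp add: C_def)
  have Gpos: "G (int n) = (\<Sum>i = 1..n. c (int i))" for n by (simp add: G_def)
  have Gneg: "G (- int (Suc n)) = - c 0 - (\<Sum>i = 1..n. c (- int i))" for n by (simp add: G_def)
  have fpos: "f (int n) = (\<Sum>i<n. G (int i))" for n by (simp add: f_def)
  have fneg: "f (- int (Suc n)) = - (\<Sum>i = 1..Suc n. G (- int i))" for n
  proof -
    have neg: "\<not> 0 \<le> - int (Suc n)" by simp
    show ?thesis unfolding f_def if_not_P[OF neg] minus_minus nat_int ..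
  qed
  have dG: "G j - G (j - 1) = c j" for j
  proof (cases j rule: int_pos_neg_cases)
    case (nonneg n)
    show ?thesis
    proof (cases n)
      case 0 then show ?thesis using nonneg Gpos[of 0] Gneg[of 0] by simp
    next
      case (Suc m)
      then have "j - 1 = int m" using nonneg by simp
      then show ?thesis using Gpos[of m] Gpos[of "Suc m"] nonneg Suc by simp
    qed
  next
    case (neg n)
    then have "j - 1 = - int (Suc (Suc n))" by simp
    then show ?thesis using Gneg[of n] Gneg[of "Suc n"] neg by simp
  qed
  have df: "f (j + 1) - f j = G j" for j
  proof (cases j rule: int_pos_neg_cases)
    case (nonneg n)
    then have "j + 1 = int (Suc n)" by simp
    then show ?thesis using fpos[of n] fpos[of "Suc n"] nonneg by (simp add: add.commute)
  next
    case (neg n)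
    show ?thesis
    proof (cases n)
      case 0 then show ?thesis using neg fpos[of 0] fneg[of 0] by simp
    next
      case (Suc m)
      then have "j + 1 = - int (Suc m)" using neg by simp
      then show ?thesis using fneg[of m] fneg[of n] neg Suc by simp
    qed
  qed
  have Gb: "(G j)\<^sup>2 \<le> C * (1 + \<bar>real_of_int j\<bar>)" for j
  proof -
    have "\<bar>G j\<bar> \<le> B * sqrt \<bar>real_of_int j\<bar> + \<bar>c 0\<bar>"
    proof (cases j rule: int_pos_neg_cases)
      case (nonneg n) then show ?thesis using B(2)[of n] Gpos[of n] by simp
    next
      case (neg n)
      have "B * sqrt (real n) \<le> B * sqrt \<bar>real_of_int j\<bar>" using neg B(1) by (intro mult_left_mono) auto
      then show ?thesis using B(3)[of n] Gneg[of n] neg by simp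
    qed
    then have "\<bar>G j\<bar>\<^sup>2 \<le> (B * sqrt \<bar>real_of_int j\<bar> + \<bar>c 0\<bar>)\<^sup>2" by (rule power_mono) simp
    also have "\<dots> \<le> 2 * (B * sqrt \<bar>real_of_int j\<bar>)\<^sup>2 + 2 * \<bar>c 0\<bar>\<^sup>2"
      using zero_le_power2[of "B * sqrt \<bar>real_of_int j\<bar> - \<bar>c 0\<bar>"] unfolding power2_sum power2_diff by linarith
    also have "\<dots> = 2 * B\<^sup>2 * \<bar>real_of_int j\<bar> + 2 * (c 0)\<^sup>2" by (simp add: power_mult_distrib)
    also have "\<dots> \<le> C * (1 + \<bar>real_of_int j\<bar>)"
    proof -
      have "0 \<le> (c 0)\<^sup>2 * \<bar>real_of_int j\<bar>" "0 \<le> B\<^sup>2" by simp_all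
      then show ?thesis unfolding C_def distrib_left distrib_right by simp
    qed
    finally show ?thesis by simp
  qed
  have Gs: "\<bar>G j\<bar> \<le> sqrt (C * (1 + real n))" if "\<bar>j\<bar> \<le> int n" for j n
  proof -
    have "\<bar>real_of_int j\<bar> \<le> real n" using that by linarith
    then have "C * (1 + \<bar>real_of_int j\<bar>) \<le> C * (1 + real n)" using C by (intro mult_left_mono) auto
    then have "(G j)\<^sup>2 \<le> C * (1 + real n)" using Gb[of j] by linarith
    then show ?thesis using real_sqrt_le_mono by fastforce
  qed
  have fb: "(f j)\<^sup>2 \<le> C * ((real_of_int j)\<^sup>2 * (1 + \<bar>real_of_int j\<bar>))" for j
  proof -
    have key: "v\<^sup>2 \<le> C * ((real n)\<^sup>2 * (1 + real n))" if "\<bar>v\<bar> \<le> real n * sqrt (C * (1 + real n))" for v n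
    proof -
      have "\<bar>v\<bar>\<^sup>2 \<le> (real n * sqrt (C * (1 + real n)))\<^sup>2" using that by (rule power_mono) simp
      then show ?thesis using C by (simp add: power_mult_distrib mult_ac)
    qed
    show ?thesis
    proof (cases j rule: int_pos_neg_cases)
      case (nonneg n)
      have "\<bar>f j\<bar> \<le> (\<Sum>i<n. \<bar>G (int i)\<bar>)" unfolding nonneg fpos by (rule sum_abs)
      also have "\<dots> \<le> (\<Sum>i<n. sqrt (C * (1 + real n)))" by (intro sum_mono Gs) auto
      finally show ?thesis using key[of "f j" n] nonneg by simp
    next
      case (neg n)
      have "\<bar>f j\<bar> \<le> (\<Sum>i = 1..Suc n. \<bar>G (- int i)\<bar>)" unfolding neg fneg abs_minus_cancel by (rule sum_abs)
      also have "\<dots> \<le> (\<Sum>i = 1..Suc n. sqrt (C * (1 + real (Suc n))))" by (intro sum_mono Gs) auto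
      finally have "\<bar>f j\<bar> \<le> real (Suc n) * sqrt (C * (1 + real (Suc n)))" by (simp del: of_nat_Suc)
      from key[OF this] have "(f j)\<^sup>2 \<le> C * ((real (Suc n))\<^sup>2 * (1 + real (Suc n)))" .
      moreover have "real_of_int j = - real (Suc n)" using neg by simp
      ultimately show ?thesis by (simp only: power2_minus abs_minus_cancel abs_of_nat)
    qed
  qed
  have lap: "f (j + 1) + f (j - 1) - 2 * f j = c j" for j
    using dG[of j] df[of j] df[of "j - 1"] by simp
  have f0: "f 0 = 0" using fpos[of 0] by simp
  show ?thesis using C f0 lap Gb fb unfolding df[symmetric] by blast
qed

text \<open>The sum is \<open>- k / \<gamma>\<close> times the error in the hypothesis, hence
  eventually at most \<open>k powr (1 - \<eta>)\<close>, and this is below \<open>sqrt k\<close>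
  because \<open>\<eta> > 1 / 2\<close>. The finitely many remaining \<open>k\<close> are absorbed
  by the constant.\<close>

lemma centered_sum_bound:
  fixes q :: "nat \<Rightarrow> real"
  assumes \<gamma>: "1 < \<gamma>" and \<eta>: "1 / 2 < \<eta>"
    and small: "(\<lambda>k::nat. (1 / real k) * (\<Sum>j = 1..k. 1 / q j) - 2 * \<gamma>) \<in> o(\<lambda>k. real k powr (- \<eta>))"
  shows "\<exists>B\<ge>0. \<forall>k. \<bar>\<Sum>j = 1..k. 2 - (1 / \<gamma>) / q j\<bar> \<le> B * sqrt (real k)"
proof -
  define F where "F k = (\<Sum>j = 1..k. 2 - (1 / \<gamma>) / q j)" for k
  have "\<forall>\<^sub>F k in sequentially. norm ((1 / real k) * (\<Sum>j = 1..k. 1 / q j) - 2 * \<gamma>) \<le> 1 * norm (real k powr (- \<eta>))"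
    by (rule landau_o.smallD[OF small]) simp
  then have "\<forall>\<^sub>F k in sequentially. \<bar>F k\<bar> \<le> sqrt (real k)"
    using eventually_ge_at_top[of 1]
  proof eventually_elim
    case (elim k)
    then have k: "1 \<le> real k" by simp
    have "F k = 2 * real k - (1 / \<gamma>) * (\<Sum>j = 1..k. 1 / q j)"
      unfolding F_def by (simp add: sum_subtractf sum_distrib_left)
    also have "\<dots> = - (real k / \<gamma>) * ((1 / real k) * (\<Sum>j = 1..k. 1 / q j) - 2 * \<gamma>)"
      using \<gamma> k by (simp add: field_simps)
    finally have "\<bar>F k\<bar> = (real k / \<gamma>) * \<bar>(1 / real k) * (\<Sum>j = 1..k. 1 / q j) - 2 * \<gamma>\<bar>"
      using \<gamma> k by (simp add: abs_mult)
    also have "\<dots> \<le> real k * (real k powr (- \<eta>))"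
      using elim \<gamma> k by (intro mult_mono) (auto simp: divide_le_eq)
    also have "\<dots> \<le> real k * (real k powr (- (1 / 2)))"
      using k \<eta> by (intro mult_left_mono powr_mono) auto
    also have "\<dots> = sqrt (real k)"
      using k by (simp add: powr_minus powr_half_sqrt real_div_sqrt inverse_eq_divide)
    finally show ?case .
  qed
  then obtain k0 where k0: "\<And>k. k0 \<le> k \<Longrightarrow> \<bar>F k\<bar> \<le> sqrt (real k)" by (auto simp: eventually_sequentially)
  define B where "B = 1 + (\<Sum>k<k0. \<bar>F k\<bar>)"
  have B: "1 \<le> B" by (simp add: B_def sum_nonneg)
  show ?thesis
  proof (intro exI[of _ B] conjI allI)
    fix k
    have "\<bar>F k\<bar> \<le> B * sqrt (real k)"
    proof (cases "k0 \<le> k")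
      case True
      have "1 * sqrt (real k) \<le> B * sqrt (real k)" using B by (intro mult_right_mono) auto
      then show ?thesis using k0[OF True] by simp
    next
      case False
      show ?thesis
      proof (cases "k = 0")
        case True then show ?thesis by (simp add: F_def)
      next
        case k: False
        have "\<bar>F k\<bar> \<le> (\<Sum>k<k0. \<bar>F k\<bar>)" using False by (intro member_le_sum) auto
        also have "\<dots> \<le> B * 1" by (simp add: B_def)
        also have "\<dots> \<le> B * sqrt (real k)" using B k by (intro mult_left_mono) auto
        finally show ?thesis .
      qed
    qed
    then show "\<bar>\<Sum>j = 1..k. 2 - (1 / \<gamma>) / q j\<bar> \<le> B * sqrt (real k)" by (simp add: F_def)
  qed (use B in simp)
qed

text \<open>The window exponent 999/1000 must exceed 7/8, the error of the horizontal time, and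
  256/257, the length of a coupling block relative to its start. It must be below twice the
  fluctuation exponent 4999/10000 for the Chernoff argument, and the latter below 1/2 to give o(sqrt
  n).\<close>

definition slowly_fluctuating :: "(nat \<Rightarrow> real) \<Rightarrow> bool" where
  "slowly_fluctuating S \<longleftrightarrow> (\<forall>\<^sub>F i in sequentially. \<forall>j\<ge>i. real (j - i) \<le> (real i + 1) powr (999 / 1000) \<longrightarrow>
     \<bar>S j - S i\<bar> \<le> (real i + 1) powr (4999 / 10000))"

lemma block_of_at_top: "filterlim block_of at_top sequentially"
proof (rule filterlim_at_top[THEN iffD2], rule allI)
  fix Z
  show "\<forall>\<^sub>F n in sequentially. Z \<le> block_of n"
  proof (rule eventually_sequentiallyI[of "block_end Z"])
    fix n assume "block_end Z \<le> n"
    then have "block_end Z < block_end (Suc (block_of n))" using block_of_bounds(2)[of n] by linarith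
    then show "Z \<le> block_of n" using block_end_strict_mono by (simp add: strict_mono_less)
  qed
qed

text \<open>From \<open>n\<close> one goes back to the start of its block. The block fits into the
  window of slow fluctuation, so both sequences move by o(sqrt n) on the way, and at the start they
  are close by assumption.\<close>

lemma coupled_sums_close:
  assumes S: "slowly_fluctuating S" and w: "slowly_fluctuating w"
    and ends: "(\<lambda>J. (S (block_end J) - w (block_end J))\<^sup>2 / real (block_end J)) \<longlonglongrightarrow> 0"
    and e: "0 < e"
  shows "\<forall>\<^sub>F n in sequentially. \<bar>S n - w n\<bar> \<le> e * sqrt (real n)"
proof -
  let ?fl = "\<lambda>V b. \<forall>j\<ge>b. real (j - b) \<le> (real b + 1) powr (999 / 1000) \<longrightarrow> \<bar>V j - V b\<bar> \<le> (real b + 1) powr (4999 / 10000)"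
  have top: "filterlim (\<lambda>n. block_end (block_of n)) at_top sequentially"
    using filterlim_compose[OF filterlim_subseq[OF block_end_strict_mono] block_of_at_top] .
  have e1: "\<forall>\<^sub>F n in sequentially. ?fl S (block_end (block_of n))" "\<forall>\<^sub>F n in sequentially. ?fl w (block_end (block_of n))"
    using S w top unfolding slowly_fluctuating_def by (auto elim: eventually_compose_filterlim)
  have e2: "\<forall>\<^sub>F n in sequentially. (S (block_end (block_of n)) - w (block_end (block_of n)))\<^sup>2 / real (block_end (block_of n)) < (e / 2)\<^sup>2"
    using order_tendstoD(2)[OF ends, of "(e / 2)\<^sup>2"] e block_of_at_top by (auto elim: eventually_compose_filterlim)
  \<comment> \<open>True since 257 * 999 / 1000 = 256.743 exceeds 256.\<close>
  have "\<forall>\<^sub>F x in at_top. 257 * (x + 1) powr 256 \<le> (x powr 257 + 1) powr (999 / 1000 :: real)" by real_asymp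
  then have "\<forall>\<^sub>F J in sequentially. 257 * (real J + 1) powr 256 \<le> (real J powr 257 + 1) powr (999 / 1000 :: real)"
    by (rule eventually_compose_filterlim) (rule filterlim_real_sequentially)
  then have e3: "\<forall>\<^sub>F n in sequentially. 257 * (real (block_of n) + 1) powr 256 \<le> (real (block_of n) powr 257 + 1) powr (999 / 1000 :: real)"
    using block_of_at_top by (rule eventually_compose_filterlim)
  have e4: "\<forall>\<^sub>F n in sequentially. 2 * (real n + 1) powr (4999 / 10000) \<le> e / 2 * sqrt (real n)"
    using e by real_asymp
  have e5: "\<forall>\<^sub>F n in sequentially. 1 \<le> block_of n"
    using block_of_at_top by (auto simp: filterlim_at_top)
  show ?thesis
    using e1 e2 e3 e4 e5
  proof eventually_elim
    case (elim n)
    define J where "J = block_of n"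
    define b where "b = block_end J"
    have b: "b \<le> n" "n < block_end (Suc J)" using block_of_bounds[of n] by (auto simp: b_def J_def)
    have b1: "0 < real b" using elim(6) by (simp add: b_def J_def block_end_def)
    have "n - b \<le> block_length J" using b by (simp add: block_length_def b_def)
    also have "\<dots> \<le> 257 * (J + 1) ^ 256" by (rule block_length_le)
    finally have "real (n - b) \<le> real (257 * (J + 1) ^ 256)" by (simp only: of_nat_le_iff)
    also have "\<dots> = 257 * (real J + 1) powr 256" by (simp add: powr_realpow[symmetric] add.commute del: powr_numeral)
    also have "\<dots> \<le> (real J powr 257 + 1) powr (999 / 1000)" using elim(4) by (simp add: J_def)
    also have "real J powr 257 = real b" using elim(6) by (simp add: b_def block_end_def J_def)
    finally have gap: "real (n - b) \<le> (real b + 1) powr (999 / 1000)" .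
    have bn: "(real b + 1) powr (4999 / 10000) \<le> (real n + 1) powr (4999 / 10000)" using b by (intro powr_mono2) auto
    have "\<bar>S n - S b\<bar> \<le> (real b + 1) powr (4999 / 10000)" "\<bar>w n - w b\<bar> \<le> (real b + 1) powr (4999 / 10000)"
      using elim(1,2) b gap by (auto simp: b_def J_def)
    moreover have "\<bar>S b - w b\<bar> \<le> e / 2 * sqrt (real n)"
    proof -
      have "(S b - w b)\<^sup>2 \<le> (e / 2)\<^sup>2 * real b" using elim(3) b1 by (simp add: b_def J_def divide_less_eq)
      also have "\<dots> \<le> (e / 2)\<^sup>2 * real n" using b by (intro mult_left_mono) auto
      also have "\<dots> = (e / 2 * sqrt (real n))\<^sup>2" by (simp add: power_mult_distrib power_divide)
      finally have "\<bar>S b - w b\<bar>\<^sup>2 \<le> (e / 2 * sqrt (real n))\<^sup>2" by simp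
      then show ?thesis by (rule power2_le_imp_le) (use e in simp)
    qed
    ultimately have "\<bar>S n - w n\<bar> \<le> e / 2 * sqrt (real n) + 2 * (real n + 1) powr (4999 / 10000)"
      using bn by linarith
    also have "\<dots> \<le> e / 2 * sqrt (real n) + e / 2 * sqrt (real n)" using elim(5) by linarith
    finally show ?case by simp
  qed
qed

text \<open>Three replacements, with \<open>m\<close> the integer part of
  \<open>\<theta> * t\<close>: \<open>S\<close> at time \<open>K n\<close> by \<open>S m\<close>
  through slow fluctuation, \<open>S m\<close> by \<open>w m\<close> through the coupling, and
  \<open>w m\<close> by the Wiener path through its integer skeleton. The constant \<open>B\<close>
  takes care of bounded \<open>t\<close>. The lemma is applied to the horizontal steps with
  \<open>\<theta>\<close> and to the vertical steps with \<open>1 - \<theta>\<close>.\<close>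

lemma time_changed_coupling:
  fixes W :: "real \<Rightarrow> real" and K :: "nat \<Rightarrow> nat"
  assumes \<theta>: "0 < \<theta>" "\<theta> \<le> 1"
    and S: "slowly_fluctuating S" and w: "slowly_fluctuating w"
    and ends: "(\<lambda>J. (S (block_end J) - w (block_end J))\<^sup>2 / real (block_end J)) \<longlonglongrightarrow> 0"
    and W: "\<And>t. 0 \<le> t \<Longrightarrow> \<bar>W t - w (nat \<lfloor>t\<rfloor>)\<bar> \<le> C * (1 + t) powr (1 / 4)"
    and K: "\<forall>\<^sub>F n in sequentially. \<bar>real (K n) - \<theta> * real n\<bar> \<le> 1152 * real n powr (7 / 8)"
    and Kn: "\<And>n. K n \<le> n" and e: "0 < e"
  shows "\<exists>B. \<forall>t\<ge>0. \<bar>S (K (nat \<lfloor>t\<rfloor>)) - W (\<theta> * t)\<bar> \<le> e * sqrt t + B"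
proof -
  have C: "0 \<le> C" using W[of 0] by simp
  obtain i0 where i0: "\<And>i j. i0 \<le> i \<Longrightarrow> i \<le> j \<Longrightarrow> real (j - i) \<le> (real i + 1) powr (999 / 1000) \<Longrightarrow> \<bar>S j - S i\<bar> \<le> (real i + 1) powr (4999 / 10000)"
    using S unfolding slowly_fluctuating_def eventually_sequentially by blast
  have "\<forall>\<^sub>F n in sequentially. \<bar>S n - w n\<bar> \<le> e / 2 * sqrt (real n)"
    by (rule coupled_sums_close[OF S w ends]) (use e in simp)
  then obtain i1 where i1: "\<And>n. i1 \<le> n \<Longrightarrow> \<bar>S n - w n\<bar> \<le> e / 2 * sqrt (real n)"
    unfolding eventually_sequentially by blast
  \<comment> \<open>The left side bounds the distance of \<open>K n\<close> and \<open>m\<close>,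
    the right side is at most the window at the smaller of the two; it wins because 7/8 <
    999/1000.\<close>
  have ev1: "\<forall>\<^sub>F n in sequentially. 1152 * real n powr (7 / 8) + 2 \<le> (\<theta> * real n - 1152 * real n powr (7 / 8) - 1) powr (999 / 1000)"
    using \<theta> by real_asymp
  have ev2: "\<forall>\<^sub>F n in sequentially. real (max i0 i1) \<le> \<theta> * real n - 1152 * real n powr (7 / 8) - 2"
    using \<theta> by real_asymp
  have ev3: "\<forall>\<^sub>F n in sequentially. (real n + 1) powr (4999 / 10000) + C * (real n + 2) powr (1 / 4) \<le> e / 2 * sqrt (real n)"
    using e by real_asymp
  from K ev1 ev2 ev3 have "\<forall>\<^sub>F n in sequentially. \<forall>t. real n \<le> t \<longrightarrow> t < real n + 1 \<longrightarrow> \<bar>S (K n) - W (\<theta> * t)\<bar> \<le> e * sqrt t"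
  proof eventually_elim
    case (elim n)
    show ?case
    proof (intro allI impI)
      fix t assume t: "real n \<le> t" "t < real n + 1"
      have t0: "0 \<le> t" using t by linarith
      define m where "m = nat \<lfloor>\<theta> * t\<rfloor>"
      have \<theta>t: "0 \<le> \<theta> * t" "\<theta> * real n \<le> \<theta> * t" "\<theta> * t \<le> \<theta> * real n + 1" "\<theta> * t < real n + 1"
      proof -
        show "0 \<le> \<theta> * t" "\<theta> * real n \<le> \<theta> * t" using \<theta> t t0 by (auto intro: mult_left_mono)
        have "\<theta> * t \<le> \<theta> * (real n + 1)" using \<theta> t by (intro mult_left_mono) auto
        then show "\<theta> * t \<le> \<theta> * real n + 1" using \<theta> by (simp add: distrib_left)
        have "\<theta> * t \<le> 1 * t" using \<theta> t0 by (intro mult_right_mono) auto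
        then show "\<theta> * t < real n + 1" using t by simp
      qed
      have m: "real m \<le> \<theta> * t" "\<theta> * t < real m + 1" using \<theta>t(1) by (auto simp: m_def)
      have mn: "m \<le> n" using m \<theta>t by linarith
      \<comment> \<open>Slow fluctuation is one-sided in time, so the window starts at the smaller
        index.\<close>
      define i j where "i = min (K n) m" and "j = max (K n) m"
      have Kb: "\<theta> * real n - 1152 * real n powr (7 / 8) \<le> real (K n)" "real (K n) \<le> \<theta> * real n + 1152 * real n powr (7 / 8)"
        using elim(1) by linarith+
      have p0: "0 \<le> 1152 * real n powr (7 / 8)" by simp
      have ilow: "\<theta> * real n - 1152 * real n powr (7 / 8) - 2 \<le> real i"
        using Kb m \<theta>t p0 by (simp add: i_def min_def)
      have ij: "i \<le> j" by (simp add: i_def j_def)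
      have "real (j - i) \<le> 1152 * real n powr (7 / 8) + 2"
      proof -
        have "real (K n) - real m \<le> 1152 * real n powr (7 / 8) + 2" "real m - real (K n) \<le> 1152 * real n powr (7 / 8) + 2"
          using Kb m \<theta>t p0 by linarith+
        then show ?thesis by (auto simp: i_def j_def min_def max_def of_nat_diff)
      qed
      also have "\<dots> \<le> (\<theta> * real n - 1152 * real n powr (7 / 8) - 1) powr (999 / 1000)" by (rule elim(2))
      also have "\<dots> \<le> (real i + 1) powr (999 / 1000)"
        using ilow elim(3) by (intro powr_mono2) auto
      finally have gap: "real (j - i) \<le> (real i + 1) powr (999 / 1000)" .
      have ibig: "i0 \<le> i" "i1 \<le> m" using ilow elim(3) by (auto simp: i_def)
      have "\<bar>S j - S i\<bar> \<le> (real i + 1) powr (4999 / 10000)" by (rule i0[OF ibig(1) ij gap])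
      also have "\<dots> \<le> (real n + 1) powr (4999 / 10000)" using mn by (intro powr_mono2) (auto simp: i_def)
      finally have a1: "\<bar>S (K n) - S m\<bar> \<le> (real n + 1) powr (4999 / 10000)"
        by (auto simp: i_def j_def min_def max_def abs_minus_commute split: if_splits)
      have a2: "\<bar>S m - w m\<bar> \<le> e / 2 * sqrt (real n)"
      proof -
        have "e / 2 * sqrt (real m) \<le> e / 2 * sqrt (real n)" using mn e by (intro mult_left_mono) auto
        then show ?thesis using i1[OF ibig(2)] by linarith
      qed
      have a3: "\<bar>w m - W (\<theta> * t)\<bar> \<le> C * (real n + 2) powr (1 / 4)"
      proof -
        have "C * (1 + \<theta> * t) powr (1 / 4) \<le> C * (real n + 2) powr (1 / 4)"
          using C \<theta>t by (intro mult_left_mono powr_mono2) auto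
        then show ?thesis using W[OF \<theta>t(1)] by (simp add: m_def abs_minus_commute)
      qed
      have "\<bar>S (K n) - W (\<theta> * t)\<bar> \<le> e / 2 * sqrt (real n) + e / 2 * sqrt (real n)"
        using a1 a2 a3 elim(4) by linarith
      also have "\<dots> = e * sqrt (real n)" by simp
      also have "\<dots> \<le> e * sqrt t" using e t by (intro mult_left_mono) auto
      finally show "\<bar>S (K n) - W (\<theta> * t)\<bar> \<le> e * sqrt t" .
    qed
  qed
  then obtain n0 where n0: "\<And>n t. n0 \<le> n \<Longrightarrow> real n \<le> t \<Longrightarrow> t < real n + 1 \<Longrightarrow> \<bar>S (K n) - W (\<theta> * t)\<bar> \<le> e * sqrt t"
    unfolding eventually_sequentially by blast
  define B where "B = (\<Sum>k\<le>n0. \<bar>S k\<bar>) + (\<Sum>k\<le>n0. \<bar>w k\<bar>) + C * (1 + real n0) powr (1 / 4)"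
  have B: "0 \<le> B" using C by (simp add: B_def sum_nonneg)
  show ?thesis
  proof (intro exI[of _ B] allI impI)
    fix t :: real assume t: "0 \<le> t"
    define n where "n = nat \<lfloor>t\<rfloor>"
    have n: "real n \<le> t" "t < real n + 1" using t by (auto simp: n_def)
    show "\<bar>S (K (nat \<lfloor>t\<rfloor>)) - W (\<theta> * t)\<bar> \<le> e * sqrt t + B"
    proof (cases "n0 \<le> n")
      case True then show ?thesis using n0[OF True n] B by (simp add: n_def)
    next
      case False
      then have tn0: "t \<le> real n0" using n by linarith
      have \<theta>t: "0 \<le> \<theta> * t" "\<theta> * t \<le> t" using \<theta> t by (auto simp: mult_left_le_one_le)
      define m where "m = nat \<lfloor>\<theta> * t\<rfloor>"
      have "real m \<le> \<theta> * t" using \<theta>t by (simp add: m_def)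
      then have "m \<le> n0" using \<theta>t tn0 by linarith
      then have "\<bar>w m\<bar> \<le> (\<Sum>k\<le>n0. \<bar>w k\<bar>)" by (intro member_le_sum) auto
      moreover have "\<bar>S (K n)\<bar> \<le> (\<Sum>k\<le>n0. \<bar>S k\<bar>)" using False Kn[of n] by (intro member_le_sum) auto
      moreover have "\<bar>W (\<theta> * t) - w m\<bar> \<le> C * (1 + real n0) powr (1 / 4)"
      proof -
        have "C * (1 + \<theta> * t) powr (1 / 4) \<le> C * (1 + real n0) powr (1 / 4)"
          using C \<theta>t tn0 by (intro mult_left_mono powr_mono2) auto
        then show ?thesis using W[OF \<theta>t(1)] by (simp add: m_def)
      qed
      ultimately have "\<bar>S (K n) - W (\<theta> * t)\<bar> \<le> B" unfolding B_def by linarith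
      moreover have "0 \<le> e * sqrt t" using e t by simp
      ultimately show ?thesis by (simp add: n_def)
    qed
  qed
qed

lemma norm_on_plane_bound:
  assumes "norm_on_plane N"
  shows "\<exists>L>0. \<forall>x y. 0 \<le> N (x, y) \<and> N (x, y) \<le> L * (\<bar>x\<bar> + \<bar>y\<bar>)"
proof -
  have scale: "N (c *\<^sub>R v) = \<bar>c\<bar> * N v" and tri: "N (u + v) \<le> N u + N v" and zero: "N 0 = 0" for c u v
    using assms unfolding norm_on_plane_def by blast+
  have nonneg: "0 \<le> N v" for v
    using tri[of v "- 1 *\<^sub>R v"] scale[of "- 1" v] zero by simp
  define L where "L = 1 + N (1, 0) + N (0, 1)"
  show ?thesis
  proof (intro exI[of _ L] conjI allI)
    show "0 < L" using nonneg[of "(1, 0)"] nonneg[of "(0, 1)"] by (simp add: L_def)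
    fix x y :: real
    show "0 \<le> N (x, y)" by (rule nonneg)
    have "N (x, y) \<le> \<bar>x\<bar> * N (1, 0) + \<bar>y\<bar> * N (0, 1)"
      using tri[of "x *\<^sub>R (1, 0)" "y *\<^sub>R (0, 1)"] scale[of x "(1, 0)"] scale[of y "(0, 1)"] by simp
    also have "\<dots> \<le> \<bar>x\<bar> * L + \<bar>y\<bar> * L"
      using nonneg[of "(1, 0)"] nonneg[of "(0, 1)"] by (intro add_mono mult_left_mono) (auto simp: L_def)
    finally show "N (x, y) \<le> L * (\<bar>x\<bar> + \<bar>y\<bar>)" by (simp add: algebra_simps)
  qed
qed

section \<open>The probability space and the theorem\<close>

lemma block_normal_measurable [measurable]:
  "(\<lambda>z. block_normal z j) \<in> borel_measurable (PiM UNIV (\<lambda>_. borel))"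
  unfolding block_normal_def by measurable

lemma coupled_sign_measurable [measurable]:
  "(\<lambda>z. coupled_sign z n) \<in> PiM UNIV (\<lambda>_. borel) \<rightarrow>\<^sub>M count_space UNIV"
  unfolding coupled_sign_def by measurable

definition gauss_space :: "(nat \<Rightarrow> real) measure" where
  "gauss_space = PiM UNIV (\<lambda>_. std_normal_distribution)"

lemma sets_gauss_space [measurable_cong]: "sets gauss_space = sets (PiM UNIV (\<lambda>_. borel))"
  unfolding gauss_space_def by (intro sets_PiM_cong) auto

lemma prob_space_gauss_space: "prob_space gauss_space"
  unfolding gauss_space_def by (rule prob_space_PiM) (rule prob_space_std_normal_distribution)

lemma gauss_space_coordinates: "prob_space.gaussian_family gauss_space (\<lambda>i \<omega>. \<omega> i) UNIV"
proof -
  interpret prob_space gauss_space by (rule prob_space_gauss_space)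
  have rv: "random_variable borel (\<lambda>\<omega>. \<omega> i)" for i by measurable
  have d: "distr gauss_space borel (\<lambda>\<omega>. \<omega> i) = std_normal_distribution" for i
  proof -
    have "distr gauss_space borel (\<lambda>\<omega>. \<omega> i) = distr gauss_space std_normal_distribution (\<lambda>\<omega>. \<omega> i)"
      by (rule distr_cong) auto
    also have "\<dots> = std_normal_distribution"
      unfolding gauss_space_def by (rule distr_PiM_component) (auto intro: prob_space_std_normal_distribution)
    finally show ?thesis .
  qed
  have "indep_vars (\<lambda>_. borel) (\<lambda>i \<omega>. \<omega> i) UNIV"
  proof (subst indep_vars_iff_distr_eq_PiM)
    have "distr gauss_space (PiM UNIV (\<lambda>_. borel)) (\<lambda>x. \<lambda>i\<in>UNIV. x i) = distr gauss_space gauss_space (\<lambda>x. x)"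
      by (rule distr_cong) (auto simp: sets_gauss_space)
    also have "\<dots> = gauss_space" by (rule distr_id)
    finally show "distr gauss_space (PiM UNIV (\<lambda>_. borel)) (\<lambda>x. \<lambda>i\<in>UNIV. x i)
        = PiM UNIV (\<lambda>i. distr gauss_space borel (\<lambda>\<omega>. \<omega> i))"
      unfolding d by (simp add: gauss_space_def)
  qed (use rv in auto)
  then show ?thesis unfolding gaussian_family_def std_normal_iff_distr using rv d by auto
qed

lemma (in prob_space) gaussian_family_reindex:
  assumes "gaussian_family x UNIV" "inj f"
  shows "gaussian_family (\<lambda>i. x (f i)) UNIV"
  using assms indep_vars_inj_reindex[of "\<lambda>_. borel" x UNIV f UNIV] unfolding gaussian_family_def by auto

text \<open>The coordinates of the space are split into disjoint rows by their first code: row 0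
  drives the clock, rows 1 and 2 hold the Levy coefficients of the two Wiener processes.\<close>

definition wiener_index :: "nat \<Rightarrow> nat \<times> nat \<Rightarrow> nat" where
  "wiener_index c i = prod_encode (c, prod_encode i)"

text \<open>The array required by \<open>walk_noise\<close>. The signs of rows 1 and 2 are functions
  of the unit increments of the corresponding Wiener process: they are independent of each other and
  of the clock, but by design not of that process.\<close>

definition noise :: "nat \<times> nat \<Rightarrow> (nat \<Rightarrow> real) \<Rightarrow> real" where
  "noise k f = (if fst k = 0 then Phi (f (prod_encode (0, snd k)))
     else if fst k = 1 then real_of_int (coupled_sign (\<lambda>i. f (wiener_index 1 (0, i))) (snd k))
     else if fst k = 2 then real_of_int (coupled_sign (\<lambda>i. f (wiener_index 2 (0, i))) (snd k))
     else 0)"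

lemma inj_wiener_index: "inj (wiener_index c)" "inj (\<lambda>i. wiener_index c (0, i))" "inj (\<lambda>n. prod_encode (c, n))"
  by (auto simp: inj_def wiener_index_def)

text \<open>Row \<open>c\<close> depends only on the coordinates in \<open>K c\<close>, which are
  disjoint for different \<open>c\<close>. Inside a row the entries are transformed coordinates or
  coupled signs; \<open>indep_vars_blocks\<close> joins the rows.\<close>

lemma noise_indep: "prob_space.indep_vars gauss_space (\<lambda>_. borel) noise UNIV"
proof -
  interpret prob_space gauss_space by (rule prob_space_gauss_space)
  note G = gauss_space_coordinates
  have ind: "indep_vars (\<lambda>_. borel) (\<lambda>i \<omega>. \<omega> i) UNIV" using G by (simp add: gaussian_family_def)
  define F where "F c = {c} \<times> (UNIV :: nat set)" for c :: nat
  define K where "K c = range (\<lambda>n. prod_encode (c, n))" for c :: nat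
  have inK: "wiener_index c i \<in> K c" "prod_encode (c, n) \<in> K c" for c i n by (auto simp: K_def wiener_index_def)
  have un: "(\<Union>c\<in>UNIV. F c) = UNIV" by (auto simp: F_def)
  have "indep_vars (\<lambda>_. borel) noise (\<Union>c\<in>UNIV. F c)"
  proof (rule indep_vars_blocks)
    have r: "indep_vars (\<lambda>c. PiM (K c) (\<lambda>_. borel)) (\<lambda>c \<omega>. restrict (\<lambda>i. \<omega> i) (K c)) UNIV"
      by (rule indep_vars_restrict[OF ind]) (auto simp: disjoint_family_on_def K_def)
    have "indep_vars (\<lambda>c. PiM (F c) (\<lambda>_. borel)) (\<lambda>c \<omega>. (\<lambda>f. \<lambda>k\<in>F c. noise k f) (restrict (\<lambda>i. \<omega> i) (K c))) UNIV"
    proof (rule indep_vars_compose2[OF r], rule measurable_restrict)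
      fix c k assume k: "k \<in> F c"
      have comp: "(\<lambda>f. f (h i)) \<in> borel_measurable (PiM (K c) (\<lambda>_. borel :: real measure))" if "h i \<in> K c" for h :: "nat \<Rightarrow> nat" and i
        by (rule measurable_component_singleton[OF that])
      have W: "(\<lambda>f. coupled_sign (\<lambda>i. f (wiener_index c (0, i))) n) \<in> PiM (K c) (\<lambda>_. borel) \<rightarrow>\<^sub>M count_space UNIV" for n
      proof -
        have "(\<lambda>f i. f (wiener_index c (0, i))) \<in> PiM (K c) (\<lambda>_. borel :: real measure) \<rightarrow>\<^sub>M PiM UNIV (\<lambda>_. borel)"
          by (rule measurable_PiM_single') (auto intro!: comp inK)
        from measurable_compose[OF this coupled_sign_measurable] show ?thesis .
      qed
      consider "c = 0" | "c = 1" | "c = 2" | "2 < c" by linarith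
      then show "(\<lambda>f. noise k f) \<in> borel_measurable (PiM (K c) (\<lambda>_. borel))"
      proof cases
        case 1
        have "(\<lambda>f. Phi (f (prod_encode (0, snd k)))) \<in> borel_measurable (PiM (K c) (\<lambda>_. borel))"
          using comp[of "\<lambda>n. prod_encode (0, n)" "snd k"] inK(2)[of 0 "snd k"] 1
          by (intro measurable_compose[OF _ Phi_borel_measurable]) auto
        then show ?thesis using 1 k by (auto simp: noise_def F_def)
      next
        case 2 then show ?thesis using measurable_compose[OF W[of "snd k"], of real_of_int borel] k by (auto simp: noise_def F_def)
      next
        case 3 then show ?thesis using measurable_compose[OF W[of "snd k"], of real_of_int borel] k by (auto simp: noise_def F_def)
      next
        case 4 then show ?thesis using k by (auto simp: noise_def F_def)
      qed
    qed
    moreover have "noise k (restrict f (K c)) = noise k f" if "k \<in> F c" for k c f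
      using that inK(1)[of 1] inK(1)[of 2] inK(2)[of 0] by (auto simp: noise_def F_def)
    then have "(\<lambda>k\<in>F c. noise k (restrict f (K c))) = (\<lambda>k\<in>F c. noise k f)" for c f
      by (intro restrict_ext) auto
    ultimately show "indep_vars (\<lambda>c. PiM (F c) (\<lambda>_. borel)) (\<lambda>c \<omega>. \<lambda>k\<in>F c. noise k \<omega>) UNIV" by simp
    show "disjoint_family_on F UNIV" by (auto simp: disjoint_family_on_def F_def)
    fix c :: nat
    have coord: "indep_vars (\<lambda>_. borel) (\<lambda>k \<omega>. \<omega> (prod_encode (c, snd k))) (F c)"
      by (rule indep_vars_inj_reindex[OF ind]) (auto simp: inj_on_def F_def)
    have sg: "indep_vars (\<lambda>_. borel) (\<lambda>k \<omega>. real_of_int (coupled_sign (\<lambda>i. \<omega> (wiener_index c (0, i))) (snd k))) (F c)"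
    proof -
      have "gaussian_family (\<lambda>i \<omega>. \<omega> (wiener_index c (0, i))) UNIV"
        by (rule gaussian_family_reindex[OF G inj_wiener_index(2)])
      from indep_vars_inj_reindex[OF coupled_sign_iid(1)[OF this], of snd "F c"]
      have "indep_vars (\<lambda>_. count_space UNIV) (\<lambda>k \<omega>. coupled_sign (\<lambda>i. \<omega> (wiener_index c (0, i))) (snd k)) (F c)"
        by (auto simp: inj_on_def F_def)
      then show ?thesis by (rule indep_vars_compose2) auto
    qed
    consider "c = 0" | "c = 1" | "c = 2" | "2 < c" by linarith
    then show "indep_vars (\<lambda>_. borel) noise (F c)"
    proof cases
      case 1
      have "indep_vars (\<lambda>_. borel) (\<lambda>k \<omega>. Phi (\<omega> (prod_encode (c, snd k)))) (F c)"
        by (rule indep_vars_compose2[OF coord]) auto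
      then show ?thesis by (rule indep_vars_cong[THEN iffD1, rotated -1]) (use 1 in \<open>auto simp: noise_def F_def fun_eq_iff\<close>)
    next
      case 2 show ?thesis by (rule indep_vars_cong[THEN iffD1, OF _ _ _ sg]) (use 2 in \<open>auto simp: noise_def F_def fun_eq_iff\<close>)
    next
      case 3 show ?thesis by (rule indep_vars_cong[THEN iffD1, OF _ _ _ sg]) (use 3 in \<open>auto simp: noise_def F_def fun_eq_iff\<close>)
    next
      case 4
      \<comment> \<open>The zero entries of the other rows are written as functions of independent
        coordinates to obtain their independence by composition.\<close>
      have "indep_vars (\<lambda>_. borel) (\<lambda>k \<omega>. 0 * \<omega> (prod_encode (c, snd k))) (F c)"
        by (rule indep_vars_compose2[OF coord]) auto
      then show ?thesis by (rule indep_vars_cong[THEN iffD1, rotated -1]) (use 4 in \<open>auto simp: noise_def F_def fun_eq_iff\<close>)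
    qed
  qed
  then show ?thesis unfolding un .
qed

lemma (in prob_space) AE_partial_sums_slowly_fluctuating:
  assumes "indep_vars (\<lambda>_. borel) Y UNIV" "\<And>i. subgaussian (Y i)"
  shows "AE \<omega> in M. slowly_fluctuating (\<lambda>n. \<Sum>k<n. Y k \<omega>)"
  using partial_sum_fluctuation[OF assms, of "999 / 1000" "4999 / 10000"] unfolding slowly_fluctuating_def by simp

lemma scaled_difference_eq:
  "(1 / sqrt (2 * real n * l)) *\<^sub>R int_pair_to_plane z - (1 / sqrt (2 * l)) *\<^sub>R scaled_wiener \<gamma> W1 W2 n t \<omega>
    = ((real_of_int (fst z) - W1 (real n * t * (1 / \<gamma>)) \<omega>) / sqrt (2 * real n * l),
       (real_of_int (snd z) - W2 (real n * t * (1 - 1 / \<gamma>)) \<omega>) / sqrt (2 * real n * l))"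
proof -
  have "sqrt (2 * real n * l) = sqrt (2 * l) * sqrt (real n)"
    by (simp add: real_sqrt_mult ac_simps)
  then show ?thesis
    by (cases z) (simp add: int_pair_to_plane_def scaled_wiener_def diff_divide_distrib)
qed

text \<open>The normalisation is at least \<open>sqrt n\<close> once \<open>2 * ln (ln n)\<close>
  reaches 1, so bounds of the form \<open>e * sqrt n + B\<close> for every \<open>e\<close> suffice,
  and any norm is bounded by a multiple of the sum of the absolute values.\<close>

lemma sup_norm_smallo:
  fixes X Y :: "nat \<Rightarrow> real \<Rightarrow> real"
  assumes N: "norm_on_plane N"
    and X: "\<And>e. 0 < e \<Longrightarrow> \<exists>B. \<forall>n. \<forall>t\<in>{0..1}. \<bar>X n t\<bar> \<le> e * sqrt (real n) + B"
    and Y: "\<And>e. 0 < e \<Longrightarrow> \<exists>B. \<forall>n. \<forall>t\<in>{0..1}. \<bar>Y n t\<bar> \<le> e * sqrt (real n) + B"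
  shows "(\<lambda>n::nat. SUP t\<in>{0..1::real}. N (X n t / sqrt (2 * real n * ln (ln (real n))), Y n t / sqrt (2 * real n * ln (ln (real n))))) \<in> o(\<lambda>_. 1)"
proof (rule landau_o.smallI)
  fix e :: real assume e: "0 < e"
  obtain L where L: "0 < L" "\<And>x y. 0 \<le> N (x, y)" "\<And>x y. N (x, y) \<le> L * (\<bar>x\<bar> + \<bar>y\<bar>)"
    using norm_on_plane_bound[OF N] by blast
  \<comment> \<open>Each coordinate will be at most \<open>2 * d\<close>, half of it to absorb the
    additive constant, and there are two coordinates.\<close>
  define d where "d = e / (4 * L)"
  have d: "0 < d" using e L by (simp add: d_def)
  obtain B1 where B1: "\<And>n t. t \<in> {0..1} \<Longrightarrow> \<bar>X n t\<bar> \<le> d * sqrt (real n) + B1" using X[OF d] by blast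
  obtain B2 where B2: "\<And>n t. t \<in> {0..1} \<Longrightarrow> \<bar>Y n t\<bar> \<le> d * sqrt (real n) + B2" using Y[OF d] by blast
  have "\<forall>\<^sub>F n in sequentially. B1 \<le> d * sqrt (real n)" "\<forall>\<^sub>F n in sequentially. B2 \<le> d * sqrt (real n)"
    "\<forall>\<^sub>F n in sequentially. 1 \<le> 2 * ln (ln (real n))" "\<forall>\<^sub>F n in sequentially. 1 \<le> real n"
    using d by real_asymp+
  then show "\<forall>\<^sub>F n in sequentially. norm (SUP t\<in>{0..1::real}. N (X n t / sqrt (2 * real n * ln (ln (real n))), Y n t / sqrt (2 * real n * ln (ln (real n))))) \<le> e * norm (1::real)"
  proof eventually_elim
    case (elim n)
    define R where "R = sqrt (2 * real n * ln (ln (real n)))"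
    define g where "g t = N (X n t / R, Y n t / R)" for t
    have "real n * 1 \<le> real n * (2 * ln (ln (real n)))" using elim by (intro mult_left_mono) auto
    then have R: "sqrt (real n) \<le> R" by (simp add: R_def ac_simps)
    have R0: "0 < R" using R elim by (intro less_le_trans[OF _ R]) auto
    have ratio: "\<bar>v / R\<bar> \<le> 2 * d" if "\<bar>v\<bar> \<le> 2 * d * sqrt (real n)" for v
    proof -
      have "2 * d * sqrt (real n) \<le> 2 * d * R" using R d by (intro mult_left_mono) auto
      with that have "\<bar>v\<bar> \<le> 2 * d * R" by (rule order_trans)
      then show ?thesis using R0 by (simp add: pos_divide_le_eq)
    qed
    have gb: "0 \<le> g t \<and> g t \<le> e" if t: "t \<in> {0..1}" for t
    proof
      show "0 \<le> g t" unfolding g_def by (rule L)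
      have "\<bar>X n t / R\<bar> \<le> 2 * d" "\<bar>Y n t / R\<bar> \<le> 2 * d"
        using B1[OF t, of n] B2[OF t, of n] elim by (auto intro!: ratio simp del: abs_divide)
      then have "L * (\<bar>X n t / R\<bar> + \<bar>Y n t / R\<bar>) \<le> L * (2 * d + 2 * d)"
        using L by (intro mult_left_mono add_mono) auto
      also have "\<dots> = e" using L by (simp add: d_def)
      finally show "g t \<le> e" using L(3)[of "X n t / R" "Y n t / R"] unfolding g_def by linarith
    qed
    have "(SUP t\<in>{0..1}. g t) \<le> e" using gb by (intro cSUP_least) auto
    \<comment> \<open>The upper bound \<open>e\<close> for all values makes the supremum of reals
      meaningful, and comparison with \<open>g 0\<close> shows that it is nonnegative.\<close>
    moreover have "g 0 \<le> (SUP t\<in>{0..1}. g t)"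
      using gb by (intro cSUP_upper bdd_aboveI[of _ e]) auto
    ultimately have "\<bar>SUP t\<in>{0..1}. g t\<bar> \<le> e" using gb[of 0] by auto
    then show ?case by (simp add: g_def R_def)
  qed
qed

theorem theorem2:
  fixes p :: "int \<Rightarrow> real" and \<gamma> \<eta> :: real and N :: "real \<times> real \<Rightarrow> real"
  assumes "\<And>j. 0 < p j \<and> p j \<le> 1 / 2"
    and "\<exists>j. p j < 1 / 2"
    and "norm_on_plane N"
    and "1 < \<gamma>"
    and "1 / 2 < \<eta>"
    and "(\<lambda>k::nat. (1 / real k) * (\<Sum>j = 1..k. 1 / p (int j)) - 2 * \<gamma>)
           \<in> o(\<lambda>k. real k powr (- \<eta>))"
    and "(\<lambda>k::nat. (1 / real k) * (\<Sum>j = 1..k. 1 / p (- int j)) - 2 * \<gamma>)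
           \<in> o(\<lambda>k. real k powr (- \<eta>))"
  shows "\<exists>(M :: (nat \<Rightarrow> real) measure) Z W1 W2.
    prob_space M \<and>
    prob_space.anisotropic_walk M p Z \<and>
    prob_space.wiener_process M W1 \<and>
    prob_space.wiener_process M W2 \<and>
    prob_space.indep_processes M W1 W2 \<and>
    (AE \<omega> in M.
      (\<forall>n::nat. n \<ge> 3 \<longrightarrow>
        (SUP t\<in>{0..1::real}.
           N ((1 / sqrt (2 * real n * ln (ln (real n)))) *\<^sub>R
                int_pair_to_plane (Z (nat \<lfloor>real n * t\<rfloor>) \<omega>)
              - (1 / sqrt (2 * ln (ln (real n)))) *\<^sub>R scaled_wiener \<gamma> W1 W2 n t \<omega>))
        = (SUP t\<in>{0..1::real}.
             N ((real_of_int (fst (Z (nat \<lfloor>real n * t\<rfloor>) \<omega>)) - W1 (real n * t * (1 / \<gamma>)) \<omega>)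
                  / sqrt (2 * real n * ln (ln (real n))),
                (real_of_int (snd (Z (nat \<lfloor>real n * t\<rfloor>) \<omega>)) - W2 (real n * t * (1 - 1 / \<gamma>)) \<omega>)
                  / sqrt (2 * real n * ln (ln (real n)))))) \<and>
      (\<lambda>n::nat. SUP t\<in>{0..1::real}.
           N ((1 / sqrt (2 * real n * ln (ln (real n)))) *\<^sub>R
                int_pair_to_plane (Z (nat \<lfloor>real n * t\<rfloor>) \<omega>)
              - (1 / sqrt (2 * ln (ln (real n)))) *\<^sub>R scaled_wiener \<gamma> W1 W2 n t \<omega>))
        \<in> o(\<lambda>_. 1))"
proof -
  interpret prob_space gauss_space by (rule prob_space_gauss_space)
  \<comment> \<open>The asymptotic proportion of horizontal steps.\<close>
  define \<theta> where "\<theta> = 1 / \<gamma>"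
  have \<theta>: "0 < \<theta>" "\<theta> < 1" using assms(4) by (auto simp: \<theta>_def)
  obtain B1 where B1: "0 \<le> B1" "\<And>k. \<bar>\<Sum>j = 1..k. 2 - \<theta> / p (int j)\<bar> \<le> B1 * sqrt (real k)"
    using centered_sum_bound[OF assms(4,5,6)] unfolding \<theta>_def by blast
  obtain B2 where B2: "0 \<le> B2" "\<And>k. \<bar>\<Sum>j = 1..k. 2 - \<theta> / p (- int j)\<bar> \<le> B2 * sqrt (real k)"
    using centered_sum_bound[OF assms(4,5,7)] unfolding \<theta>_def by blast
  have "\<exists>f C. 0 \<le> C \<and> f 0 = (0::real) \<and> (\<forall>j. f (j + 1) + f (j - 1) - 2 * f j = 2 - \<theta> / p j) \<and>
    (\<forall>j. (f (j + 1) - f j)\<^sup>2 \<le> C * (1 + \<bar>real_of_int j\<bar>)) \<and>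
    (\<forall>j. (f j)\<^sup>2 \<le> C * ((real_of_int j)\<^sup>2 * (1 + \<bar>real_of_int j\<bar>)))"
  proof (rule potential_with_gradient_bound[where B = "max B1 B2"])
    fix k :: nat
    show "\<bar>\<Sum>j = 1..k. 2 - \<theta> / p (int j)\<bar> \<le> max B1 B2 * sqrt (real k)"
      using B1(2)[of k] by (rule order_trans) (auto intro: mult_right_mono)
    show "\<bar>\<Sum>j = 1..k. 2 - \<theta> / p (- int j)\<bar> \<le> max B1 B2 * sqrt (real k)"
      using B2(2)[of k] by (rule order_trans) (auto intro: mult_right_mono)
  qed (use B1 in simp)
  then obtain f C where f: "0 \<le> C" "f 0 = (0::real)" "\<And>j. f (j + 1) + f (j - 1) - 2 * f j = 2 - \<theta> / p j"
    "\<And>j. (f (j + 1) - f j)\<^sup>2 \<le> C * (1 + \<bar>real_of_int j\<bar>)"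
    "\<And>j. (f j)\<^sup>2 \<le> C * ((real_of_int j)\<^sup>2 * (1 + \<bar>real_of_int j\<bar>))"
    by blast
  have lap: "p j * (f (j + 1) + f (j - 1) - 2 * f j) = 2 * p j - \<theta>" for j
  proof -
    have "p j \<noteq> 0" using assms(1)[of j] by auto
    then show ?thesis unfolding f(3) by (simp add: field_simps)
  qed
  define x where "x c i \<omega> = \<omega> (wiener_index c i)" for c i and \<omega> :: "nat \<Rightarrow> real"
  \<comment> \<open>The level-0 coefficients, which are the increments of the process
    \<open>W c\<close> over unit intervals. The signs \<open>sg c\<close> are built from them, so
    \<open>S c\<close> follows \<open>W c\<close>.\<close>
  define z where "z c k \<omega> = x c (0, k) \<omega>" for c k and \<omega> :: "nat \<Rightarrow> real"
  define W where "W c t \<omega> = levy_path (\<lambda>i. x c i \<omega>) t" for c t and \<omega> :: "nat \<Rightarrow> real"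
  define sg where "sg c k \<omega> = coupled_sign (\<lambda>i. z c i \<omega>) k" for c k and \<omega> :: "nat \<Rightarrow> real"
  define u where "u n \<omega> = Phi (\<omega> (prod_encode (0, n)))" for n and \<omega> :: "nat \<Rightarrow> real"
  have gx: "gaussian_family (x c) UNIV" for c
    unfolding x_def[abs_def] by (rule gaussian_family_reindex[OF gauss_space_coordinates inj_wiener_index(1)])
  have gz: "gaussian_family (z c) UNIV" for c
    unfolding x_def[abs_def] z_def[abs_def] by (rule gaussian_family_reindex[OF gauss_space_coordinates inj_wiener_index(2)])
  have wien: "wiener_process (W c)" for c
    using levy_path_wiener[OF gx[of c]] by (simp add: W_def[abs_def])
  have indW: "indep_processes (W 1) (W 2)"
  proof -
    have "indep_vars (\<lambda>_. borel) (\<lambda>i \<omega>. \<omega> i) UNIV" using gauss_space_coordinates by (simp add: gaussian_family_def)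
    moreover have "range (wiener_index 1) \<inter> range (wiener_index 2) = {}" by (auto simp: wiener_index_def)
    ultimately show ?thesis unfolding W_def[abs_def] x_def by (rule indep_processes_levy_path)
  qed
  interpret walk: walk_noise gauss_space p u "sg 1" "sg 2" noise
  proof
    show "0 < p j" "p j \<le> 1 / 2" for j using assms(1) by auto
    show "prob {\<omega> \<in> space gauss_space. u n \<omega> < c} = c" if "0 \<le> c" "c \<le> 1" for c n
      unfolding u_def using gauss_space_coordinates that by (intro prob_std_normal_Phi_less) (auto simp: gaussian_family_def)
    show "fair_sign (sg 1 n)" "fair_sign (sg 2 n)" for n
      unfolding sg_def[abs_def] by (rule coupled_sign_iid(2)[OF gz])+
    show "noise (0, n) \<omega> = u n \<omega>" "noise (1, n) \<omega> = real_of_int (sg 1 n \<omega>)" "noise (2, n) \<omega> = real_of_int (sg 2 n \<omega>)" for n \<omega>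
      by (simp_all add: noise_def u_def sg_def z_def x_def)
    show "indep_vars (\<lambda>_. borel) noise UNIV" by (rule noise_indep)
  qed
  define Z where "Z n \<omega> = snd (walk.st n \<omega>)" for n \<omega>
  define S where "S c n \<omega> = (\<Sum>k<n. real_of_int (sg c k \<omega>))" for c n and \<omega> :: "nat \<Rightarrow> real"
  define w where "w c n \<omega> = (\<Sum>k<n. z c k \<omega>)" for c n and \<omega> :: "nat \<Rightarrow> real"
  have Z: "real_of_int (fst (Z n \<omega>)) = S 1 (walk.hor n \<omega>) \<omega>" "real_of_int (snd (Z n \<omega>)) = S 2 (n - walk.hor n \<omega>) \<omega>" for n \<omega>
    using walk.xpos_sum[of n \<omega>] walk.ypos_sum[of n \<omega>] unfolding Z_def S_def walk.xpos_def by simp_all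
  have aeS: "AE \<omega> in gauss_space. slowly_fluctuating (\<lambda>n. S c n \<omega>)" for c
    unfolding S_def
  proof (rule AE_partial_sums_slowly_fluctuating)
    show "indep_vars (\<lambda>_. borel) (\<lambda>k \<omega>. real_of_int (sg c k \<omega>)) UNIV"
      unfolding sg_def by (rule indep_vars_compose2[OF coupled_sign_iid(1)[OF gz]]) auto
    show "subgaussian (\<lambda>\<omega>. real_of_int (sg c k \<omega>))" for k
      unfolding sg_def by (rule subgaussian_fair_sign[OF coupled_sign_iid(2)[OF gz]])
  qed
  have aew: "AE \<omega> in gauss_space. slowly_fluctuating (\<lambda>n. w c n \<omega>)" for c
    unfolding w_def using gz[of c] by (intro AE_partial_sums_slowly_fluctuating subgaussian_std_normal) (auto simp: gaussian_family_def)
  have aeb: "AE \<omega> in gauss_space. (\<lambda>J. (S c (block_end J) \<omega> - w c (block_end J) \<omega>)\<^sup>2 / real (block_end J)) \<longlonglongrightarrow> 0" for c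
    using AE_block_coupling[OF gz[of c]] by (simp add: S_def w_def sg_def)
  have aeW: "AE \<omega> in gauss_space. \<exists>C. \<forall>t\<ge>0. \<bar>W c t \<omega> - w c (nat \<lfloor>t\<rfloor>) \<omega>\<bar> \<le> C * (1 + t) powr (1 / 4)" for c
    using AE_levy_path_integer_skeleton[OF gx[of c]] by (simp add: W_def w_def z_def)
  note var = walk.horizontal_time_variance[OF less_imp_le[OF \<theta>(1)] less_imp_le[OF \<theta>(2)] f(1) lap f(2) f(4) f(5)]
  have aeH: "AE \<omega> in gauss_space. \<forall>\<^sub>F n in sequentially. \<bar>real (walk.hor n \<omega>) - \<theta> * real n\<bar> \<le> 1152 * real n powr (7 / 8)"
    by (rule walk.AE_horizontal_time[OF less_imp_le[OF \<theta>(1)] less_imp_le[OF \<theta>(2)] var])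
  have main: "AE \<omega> in gauss_space. (\<lambda>n::nat. SUP t\<in>{0..1::real}.
        N ((real_of_int (fst (Z (nat \<lfloor>real n * t\<rfloor>) \<omega>)) - W 1 (real n * t * (1 / \<gamma>)) \<omega>) / sqrt (2 * real n * ln (ln (real n))),
           (real_of_int (snd (Z (nat \<lfloor>real n * t\<rfloor>) \<omega>)) - W 2 (real n * t * (1 - 1 / \<gamma>)) \<omega>) / sqrt (2 * real n * ln (ln (real n)))))
        \<in> o(\<lambda>_. 1)"
    using aeS[of 1] aeS[of 2] aew[of 1] aew[of 2] aeb[of 1] aeb[of 2] aeW[of 1] aeW[of 2] aeH
  proof eventually_elim
    case (elim \<omega>)
    obtain C1 where C1: "\<And>t. 0 \<le> t \<Longrightarrow> \<bar>W 1 t \<omega> - w 1 (nat \<lfloor>t\<rfloor>) \<omega>\<bar> \<le> C1 * (1 + t) powr (1 / 4)" using elim(7) by blast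
    obtain C2 where C2: "\<And>t. 0 \<le> t \<Longrightarrow> \<bar>W 2 t \<omega> - w 2 (nat \<lfloor>t\<rfloor>) \<omega>\<bar> \<le> C2 * (1 + t) powr (1 / 4)" using elim(8) by blast
    have elimV: "\<forall>\<^sub>F n in sequentially. \<bar>real (n - walk.hor n \<omega>) - (1 - \<theta>) * real n\<bar> \<le> 1152 * real n powr (7 / 8)"
      using elim(9)
    proof eventually_elim
      case (elim n)
      have "real (n - walk.hor n \<omega>) - (1 - \<theta>) * real n = - (real (walk.hor n \<omega>) - \<theta> * real n)"
        using walk.hor_le[of n \<omega>] by (simp add: of_nat_diff algebra_simps)
      then show ?case using elim by (simp only: abs_minus_cancel)
    qed
    \<comment> \<open>The bound at time \<open>n * t\<close> is at most the one at time
      \<open>n\<close>, which makes it uniform over \<open>t\<close> in the unit interval.\<close>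
    have scale: "\<exists>B. \<forall>n::nat. \<forall>t\<in>{0..1::real}. \<bar>V (nat \<lfloor>real n * t\<rfloor>) - U (c * (real n * t))\<bar> \<le> e * sqrt (real n) + B"
      if B: "\<exists>B. \<forall>t\<ge>0. \<bar>V (nat \<lfloor>t\<rfloor>) - U (c * t)\<bar> \<le> e * sqrt t + B" and e: "0 < e" for V :: "nat \<Rightarrow> real" and U :: "real \<Rightarrow> real" and c e
    proof -
      obtain B where B: "\<And>t. 0 \<le> t \<Longrightarrow> \<bar>V (nat \<lfloor>t\<rfloor>) - U (c * t)\<bar> \<le> e * sqrt t + B" using B by blast
      show ?thesis
      proof (intro exI[of _ B] allI ballI)
        fix n :: nat and t :: real assume t: "t \<in> {0..1}"
        have "real n * t \<le> real n * 1" using t by (intro mult_left_mono) auto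
        then have "e * sqrt (real n * t) \<le> e * sqrt (real n)" using e by (intro mult_left_mono) auto
        moreover have "0 \<le> real n * t" using t by simp
        ultimately show "\<bar>V (nat \<lfloor>real n * t\<rfloor>) - U (c * (real n * t))\<bar> \<le> e * sqrt (real n) + B"
          using B[of "real n * t"] by linarith
      qed
    qed
    show ?case
    proof (rule sup_norm_smallo[OF assms(3)])
      fix e :: real assume e: "0 < e"
      have "\<exists>B. \<forall>t\<ge>0. \<bar>S 1 (walk.hor (nat \<lfloor>t\<rfloor>) \<omega>) \<omega> - W 1 (\<theta> * t) \<omega>\<bar> \<le> e * sqrt t + B"
        by (rule time_changed_coupling[where W = "\<lambda>t. W 1 t \<omega>" and K = "\<lambda>n. walk.hor n \<omega>",
              OF \<theta>(1) less_imp_le[OF \<theta>(2)] elim(1) elim(3) elim(5) C1 elim(9) walk.hor_le e])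
      from scale[OF this e]
      show "\<exists>B. \<forall>n. \<forall>t\<in>{0..1}. \<bar>real_of_int (fst (Z (nat \<lfloor>real n * t\<rfloor>) \<omega>)) - W 1 (real n * t * (1 / \<gamma>)) \<omega>\<bar> \<le> e * sqrt (real n) + B"
        unfolding Z \<theta>_def by (simp add: mult.commute)
      have "\<exists>B. \<forall>t\<ge>0. \<bar>S 2 (nat \<lfloor>t\<rfloor> - walk.hor (nat \<lfloor>t\<rfloor>) \<omega>) \<omega> - W 2 ((1 - \<theta>) * t) \<omega>\<bar> \<le> e * sqrt t + B"
        by (rule time_changed_coupling[where W = "\<lambda>t. W 2 t \<omega>" and K = "\<lambda>n. n - walk.hor n \<omega>",
              OF _ _ elim(2) elim(4) elim(6) C2 elimV _ e]) (use \<theta> in auto)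
      from scale[of "\<lambda>n. S 2 (n - walk.hor n \<omega>) \<omega>" "\<lambda>t. W 2 t \<omega>" "1 - \<theta>", OF this e]
      show "\<exists>B. \<forall>n. \<forall>t\<in>{0..1}. \<bar>real_of_int (snd (Z (nat \<lfloor>real n * t\<rfloor>) \<omega>)) - W 2 (real n * t * (1 - 1 / \<gamma>)) \<omega>\<bar> \<le> e * sqrt (real n) + B"
        unfolding Z \<theta>_def by (simp add: mult.commute)
    qed
  qed
  have walkZ: "anisotropic_walk p Z" unfolding Z_def[abs_def] by (rule walk.anisotropic_walk)
  show ?thesis
    \<comment> \<open>In coordinates both suprema of the claim are the same expression, so the
      estimate \<open>main\<close> serves for both.\<close>
    unfolding scaled_difference_eq
    by (intro exI[of _ gauss_space] exI[of _ Z] exI[of _ "W 1"] exI[of _ "W 2"] conjI)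
      (use prob_space_gauss_space walkZ wien indW main in auto)
qed

end
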